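(* Let $E=\{x_n\}\subseteq\mathbb{R}^d$ be a separated sequence that is symmetric about $0$, and let $\Lambda\subseteq\widehat{\mathbb{R}}^d$ be an S-set of strict multiplicity that is compact, convex, and symmetric about $0$. Assume balayage is possible for $(E,\Lambda)$. Let $g\in L^2(\mathbb{R}^d)$, $\widehat g=G$, with $\|g\|_2=1$. (a) There exists $A>0$ such that for all $f\in PW_\Lambda\setminus\{0\}$, with $\widehat f=F$, $$A\|f\|_2^2=A\|F\|_2^2\le\sum_{x\in E}\int|V_GF(\omega,x)|^2\,d\omega=\sum_{x\in E}\int|V_gf(x,\omega)|^2\,d\omega.$$ (b) If moreover $g\in\mathcal{S}_0(\mathbb{R}^d)$, then there exists $B>0$ such that for all $f\in PW_\Lambda\setminus\{0\}$, with $\widehat f=F$, $$\sum_{x\in E}\int|V_gf(x,\omega)|^2\,d\omega=\sum_{x\in E}\int|V_GF(\omega,-x)|^2\,d\omega\le B\|F\|_2^2=B\|f\|_2^2,$$ where $B$ can be taken as $2^{d/2}\,C\,\|V_{g_0}g\|_1^2$ with $C=\sup_{u\in\mathbb{R}^d}\sum_{x\in E}e^{-\|x-u\|^2}$.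
   Context: Fourier transform: $\widehat f(\gamma)=\int f(x)e^{-2\pi i x\cdot\gamma}dx$; $\widehat{\mathbb{R}}^d$ denotes $\mathbb{R}^d$ as frequency domain. $PW_\Lambda=\{f\in L^2(\mathbb{R}^d):\operatorname{supp}(\widehat f)\subseteq\Lambda\}$. Short-time Fourier transform: for $f,g\in L^2(\mathbb{R}^d)$, $V_gf(x,\omega)=\int f(t)\overline{g(t-x)}e^{-2\pi i t\cdot\omega}dt$; analogously, for $F,G\in L^2(\widehat{\mathbb{R}}^d)$, $V_GF(\omega,x)=\int F(t)\overline{G(t-\omega)}e^{-2\pi i t\cdot x}dt$. $g_0(x)=2^{d/4}e^{-\pi\|x\|^2}$; the Feichtinger algebra is $\mathcal{S}_0(\mathbb{R}^d)=\{f\in L^2(\mathbb{R}^d):\|V_{g_0}f\|_{L^1(\mathbb{R}^{2d})}<\infty\}$. $M_b(X)$: bounded complex Radon measures supported in closed $X$. $\mathcal{C}(\Lambda)=\{f\in C_b(\mathbb{R}^d):\operatorname{supp}(\widehat f)\subseteq\Lambda\}$. Balayage is possible for $(E,\Lambda)$ if for every $\mu\in M_b(\mathbb{R}^d)$ there is $\nu\in M_b(E)$ with $\widehat\mu=\widehat\nu$ on $\Lambda$. $\Lambda$ closed is an S-set if for all $f\in\mathcal{C}(\Lambda)$ and $\mu\in M_b(\mathbb{R}^d)$ with $\widehat\mu=0$ on $\Lambda$, $\int f\,d\mu=0$. $\Lambda$ closed is of strict multiplicity if some $\mu\in M_b(\Lambda)\setminus\{0\}$ has $|\mu^\vee(x)|\to0$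 as $\|x\|\to\infty$. $E$ separated: $\inf\{\|x-y\|:x\ne y\in E\}>0$. *)

theory Defs
  imports "HOL-Analysis.Analysis"
begin

definition L2fun :: "('a::euclidean_space \<Rightarrow> complex) \<Rightarrow> bool" where
  "L2fun f \<longleftrightarrow> f \<in> borel_measurable lborel \<and> integrable lborel (\<lambda>x. (cmod (f x))\<^sup>2)"

definition L2sq :: "('a::euclidean_space \<Rightarrow> complex) \<Rightarrow> ennreal" where
  "L2sq f = (\<integral>\<^sup>+ x. ennreal ((cmod (f x))\<^sup>2) \<partial>lborel)"

definition fourier1 :: "('a::euclidean_space \<Rightarrow> complex) \<Rightarrow> 'a \<Rightarrow> complex" where
  "fourier1 f \<gamma> = (\<integral> x. f x * cis (- 2 * pi * (x \<bullet> \<gamma>)) \<partial>lborel)"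

definition is_fourier_L2 :: "('a::euclidean_space \<Rightarrow> complex) \<Rightarrow> ('a \<Rightarrow> complex) \<Rightarrow> bool" where
  "is_fourier_L2 f F \<longleftrightarrow> L2fun F \<and>
     ((\<lambda>R::real. \<integral>\<^sup>+ \<gamma>. ennreal ((cmod (F \<gamma> -
         (LINT x:cball 0 R|lborel. f x * cis (- 2 * pi * (x \<bullet> \<gamma>)))))\<^sup>2) \<partial>lborel)
       \<longlongrightarrow> 0) at_top"

definition PW :: "'a::euclidean_space set \<Rightarrow> ('a \<Rightarrow> complex) set" where
  "PW \<Lambda> = {f. L2fun f \<and> (\<exists>F. is_fourier_L2 f F \<and> (AE \<gamma> in lborel. \<gamma> \<notin> \<Lambda> \<longrightarrow> F \<gamma> = 0))}"

text \<open>V_g f(x,w) = int f(t) conj(g(t-x)) e^{-2 pi i t.w} dt.  The same formula also gives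
  V_G F(w,x) for functions on the frequency domain (first argument = translation parameter).\<close>
definition STFT :: "('a::euclidean_space \<Rightarrow> complex) \<Rightarrow> ('a \<Rightarrow> complex) \<Rightarrow> 'a \<Rightarrow> 'a \<Rightarrow> complex" where
  "STFT g f x \<omega> = (\<integral> t. f t * cnj (g (t - x)) * cis (- 2 * pi * (t \<bullet> \<omega>)) \<partial>lborel)"

definition gauss0 :: "'a::euclidean_space \<Rightarrow> complex" where
  "gauss0 x = complex_of_real (2 powr (real DIM('a) / 4) * exp (- pi * (norm x)\<^sup>2))"

definition S0norm :: "('a::euclidean_space \<Rightarrow> complex) \<Rightarrow> ennreal" where
  "S0norm g = (\<integral>\<^sup>+ p. ennreal (cmod (STFT gauss0 g (fst p) (snd p))) \<partial>(lborel \<Otimes>\<^sub>M lborel))"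

definition Feichtinger :: "('a::euclidean_space \<Rightarrow> complex) set" where
  "Feichtinger = {g. L2fun g \<and> S0norm g < \<infinity>}"

text \<open>A complex measure is represented as mu1 - mu2 + i (mu3 - mu4) with finite positive
  Borel measures mu_k.\<close>
type_synonym 'a cmeasure = "'a measure \<times> 'a measure \<times> 'a measure \<times> 'a measure"

definition fin_borel :: "'a::euclidean_space measure \<Rightarrow> bool" where
  "fin_borel M \<longleftrightarrow> sets M = sets borel \<and> finite_measure M"

definition cm_parts :: "'a cmeasure \<Rightarrow> 'a measure list" where
  "cm_parts \<mu> = (case \<mu> of (m1, m2, m3, m4) \<Rightarrow> [m1, m2, m3, m4])"

definition Mb :: "'a::euclidean_space set \<Rightarrow> 'a cmeasure set" where
  "Mb X = {\<mu>. \<forall>m \<in> set (cm_parts \<mu>). fin_borel m \<and> emeasure m (UNIV - X) = 0}"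

definition cm_val :: "'a::euclidean_space cmeasure \<Rightarrow> 'a set \<Rightarrow> complex" where
  "cm_val \<mu> A = (case \<mu> of (m1, m2, m3, m4) \<Rightarrow>
     complex_of_real (measure m1 A - measure m2 A) + \<i> * complex_of_real (measure m3 A - measure m4 A))"

definition cm_zero :: "'a::euclidean_space cmeasure \<Rightarrow> bool" where
  "cm_zero \<mu> \<longleftrightarrow> (\<forall>A \<in> sets borel. cm_val \<mu> A = 0)"

definition cm_integral :: "'a::euclidean_space cmeasure \<Rightarrow> ('a \<Rightarrow> complex) \<Rightarrow> complex" where
  "cm_integral \<mu> f = (case \<mu> of (m1, m2, m3, m4) \<Rightarrow>
     integral\<^sup>L m1 f - integral\<^sup>L m2 f + \<i> * (integral\<^sup>L m3 f - integral\<^sup>L m4 f))"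

definition cm_fourier :: "'a::euclidean_space cmeasure \<Rightarrow> 'a \<Rightarrow> complex" where
  "cm_fourier \<mu> \<gamma> = cm_integral \<mu> (\<lambda>x. cis (- 2 * pi * (x \<bullet> \<gamma>)))"

definition cm_ifourier :: "'a::euclidean_space cmeasure \<Rightarrow> 'a \<Rightarrow> complex" where
  "cm_ifourier \<mu> x = cm_integral \<mu> (\<lambda>\<gamma>. cis (2 * pi * (x \<bullet> \<gamma>)))"

definition dir_deriv :: "'a::euclidean_space \<Rightarrow> ('a \<Rightarrow> complex) \<Rightarrow> 'a \<Rightarrow> complex" where
  "dir_deriv v f x = vector_derivative (\<lambda>t::real. f (x + t *\<^sub>R v)) (at 0)"

definition smooth_fun :: "('a::euclidean_space \<Rightarrow> complex) \<Rightarrow> bool" where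
  "smooth_fun f \<longleftrightarrow> (\<forall>vs. set vs \<subseteq> Basis \<longrightarrow>
     continuous_on UNIV (foldr dir_deriv vs f) \<and>
     (\<forall>v \<in> Basis. \<forall>x. (\<lambda>t::real. foldr dir_deriv vs f (x + t *\<^sub>R v)) differentiable (at 0)))"

definition tsupport :: "('a::euclidean_space \<Rightarrow> complex) \<Rightarrow> 'a set" where
  "tsupport \<phi> = closure {x. \<phi> x \<noteq> 0}"

definition test_fun :: "('a::euclidean_space \<Rightarrow> complex) \<Rightarrow> bool" where
  "test_fun \<phi> \<longleftrightarrow> smooth_fun \<phi> \<and> compact (tsupport \<phi>)"

text \<open>supp(hat f) \<subseteq> Lambda in the distributional sense: <hat f, phi> = <f, hat phi> = 0 for
  all test functions phi supported off Lambda.\<close>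
definition spec_in :: "('a::euclidean_space \<Rightarrow> complex) \<Rightarrow> 'a set \<Rightarrow> bool" where
  "spec_in f \<Lambda> \<longleftrightarrow> (\<forall>\<phi>. test_fun \<phi> \<and> tsupport \<phi> \<inter> \<Lambda> = {} \<longrightarrow>
     (\<integral> x. f x * fourier1 \<phi> x \<partial>lborel) = 0)"

definition Cb_spec :: "'a::euclidean_space set \<Rightarrow> ('a \<Rightarrow> complex) set" where
  "Cb_spec \<Lambda> = {f. continuous_on UNIV f \<and> bounded (range f) \<and> spec_in f \<Lambda>}"

definition S_set :: "'a::euclidean_space set \<Rightarrow> bool" where
  "S_set \<Lambda> \<longleftrightarrow> closed \<Lambda> \<and> (\<forall>f \<in> Cb_spec \<Lambda>. \<forall>\<mu> \<in> Mb UNIV.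
     (\<forall>\<gamma> \<in> \<Lambda>. cm_fourier \<mu> \<gamma> = 0) \<longrightarrow> cm_integral \<mu> f = 0)"

definition strict_multiplicity :: "'a::euclidean_space set \<Rightarrow> bool" where
  "strict_multiplicity \<Lambda> \<longleftrightarrow> closed \<Lambda> \<and>
     (\<exists>\<mu> \<in> Mb \<Lambda>. \<not> cm_zero \<mu> \<and> ((\<lambda>x. cmod (cm_ifourier \<mu> x)) \<longlongrightarrow> 0) at_infinity)"

definition balayage :: "'a::euclidean_space set \<Rightarrow> 'a set \<Rightarrow> bool" where
  "balayage E \<Lambda> \<longleftrightarrow> (\<forall>\<mu> \<in> Mb UNIV. \<exists>\<nu> \<in> Mb E. \<forall>\<gamma> \<in> \<Lambda>. cm_fourier \<mu> \<gamma> = cm_fourier \<nu> \<gamma>)"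

definition separated :: "'a::euclidean_space set \<Rightarrow> bool" where
  "separated E \<longleftrightarrow> (\<exists>\<delta>>0. \<forall>x\<in>E. \<forall>y\<in>E. x \<noteq> y \<longrightarrow> \<delta> \<le> dist x y)"

definition stft_energy :: "'a::euclidean_space set \<Rightarrow> ('a \<Rightarrow> 'a \<Rightarrow> complex) \<Rightarrow> ennreal" where
  "stft_energy E V = (\<integral>\<^sup>+ x. (\<integral>\<^sup>+ \<omega>. ennreal ((cmod (V x \<omega>))\<^sup>2) \<partial>lborel) \<partial>count_space E)"

end

theory Submission
  imports Defs "HOL-Probability.Characteristic_Functions"
begin

text \<open>
  For fixed \<open>\<omega>\<close> the map \<open>x \<mapsto> V\<^sub>G F (\<omega>, x)\<close> is the Fourier transform of \<open>F \<cdot> cnj (G (\<cdot> - \<omega>))\<close>, which is supported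
  in \<open>\<Lambda>\<close>. Hence (a) follows, by integrating over \<open>\<omega>\<close>, from a lower frame bound
  \<open>A \<parallel>H\<parallel>\<^sup>2 \<le> \<Sum>x\<in>E. |H^(x)|\<^sup>2\<close> for \<open>H\<close> supported in \<open>\<Lambda>\<close>. If \<open>\<Lambda>\<close> has empty interior it is a null set by
  convexity. Otherwise balayage gives a sampling inequality \<open>sup |f| \<le> K sup\<^sub>E |f|\<close> for band-limited \<open>f\<close>;
  a compactness argument in the style of Beurling extends it to the dilate \<open>(1 + \<epsilon>) \<Lambda>\<close>, and applying it to
  \<open>f \<cdot> h (\<cdot> - y)\<close> for a fixed square-integrable \<open>h\<close> with small spectrum and integrating the squares over
  \<open>y\<close> yields the frame bound.

  For (b), Plancherel turns the energy into \<open>\<integral> |f t|\<^sup>2 \<Sum>x\<in>E. |g (t - x)|\<^sup>2\<close>. Fourier inversion on the slices of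
  \<open>V g\<close> with respect to the Gaussian window \<open>g\<^sub>0\<close> bounds \<open>|g|\<close> by the convolution of \<open>g\<^sub>0\<close> with the
  marginal \<open>\<integral> |V g (\<cdot>, \<omega>)| d\<omega>\<close>, so that Cauchy-Schwarz reduces the sum over \<open>E\<close> to one over Gaussians.
\<close>

subsection \<open>Lebesgue measure and Gaussians\<close>

text \<open>Balayage sweeps each measure separately and gives no bound for the mass of the result,
  whereas a frame bound needs one constant for all functions; uniformity over point masses is
  therefore extracted first, in \<open>swept_uniform\<close>. The test functions are transforms of
  integrable functions. They vanish at infinity, so coordinatewise limits of configurations of
  bounded mass still act correctly on them, even if mass escapes to infinity.

  The dilation is forced by the localiser \<open>h\<close>: it turns a sup-norm inequality into a
  square-summable one, but multiplying by it adds a small ball to the spectrum. If \<Lambda>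
  contains the ball of radius \<rho> about 0, convexity puts \<Lambda> plus a ball of radius
  \<epsilon>\<rho> inside (1 + \<epsilon>) \<Lambda>, which is exactly the room that dilated
  sampling provides.

  In (b) each factor of the constant has its own source: one \<open>S0norm g\<close> is the total
  mass in Cauchy-Schwarz, the other comes from integrating the marginal once more, 2^(d/2) is the
  peak of the squared window, and C bounds the sum of its profile exp(-2 pi |.|^2) over E, because 2
  pi \<ge> 1.\<close>

abbreviation sqnorm :: "complex \<Rightarrow> ennreal" where
  "sqnorm z \<equiv> ennreal ((cmod z)\<^sup>2)"

lemma nn_integral_lborel_affine:
  fixes f :: "'a::euclidean_space \<Rightarrow> ennreal"
  assumes [measurable]: "f \<in> borel_measurable borel" and c: "c \<noteq> 0"
  shows "(\<integral>\<^sup>+x. f x \<partial>lborel) = ennreal (\<bar>c\<bar> ^ DIM('a)) * (\<integral>\<^sup>+x. f (t + c *\<^sub>R x) \<partial>lborel)"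
  by (subst lborel_affine[OF c, of t])
     (simp add: nn_integral_density nn_integral_distr nn_integral_cmult ennreal_power)

lemma integrable_lborel_affine:
  fixes f :: "'a::euclidean_space \<Rightarrow> 'b :: {banach, second_countable_topology}"
  assumes f[measurable]: "integrable lborel f" and c: "c \<noteq> 0"
  shows "integrable lborel (\<lambda>x. f (t + c *\<^sub>R x))"
proof -
  have "(\<integral>\<^sup>+x. ennreal (norm (f x)) \<partial>lborel)
      = ennreal (\<bar>c\<bar> ^ DIM('a)) * (\<integral>\<^sup>+x. ennreal (norm (f (t + c *\<^sub>R x))) \<partial>lborel)"
    by (rule nn_integral_lborel_affine[OF _ c]) measurable
  then show ?thesis
    using f c unfolding integrable_iff_bounded by (auto simp: ennreal_mult_less_top)
qed

lemma integral_lborel_affine: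
  fixes f :: "'a::euclidean_space \<Rightarrow> 'b :: {banach, second_countable_topology}"
  assumes f[measurable]: "integrable lborel f" and c: "c \<noteq> 0"
  shows "(\<integral>x. f x \<partial>lborel) = \<bar>c\<bar> ^ DIM('a) *\<^sub>R (\<integral>x. f (t + c *\<^sub>R x) \<partial>lborel)"
  using integrable_lborel_affine[OF f c, of t]
  by (subst lborel_affine[OF c, of t])
     (simp add: integral_density integral_distr ennreal_power)

lemma nn_integral_lborel_shift:
  fixes f :: "'a::euclidean_space \<Rightarrow> ennreal"
  assumes [measurable]: "f \<in> borel_measurable borel"
  shows "(\<integral>\<^sup>+x. f (x - t) \<partial>lborel) = (\<integral>\<^sup>+x. f x \<partial>lborel)"
  using nn_integral_lborel_affine[OF assms, of 1 "-t"] by simp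

lemma nn_integral_lborel_reflect:
  fixes f :: "'a::euclidean_space \<Rightarrow> ennreal"
  assumes [measurable]: "f \<in> borel_measurable borel"
  shows "(\<integral>\<^sup>+x. f (t - x) \<partial>lborel) = (\<integral>\<^sup>+x. f x \<partial>lborel)"
  using nn_integral_lborel_affine[OF assms, of "-1" "t"] by simp

lemma integrable_lborel_shift:
  fixes f :: "'a::euclidean_space \<Rightarrow> 'b :: {banach, second_countable_topology}"
  assumes f: "integrable lborel f"
  shows "integrable lborel (\<lambda>x. f (x - t))"
  using integrable_lborel_affine[OF f, of 1 "-t"] by simp

lemma integral_lborel_shift:
  fixes f :: "'a::euclidean_space \<Rightarrow> 'b :: {banach, second_countable_topology}"
  assumes f: "integrable lborel f"
  shows "(\<integral>x. f (x - t) \<partial>lborel) = (\<integral>x. f x \<partial>lborel)"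
  using integral_lborel_affine[OF f, of 1 "-t"] by simp

text \<open>Fubini over the coordinates; it reduces the Gaussian on the whole space to the Gaussian
  on the line.\<close>

lemma integrable_lborel_prod:
  fixes f :: "'a::euclidean_space \<Rightarrow> real \<Rightarrow> complex"
  assumes f: "\<And>b. b \<in> Basis \<Longrightarrow> integrable lborel (f b)"
  shows "integrable lborel (\<lambda>x::'a. \<Prod>b\<in>Basis. f b (x \<bullet> b))" (is ?A)
    and "(\<integral>x. (\<Prod>b\<in>Basis. f b (x \<bullet> b)) \<partial>lborel) = (\<Prod>b\<in>Basis. (\<integral>x. f b x \<partial>lborel))" (is ?B)
proof -
  interpret product_sigma_finite "\<lambda>_::'a. lborel::real measure"
    by standard
  have [measurable]: "f b \<in> borel_measurable borel" if "b \<in> Basis" for b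
    using borel_measurable_integrable[OF f[OF that]] by simp
  let ?P = "Pi\<^sub>M (Basis::'a set) (\<lambda>_. lborel :: real measure)"
  let ?F = "\<lambda>x::'a. \<Prod>b\<in>Basis. f b (x \<bullet> b)"
  let ?T = "\<lambda>w::'a\<Rightarrow>real. \<Sum>b\<in>Basis. w b *\<^sub>R b"
  have F[measurable]: "?F \<in> borel_measurable borel"
    by measurable
  have T[measurable]: "?T \<in> ?P \<rightarrow>\<^sub>M borel"
    by measurable
  have TF: "?F (?T w) = (\<Prod>b\<in>Basis. f b (w b))" for w
    by (rule prod.cong) auto
  have int: "integrable ?P (\<lambda>w. \<Prod>b\<in>Basis. f b (w b))"
    by (rule product_integrable_prod) (auto intro: f)
  have "integrable (distr ?P borel ?T) ?F"
    by (subst integrable_distr_eq) (use int in \<open>auto simp: TF\<close>)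
  then show ?A by (simp flip: lborel_eq)
  have "integral\<^sup>L (lborel::'a measure) ?F = integral\<^sup>L (distr ?P borel ?T) ?F"
    by (simp flip: lborel_eq)
  also have "\<dots> = integral\<^sup>L ?P (\<lambda>w. \<Prod>b\<in>Basis. f b (w b))"
    by (subst integral_distr) (auto simp: TF)
  also have "\<dots> = (\<Prod>b\<in>Basis. (\<integral>x. f b x \<partial>lborel))"
    by (rule product_integral_prod) (auto intro: f)
  finally show ?B .
qed

text \<open>Normalised to have integral 1 and to be its own Fourier transform. It serves as
  summability factor, as mollifier and as profile of the window.\<close>

definition gau :: "'a::euclidean_space \<Rightarrow> real" where
  "gau x = exp (- pi * (norm x)\<^sup>2)"

lemma gau_nonneg: "0 \<le> gau x" and gau_le1: "gau x \<le> 1"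
  and gau_0: "gau 0 = 1" and gau_minus [simp]: "gau (- x) = gau x"
  by (auto simp: gau_def)

lemma gau_measurable [measurable]: "gau \<in> borel_measurable borel"
  unfolding gau_def by measurable

text \<open>The characteristic function of the standard normal law, rescaled by
  \<open>sqrt (2 * pi)\<close>, which turns its density into exp(-pi x^2).\<close>

lemma fourier_gau_real:
  fixes s :: real
  shows "integrable lborel (\<lambda>x::real. exp (- pi * x\<^sup>2) * cis (- 2 * pi * (x * s)))" (is ?A)
    and "(\<integral>x. exp (- pi * x\<^sup>2) * cis (- 2 * pi * (x * s)) \<partial>lborel) = exp (- pi * s\<^sup>2)" (is ?B)
proof -
  define c where "c = sqrt (2 * pi)"
  have c: "c > 0" "c\<^sup>2 = 2 * pi" "c * c = 2 * pi"
    by (auto simp: c_def)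
  \<comment> \<open>Chosen so that the phase \<open>t * (c * x)\<close> is -2 pi x s.\<close>
  define t where "t = - s * c"
  have t: "t * c = - 2 * pi * s" "t\<^sup>2 / 2 = pi * s\<^sup>2"
    using c by (auto simp: t_def power_mult_distrib)
  let ?h = "\<lambda>x. std_normal_density x *\<^sub>R iexp (t * x)"
  have i1: "integrable lborel ?h"
    by (rule Bochner_Integration.integrable_bound[of lborel std_normal_density])
       (auto simp: integrable_normal_density normal_density_nonneg)
  have eq: "c *\<^sub>R ?h (0 + c * x) = exp (- pi * x\<^sup>2) * cis (- 2 * pi * (x * s))" for x
  proof -
    have "t * (c * x) = - 2 * pi * (x * s)" using arg_cong[OF t(1), of "\<lambda>u. u * x"] by (simp add: mult_ac)
    then have "iexp (t * (c * x)) = cis (- 2 * pi * (x * s))"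
      by (simp add: cis_conv_exp)
    moreover have "c * std_normal_density (c * x) = exp (- pi * x\<^sup>2)"
      using c by (simp add: std_normal_density_def power_mult_distrib c_def[symmetric])
    ultimately show ?thesis by (simp add: scaleR_conv_of_real flip: of_real_mult mult.assoc)
  qed
  have "integrable lborel (\<lambda>x. c *\<^sub>R ?h (0 + c * x))"
    using lborel_integrable_real_affine[OF i1, of c 0] c by (intro integrable_scaleR_right) blast
  then show ?A unfolding eq .
  have "exp (- pi * s\<^sup>2) = char std_normal_distribution t"
    by (simp add: char_std_normal_distribution t)
  also have "\<dots> = (\<integral>x. ?h x \<partial>lborel)"
    unfolding char_def by (subst integral_density) (auto simp: normal_density_nonneg)
  also have "\<dots> = \<bar>c\<bar> *\<^sub>R (\<integral>x. ?h (0 + c * x) \<partial>lborel)"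
    by (rule lborel_integral_real_affine) (use c in auto)
  also have "\<dots> = (\<integral>x. c *\<^sub>R ?h (0 + c * x) \<partial>lborel)"
    using c(1) by (simp only: integral_scaleR_right abs_of_pos)
  also have "\<dots> = (\<integral>x. exp (- pi * x\<^sup>2) * cis (- 2 * pi * (x * s)) \<partial>lborel)"
    unfolding eq ..
  finally show ?B by simp
qed

lemma cis_sum: "finite A \<Longrightarrow> cis (sum f A) = (\<Prod>x\<in>A. cis (f x))"
  by (induction rule: finite_induct) (auto simp: cis_mult[symmetric])

lemma gau_prod: "gau (x::'a::euclidean_space) = (\<Prod>b\<in>Basis. exp (- pi * (x \<bullet> b)\<^sup>2))"
proof -
  have "(norm x)\<^sup>2 = (\<Sum>b\<in>Basis. (x \<bullet> b)\<^sup>2)"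
    by (subst power2_norm_eq_inner, subst euclidean_inner) (simp add: power2_eq_square)
  then show ?thesis
    by (simp add: gau_def exp_sum[symmetric] sum_distrib_left sum_negf)
qed

lemma fourier_gau_cis:
  fixes \<gamma> :: "'a::euclidean_space"
  shows "integrable lborel (\<lambda>x. gau x * cis (- 2 * pi * (x \<bullet> \<gamma>)))" (is ?A)
    and "(\<integral>x. gau x * cis (- 2 * pi * (x \<bullet> \<gamma>)) \<partial>lborel) = gau \<gamma>" (is ?B)
proof -
  let ?f = "\<lambda>b (x::real). complex_of_real (exp (- pi * x\<^sup>2)) * cis (- 2 * pi * (x * (\<gamma> \<bullet> b)))"
  have eq: "(\<Prod>b\<in>Basis. ?f b (x \<bullet> b)) = gau x * cis (- 2 * pi * (x \<bullet> \<gamma>))" for x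
  proof -
    have "cis (- 2 * pi * (x \<bullet> \<gamma>)) = (\<Prod>b\<in>Basis. cis (- 2 * pi * ((x \<bullet> b) * (\<gamma> \<bullet> b))))"
      by (subst cis_sum[symmetric]) (auto simp: euclidean_inner[of x \<gamma>] sum_distrib_left)
    then show ?thesis
      by (simp add: gau_prod prod.distrib)
  qed
  show ?A ?B
    using integrable_lborel_prod[of ?f] fourier_gau_real unfolding eq
    by (auto simp: gau_prod)
qed

lemma integrable_gau: "integrable lborel (gau :: 'a::euclidean_space \<Rightarrow> real)"
  using integrable_Re[OF fourier_gau_cis(1)[of "0::'a"]] by simp

lemma integral_gau: "integral\<^sup>L lborel (gau :: 'a::euclidean_space \<Rightarrow> real) = 1"
proof -
  have "complex_of_real (integral\<^sup>L lborel (gau :: 'a \<Rightarrow> real)) = of_real 1"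
    using fourier_gau_cis(2)[of "0::'a"] by (simp add: gau_0)
  then show ?thesis by (simp only: of_real_eq_iff)
qed

lemma nn_integral_gau: "(\<integral>\<^sup>+x. ennreal (gau (x::'a::euclidean_space)) \<partial>lborel) = 1"
  by (subst nn_integral_eq_integral) (auto simp: integrable_gau integral_gau gau_nonneg)

subsection \<open>The Fourier transform on \<open>L\<^sup>1\<close>\<close>

lemma cis_measurable [measurable]: "cis \<in> borel_measurable borel"
  by (intro borel_measurable_continuous_onI continuous_intros)

lemma fourier1_integrand_integrable:
  fixes f :: "'a::euclidean_space \<Rightarrow> complex"
  assumes f[measurable]: "integrable lborel f"
  shows "integrable lborel (\<lambda>x. f x * cis (s * (x \<bullet> \<gamma>)))"
proof -
  show ?thesis
    by (rule Bochner_Integration.integrable_bound[OF f]) (auto simp: norm_mult)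
qed

lemma cnj_measurable [measurable]: "cnj \<in> borel_measurable borel"
  by (intro borel_measurable_continuous_onI continuous_intros)

lemma fourier1_measurable [measurable]:
  fixes f :: "'a::euclidean_space \<Rightarrow> complex"
  assumes [measurable]: "f \<in> borel_measurable borel"
  shows "fourier1 f \<in> borel_measurable borel"
  unfolding fourier1_def by measurable

lemma norm_fourier1_le:
  fixes f :: "'a::euclidean_space \<Rightarrow> complex"
  shows "cmod (fourier1 f \<gamma>) \<le> (\<integral>x. cmod (f x) \<partial>lborel)"
proof -
  have "cmod (fourier1 f \<gamma>) \<le> (\<integral>x. cmod (f x * cis (- 2 * pi * (x \<bullet> \<gamma>))) \<partial>lborel)"
    unfolding fourier1_def by (rule integral_norm_bound)
  then show ?thesis by (simp add: norm_mult)
qed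

lemma continuous_on_fourier1:
  fixes f :: "'a::euclidean_space \<Rightarrow> complex"
  assumes f[measurable]: "integrable lborel f"
  shows "continuous_on UNIV (fourier1 f)"
proof -
  have "isCont (fourier1 f) \<gamma>" for \<gamma>
    unfolding continuous_at_sequentially comp_def fourier1_def
  proof (intro allI impI)
    fix u assume "u \<longlonglongrightarrow> \<gamma>"
    then show "(\<lambda>n. \<integral>x. f x * cis (- 2 * pi * (x \<bullet> u n)) \<partial>lborel)
        \<longlonglongrightarrow> (\<integral>x. f x * cis (- 2 * pi * (x \<bullet> \<gamma>)) \<partial>lborel)"
      by (intro integral_dominated_convergence[where w="\<lambda>x. cmod (f x)"])
         (auto intro!: tendsto_intros integrable_norm f simp: norm_mult)
  qed
  then show ?thesis by (simp add: continuous_on_eq_continuous_at)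
qed

lemma fourier1_shift:
  fixes f :: "'a::euclidean_space \<Rightarrow> complex"
  assumes f: "integrable lborel f"
  shows "fourier1 (\<lambda>x. f (x - a)) \<gamma> = cis (- 2 * pi * (a \<bullet> \<gamma>)) * fourier1 f \<gamma>"
proof -
  have "fourier1 (\<lambda>x. f (x - a)) \<gamma>
      = (\<integral>x. cis (- 2 * pi * (a \<bullet> \<gamma>)) * (f (x - a) * cis (- 2 * pi * ((x - a) \<bullet> \<gamma>))) \<partial>lborel)"
    unfolding fourier1_def by (rule Bochner_Integration.integral_cong) (auto simp: algebra_simps cis_mult)
  also have "\<dots> = cis (- 2 * pi * (a \<bullet> \<gamma>)) * fourier1 f \<gamma>"
    using integral_lborel_shift[OF fourier1_integrand_integrable[OF f, of "-2*pi" \<gamma>], of a]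
    by (simp add: fourier1_def)
  finally show ?thesis .
qed

lemma fourier1_modulate:
  "fourier1 (\<lambda>x. f x * cis (2 * pi * (x \<bullet> a))) \<gamma> = fourier1 f (\<gamma> - a)"
  unfolding fourier1_def
  by (rule Bochner_Integration.integral_cong) (auto simp: cis_mult algebra_simps)

lemma fourier1_cnj: "fourier1 (\<lambda>x. cnj (f x)) \<gamma> = cnj (fourier1 f (- \<gamma>))"
proof -
  have "fourier1 (\<lambda>x. cnj (f x)) \<gamma> = (\<integral>x. cnj (f x * cis (- 2 * pi * (x \<bullet> - \<gamma>))) \<partial>lborel)"
    unfolding fourier1_def by (rule Bochner_Integration.integral_cong) (auto simp: cis_cnj)
  then show ?thesis
    by (simp add: fourier1_def del: complex_cnj_mult)
qed

lemma fourier1_mult_right: "fourier1 (\<lambda>x. c * f x) \<gamma> = c * fourier1 f \<gamma>"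
  by (simp add: fourier1_def mult.assoc)

lemma fourier1_add:
  assumes "integrable lborel f" "integrable lborel g"
  shows "fourier1 (\<lambda>x. f x + g x) \<gamma> = fourier1 f \<gamma> + fourier1 g \<gamma>"
  using fourier1_integrand_integrable[OF assms(1), of "-2*pi" \<gamma>]
    fourier1_integrand_integrable[OF assms(2), of "-2*pi" \<gamma>]
  by (simp add: fourier1_def distrib_right)

lemma fourier1_diff:
  assumes "integrable lborel f" "integrable lborel g"
  shows "fourier1 (\<lambda>x. f x - g x) \<gamma> = fourier1 f \<gamma> - fourier1 g \<gamma>"
  using fourier1_integrand_integrable[OF assms(1), of "-2*pi" \<gamma>]
    fourier1_integrand_integrable[OF assms(2), of "-2*pi" \<gamma>]
  by (simp add: fourier1_def left_diff_distrib)

lemma integrable_pair_mult: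
  fixes f g :: "'a::euclidean_space \<Rightarrow> complex"
  assumes f[measurable]: "integrable lborel f" and g[measurable]: "integrable lborel g"
    and h[measurable]: "h \<in> borel_measurable (lborel \<Otimes>\<^sub>M lborel)" and h1: "\<And>x. cmod (h x) \<le> 1"
  shows "integrable (lborel \<Otimes>\<^sub>M lborel) (\<lambda>(x, y). f x * g y * h (x, y))"
proof -
  have "integrable (lborel \<Otimes>\<^sub>M lborel) (\<lambda>(x, y). f x * g y)"
  proof (rule lborel_pair.Fubini_integrable, goal_cases)
    case 2
    have "(\<lambda>x. \<integral>y. cmod (case (x, y) of (x, y) \<Rightarrow> f x * g y) \<partial>lborel)
        = (\<lambda>x. cmod (f x) * (\<integral>y. cmod (g y) \<partial>lborel))"
      by (simp add: norm_mult)
    then show ?case using f by simp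
  qed (use g in auto)
  then show ?thesis
    by (rule Bochner_Integration.integrable_bound)
       (auto simp: norm_mult mult_left_le h1)
qed

lemma fourier1_multiplication_formula:
  fixes f g :: "'a::euclidean_space \<Rightarrow> complex"
  assumes f[measurable]: "integrable lborel f" and g[measurable]: "integrable lborel g"
  shows "(\<integral>x. fourier1 f x * g x \<partial>lborel) = (\<integral>x. f x * fourier1 g x \<partial>lborel)"
proof -
  have I: "integrable (lborel \<Otimes>\<^sub>M lborel) (\<lambda>(x, y). f x * g y * cis (- 2 * pi * (x \<bullet> y)))"
    using integrable_pair_mult[OF f g, of "\<lambda>p. cis (- 2 * pi * (fst p \<bullet> snd p))"] by simp
  have "(\<integral>y. fourier1 f y * g y \<partial>lborel) = (\<integral>y. (\<integral>x. f x * g y * cis (- 2 * pi * (x \<bullet> y)) \<partial>lborel) \<partial>lborel)"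
    unfolding fourier1_def
    by (intro Bochner_Integration.integral_cong refl, subst integral_mult_left_zero[symmetric])
       (simp add: mult_ac)
  also have "\<dots> = (\<integral>x. (\<integral>y. f x * g y * cis (- 2 * pi * (x \<bullet> y)) \<partial>lborel) \<partial>lborel)"
    by (rule lborel_pair.Fubini_integral[OF I])
  also have "\<dots> = (\<integral>x. f x * fourier1 g x \<partial>lborel)"
    unfolding fourier1_def
    by (intro Bochner_Integration.integral_cong refl, subst integral_mult_right_zero[symmetric])
       (simp add: mult_ac inner_commute)
  finally show ?thesis .
qed

subsection \<open>Inversion and the Plancherel identity\<close>

text \<open>Outer regularity replaces A by an open U with U - A small; a point of an open U stays in
  U under small shifts, so dominated convergence applies to U.\<close>

lemma L1_translation_indicator:
  fixes A :: "'a::euclidean_space set"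
  assumes A[measurable]: "A \<in> sets borel" and fin: "emeasure lborel A < \<infinity>" and w: "w \<longlonglongrightarrow> 0"
  shows "(\<lambda>n. \<integral>x. \<bar>indicator A (x - w n) - indicator A x :: real\<bar> \<partial>lborel) \<longlonglongrightarrow> 0"
proof (rule LIMSEQ_I)
  fix e :: real assume e: "0 < e"
  obtain U where U: "open U" "A \<subseteq> U" "emeasure lborel (U - A) < e / 4"
    using outer_regular_lborel[OF A, of "e/4"] e by auto
  have [measurable]: "U \<in> sets borel" using U by auto
  have eU: "emeasure lborel U < \<infinity>"
  proof -
    have "emeasure lborel U \<le> emeasure lborel A + emeasure lborel (U - A)"
      using emeasure_subadditive[of A lborel "U - A"] U by (simp add: Un_absorb1)
    also have "\<dots> < \<infinity>" using fin less_trans[OF U(3) ennreal_less_top] by (simp add: less_top)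
    finally show ?thesis .
  qed
  let ?I = "indicator :: 'a set \<Rightarrow> 'a \<Rightarrow> real"
  have iU: "integrable lborel (?I U)" and iUA: "integrable lborel (?I (U - A))" and iA: "integrable lborel (?I A)"
    using eU less_trans[OF U(3) ennreal_less_top] fin by auto
  have mUA: "integral\<^sup>L lborel (?I (U - A)) < e / 4"
  proof -
    have "ennreal (integral\<^sup>L lborel (?I (U - A))) = emeasure lborel (U - A)"
      using less_trans[OF U(3) ennreal_less_top] by (simp add: emeasure_eq_ennreal_measure)
    then have "ennreal (integral\<^sup>L lborel (?I (U - A))) < ennreal (e / 4)" using U(3) by simp
    then show ?thesis using e by (subst (asm) ennreal_less_iff) auto
  qed
  \<comment> \<open>The product form confines the argument to points of U, so nothing has to be
    known about the boundary of U.\<close>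
  have lim: "(\<lambda>n. \<integral>x. ?I U x * ?I U (x - w n) \<partial>lborel) \<longlonglongrightarrow> (\<integral>x. ?I U x * ?I U x \<partial>lborel)"
  proof (rule integral_dominated_convergence[where w="?I U"])
    show "AE x in lborel. (\<lambda>n. ?I U x * ?I U (x - w n)) \<longlonglongrightarrow> ?I U x * ?I U x"
    proof (intro AE_I2)
      fix x
      show "(\<lambda>n. ?I U x * ?I U (x - w n)) \<longlonglongrightarrow> ?I U x * ?I U x"
      proof (cases "x \<in> U")
        case True
        have "(\<lambda>n. x - w n) \<longlonglongrightarrow> x" using w by (auto intro!: tendsto_eq_intros)
        then have "eventually (\<lambda>n. x - w n \<in> U) sequentially"
          by (rule topological_tendstoD[OF _ U(1) True])
        then show ?thesis
          by (intro tendsto_eventually) (auto elim!: eventually_mono simp: True)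
      qed auto
    qed
  qed (use iU in \<open>auto split: split_indicator\<close>)
  have "eventually (\<lambda>n. \<bar>(\<integral>x. ?I U x * ?I U (x - w n) \<partial>lborel) - (\<integral>x. ?I U x * ?I U x \<partial>lborel)\<bar> < e / 4) sequentially"
    using LIMSEQ_D[OF lim, of "e/4"] e by (auto simp: eventually_sequentially)
  then obtain N where N: "\<And>n. n \<ge> N \<Longrightarrow> \<bar>(\<integral>x. ?I U x * ?I U (x - w n) \<partial>lborel) - (\<integral>x. ?I U x * ?I U x \<partial>lborel)\<bar> < e / 4"
    by (auto simp: eventually_sequentially)
  show "\<exists>N. \<forall>n\<ge>N. norm ((\<integral>x. \<bar>?I A (x - w n) - ?I A x\<bar> \<partial>lborel) - 0) < e"
  proof (intro exI allI impI)
    fix n assume n: "n \<ge> N"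
    have iUw: "integrable lborel (\<lambda>x. ?I U (x - w n))" "integrable lborel (\<lambda>x. ?I (U - A) (x - w n))"
      by (rule integrable_lborel_shift[OF iU] integrable_lborel_shift[OF iUA])+
    have iUU: "integrable lborel (\<lambda>x. ?I U x * ?I U (x - w n))"
      by (rule Bochner_Integration.integrable_bound[OF iU]) (auto split: split_indicator)
    have iAA: "integrable lborel (\<lambda>x. \<bar>?I A (x - w n) - ?I A x\<bar>)"
      using integrable_lborel_shift[OF iA] iA by auto
    have UU: "(\<integral>x. ?I U x * ?I U x \<partial>lborel) = (\<integral>x. ?I U x \<partial>lborel)"
      by (rule Bochner_Integration.integral_cong) (auto split: split_indicator)
    \<comment> \<open>For indicator values a, b of U the distance |a - b| is a + b - 2ab; passing
      from A to U costs the indicator of U - A at both points.\<close>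
    have "(\<integral>x. \<bar>?I A (x - w n) - ?I A x\<bar> \<partial>lborel)
        \<le> (\<integral>x. (?I U (x - w n) + ?I U x - 2 * (?I U x * ?I U (x - w n))) + (?I (U - A) (x - w n) + ?I (U - A) x) \<partial>lborel)"
      using U(2) iUw iUU iU iUA iAA
      by (intro integral_mono) (auto split: split_indicator)
    also have "\<dots> = 2 * (\<integral>x. ?I U x \<partial>lborel) - 2 * (\<integral>x. ?I U x * ?I U (x - w n) \<partial>lborel) + 2 * integral\<^sup>L lborel (?I (U - A))"
      using iUw iUU iU iUA integral_lborel_shift[OF iU, of "w n"] integral_lborel_shift[OF iUA, of "w n"]
      by (simp del: integral_indicator)
    also have "\<dots> < e"
      using N[OF n] mUA unfolding UU by linarith
    finally show "norm ((\<integral>x. \<bar>?I A (x - w n) - ?I A x\<bar> \<partial>lborel) - 0) < e"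
      by simp
  qed
qed

text \<open>Density argument: in the limit step the L^1 distance between f and \<open>s i\<close>
  enters twice, since it is invariant under translation.\<close>

lemma L1_translation_continuous:
  fixes f :: "'a::euclidean_space \<Rightarrow> complex"
  assumes f: "integrable lborel f" and w: "w \<longlonglongrightarrow> 0"
  shows "(\<lambda>n. \<integral>x. cmod (f (x - w n) - f x) \<partial>lborel) \<longlonglongrightarrow> 0"
  using f
proof (induction rule: integrable_induct)
  case (base A c)
  have "(\<lambda>n. cmod c * (\<integral>x. \<bar>indicator A (x - w n) - indicator A x :: real\<bar> \<partial>lborel)) \<longlonglongrightarrow> cmod c * 0"
    using base by (intro tendsto_intros L1_translation_indicator w) auto
  moreover have "cmod (indicator A (x - w n) *\<^sub>R c - indicator A x *\<^sub>R c)
      = cmod c * \<bar>indicator A (x - w n) - indicator A x :: real\<bar>" for x n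
    by (simp flip: scaleR_left_diff_distrib)
  ultimately show ?case by simp
next
  case (add f g)
  have "(\<lambda>n. (\<integral>x. cmod (f (x - w n) - f x) \<partial>lborel) + (\<integral>x. cmod (g (x - w n) - g x) \<partial>lborel)) \<longlonglongrightarrow> 0 + 0"
    by (intro tendsto_add add.IH)
  moreover have "(\<integral>x. cmod (f (x - w n) + g (x - w n) - (f x + g x)) \<partial>lborel)
      \<le> (\<integral>x. cmod (f (x - w n) - f x) \<partial>lborel) + (\<integral>x. cmod (g (x - w n) - g x) \<partial>lborel)" for n
  proof -
    have i: "integrable lborel (\<lambda>x. cmod (f (x - w n) - f x))" "integrable lborel (\<lambda>x. cmod (g (x - w n) - g x))"
      using integrable_lborel_shift[OF add.hyps(1), of "w n"] integrable_lborel_shift[OF add.hyps(2), of "w n"] add.hyps by auto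
    have "(\<integral>x. cmod (f (x - w n) + g (x - w n) - (f x + g x)) \<partial>lborel)
        \<le> (\<integral>x. cmod (f (x - w n) - f x) + cmod (g (x - w n) - g x) \<partial>lborel)"
    proof (rule integral_mono)
      show "integrable lborel (\<lambda>x. cmod (f (x - w n) + g (x - w n) - (f x + g x)))"
        using integrable_lborel_shift[OF add.hyps(1), of "w n"] integrable_lborel_shift[OF add.hyps(2), of "w n"] add.hyps by auto
      show "cmod (f (x - w n) + g (x - w n) - (f x + g x)) \<le> cmod (f (x - w n) - f x) + cmod (g (x - w n) - g x)" for x
        using norm_triangle_ineq[of "f (x - w n) - f x" "g (x - w n) - g x"] by (simp add: algebra_simps)
    qed (use i in auto)
    then show ?thesis using i by simp
  qed
  ultimately show ?case
    by - (rule tendsto_sandwich[OF always_eventually always_eventually tendsto_const, rotated 2], auto)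
next
  case (lim f s)
  have conv: "(\<lambda>i. \<integral>x. cmod (s i x - f x) \<partial>lborel) \<longlonglongrightarrow> (\<integral>x. 0 \<partial>(lborel :: 'a measure))"
  proof (rule integral_dominated_convergence[where w="\<lambda>x. 3 * cmod (f x)"])
    show "AE x in lborel. (\<lambda>i. cmod (s i x - f x)) \<longlonglongrightarrow> 0"
      using lim.hyps(2) by (intro AE_I2 tendsto_norm_zero LIM_zero)
    show "AE x in lborel. norm (cmod (s i x - f x)) \<le> 3 * cmod (f x)" for i
    proof (intro AE_I2)
      fix x
      have "cmod (s i x - f x) \<le> cmod (s i x) + cmod (f x)" by (rule norm_triangle_ineq4)
      also have "\<dots> \<le> 3 * cmod (f x)" using lim.hyps(3)[of x i] by simp
      finally show "norm (cmod (s i x - f x)) \<le> 3 * cmod (f x)" by simp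
    qed
  qed (use lim.hyps in auto)
  show ?case
  proof (rule LIMSEQ_I)
    fix e :: real assume e: "e > 0"
    obtain i where i: "(\<integral>x. cmod (s i x - f x) \<partial>lborel) < e / 4"
      using LIMSEQ_D[OF conv, of "e/4"] e by auto
    obtain N where N: "\<And>n. n \<ge> N \<Longrightarrow> (\<integral>x. cmod (s i (x - w n) - s i x) \<partial>lborel) < e / 4"
      using LIMSEQ_D[OF lim.IH[of i], of "e/4"] e by auto
    have "(\<integral>x. cmod (f (x - w n) - f x) \<partial>lborel) < e" if "n \<ge> N" for n
    proof -
      let ?d = "\<lambda>x. cmod (s i x - f x)"
      have d: "integrable lborel ?d" using lim.hyps by auto
      have dw: "integrable lborel (\<lambda>x. ?d (x - w n))" by (rule integrable_lborel_shift[OF d])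
      have ss: "integrable lborel (\<lambda>x. cmod (s i (x - w n) - s i x))"
        using integrable_lborel_shift[OF lim.hyps(1), of i "w n"] lim.hyps by auto
      have "(\<integral>x. cmod (f (x - w n) - f x) \<partial>lborel)
          \<le> (\<integral>x. ?d (x - w n) + cmod (s i (x - w n) - s i x) + ?d x \<partial>lborel)"
      proof (rule integral_mono)
        show "integrable lborel (\<lambda>x. cmod (f (x - w n) - f x))"
          using integrable_lborel_shift[OF lim.hyps(4), of "w n"] lim.hyps by auto
        show "cmod (f (x - w n) - f x) \<le> ?d (x - w n) + cmod (s i (x - w n) - s i x) + ?d x" for x
        proof -
          have "f (x - w n) - f x = (f (x - w n) - s i (x - w n)) + ((s i (x - w n) - s i x) + (s i x - f x))"
            by simp
          also have "cmod \<dots> \<le> cmod (f (x - w n) - s i (x - w n)) + (cmod (s i (x - w n) - s i x) + cmod (s i x - f x))"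
            by (intro norm_triangle_le add_left_mono norm_triangle_ineq)
          finally show ?thesis by (simp add: norm_minus_commute)
        qed
      qed (use d dw ss in auto)
      also have "\<dots> = 2 * (\<integral>x. ?d x \<partial>lborel) + (\<integral>x. cmod (s i (x - w n) - s i x) \<partial>lborel)"
        using d dw ss integral_lborel_shift[OF d, of "w n"] by simp
      also have "\<dots> < e" using i N[OF that] e by linarith
      finally show ?thesis .
    qed
    then show "\<exists>no. \<forall>n\<ge>no. norm ((\<integral>x. cmod (f (x - w n) - f x) \<partial>lborel) - 0) < e"
      by (auto simp: abs_of_nonneg)
  qed
qed

text \<open>Convolution with a Gaussian probability density of width \<epsilon>, after a
  substitution that makes the weight independent of \<epsilon>, so that limits act on the argument
  of f alone.\<close>

definition gconv :: "real \<Rightarrow> ('a::euclidean_space \<Rightarrow> complex) \<Rightarrow> 'a \<Rightarrow> complex" where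
  "gconv \<epsilon> f x = (\<integral>v. f (x - \<epsilon> *\<^sub>R v) * gau v \<partial>lborel)"

lemma gconv_measurable [measurable]:
  assumes [measurable]: "f \<in> borel_measurable borel"
  shows "gconv \<epsilon> f \<in> borel_measurable borel"
  unfolding gconv_def by measurable

lemma integrable_mult_gau:
  fixes f :: "'a::euclidean_space \<Rightarrow> complex"
  assumes [measurable]: "f \<in> borel_measurable borel" and b: "\<And>x. cmod (f x) \<le> B" and e: "\<epsilon> \<noteq> 0"
  shows "integrable lborel (\<lambda>x. f x * gau (\<epsilon> *\<^sub>R x))"
proof -
  have "integrable lborel (\<lambda>x::'a. B * gau (\<epsilon> *\<^sub>R x))"
    using integrable_lborel_affine[OF integrable_gau[where 'a='a] e, of 0] by simp
  then show ?thesis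
    by (rule Bochner_Integration.integrable_bound)
       (auto simp: norm_mult abs_mult gau_nonneg intro!: AE_I2 mult_right_mono order.trans[OF b])
qed

text \<open>Inversion with a Gaussian summability factor, exact for every \<epsilon> > 0. It is the
  multiplication formula for f and a modulated Gaussian, whose transform is a Gaussian of width
  \<epsilon> centred at x.\<close>

lemma fourier1_fourier1_gau:
  fixes f :: "'a::euclidean_space \<Rightarrow> complex"
  assumes f[measurable]: "integrable lborel f" and e: "\<epsilon> > 0"
  shows "fourier1 (\<lambda>\<gamma>. fourier1 f \<gamma> * gau (\<epsilon> *\<^sub>R \<gamma>)) (- x) = gconv \<epsilon> f x"
proof -
  define g where "g = (\<lambda>\<gamma>::'a. cis (2 * pi * (\<gamma> \<bullet> x)) * gau (\<epsilon> *\<^sub>R \<gamma>))"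
  have g: "integrable lborel g"
    unfolding g_def by (rule integrable_mult_gau[where B=1]) (use e in auto)
  \<comment> \<open>The power of \<epsilon> is the Jacobian of y = x - \<epsilon> v; it cancels the
    height of the narrow Gaussian.\<close>
  have hatg: "\<epsilon> ^ DIM('a) *\<^sub>R fourier1 g (x - \<epsilon> *\<^sub>R v) = gau v" for v
  proof -
    let ?h = "\<lambda>u::'a. (1/\<epsilon>) ^ DIM('a) *\<^sub>R (gau u * cis (- 2 * pi * (u \<bullet> - v)))"
    have eq: "gau (\<epsilon> *\<^sub>R \<gamma>) * cis (- 2 * pi * ((\<epsilon> *\<^sub>R \<gamma>) \<bullet> - v)) = g \<gamma> * cis (- 2 * pi * (\<gamma> \<bullet> (x - \<epsilon> *\<^sub>R v)))" for \<gamma>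
      by (simp add: g_def cis_mult algebra_simps)
    have "complex_of_real (gau v) = (\<integral>u. gau u * cis (- 2 * pi * (u \<bullet> - v)) \<partial>lborel)"
      by (subst fourier_gau_cis) simp
    also have "\<dots> = \<epsilon> ^ DIM('a) *\<^sub>R (\<integral>\<gamma>. gau (\<epsilon> *\<^sub>R \<gamma>) * cis (- 2 * pi * ((\<epsilon> *\<^sub>R \<gamma>) \<bullet> - v)) \<partial>lborel)"
      using integral_lborel_affine[OF fourier_gau_cis(1)[of "-v"], of \<epsilon> 0] e by simp
    finally show ?thesis
      unfolding eq fourier1_def by simp
  qed
  have "fourier1 (\<lambda>\<gamma>. fourier1 f \<gamma> * gau (\<epsilon> *\<^sub>R \<gamma>)) (- x) = (\<integral>\<gamma>. fourier1 f \<gamma> * g \<gamma> \<partial>lborel)"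
    unfolding fourier1_def[of _ "-x"] g_def by (simp add: mult_ac)
  also have "\<dots> = (\<integral>y. f y * fourier1 g y \<partial>lborel)"
    by (rule fourier1_multiplication_formula[OF f g])
  also have "\<dots> = \<bar>-\<epsilon>\<bar> ^ DIM('a) *\<^sub>R (\<integral>v. f (x + (-\<epsilon>) *\<^sub>R v) * fourier1 g (x + (-\<epsilon>) *\<^sub>R v) \<partial>lborel)"
  proof (rule integral_lborel_affine)
    show "integrable lborel (\<lambda>y. f y * fourier1 g y)"
    proof (rule Bochner_Integration.integrable_bound)
      show "integrable lborel (\<lambda>y. f y * of_real (\<integral>x. cmod (g x) \<partial>lborel))" using f by simp
      have [measurable]: "g \<in> borel_measurable borel" unfolding g_def by measurable
      show "(\<lambda>y. f y * fourier1 g y) \<in> borel_measurable lborel" by measurable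
    qed (auto simp: norm_mult intro!: mult_left_mono norm_fourier1_le)
  qed (use e in auto)
  also have "\<dots> = (\<integral>v. f (x - \<epsilon> *\<^sub>R v) * (\<epsilon> ^ DIM('a) *\<^sub>R fourier1 g (x - \<epsilon> *\<^sub>R v)) \<partial>lborel)"
    using e by (simp flip: integral_scaleR_right)
  also have "\<dots> = gconv \<epsilon> f x"
    unfolding hatg gconv_def ..
  finally show ?thesis .
qed

text \<open>The L^1 distance between \<open>gconv \<epsilon> f\<close> and f is at most the Gaussian
  average over v of the translation modulus \<tau> at \<epsilon> v, which tends to 0; a subsequence
  then converges almost everywhere.\<close>

lemma gconv_L1_conv:
  fixes f :: "'a::euclidean_space \<Rightarrow> complex"
  assumes f[measurable]: "integrable lborel f" and e: "\<epsilon> \<longlonglongrightarrow> 0" and e0: "\<And>n. \<epsilon> n > 0"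
  obtains r :: "nat \<Rightarrow> nat" where "strict_mono r" "AE x in lborel. (\<lambda>n. gconv (\<epsilon> (r n)) f x) \<longlonglongrightarrow> f x"
proof -
  define \<tau> where "\<tau> = (\<lambda>w. \<integral>x. cmod (f (x - w) - f x) \<partial>lborel)"
  have sh: "integrable lborel (\<lambda>x. f (x - w))" for w by (rule integrable_lborel_shift[OF f])
  have \<tau>_le: "\<tau> w \<le> 2 * (\<integral>x. cmod (f x) \<partial>lborel)" for w
  proof -
    have "\<tau> w \<le> (\<integral>x. cmod (f (x - w)) + cmod (f x) \<partial>lborel)"
      unfolding \<tau>_def using sh f by (intro integral_mono) (auto intro: norm_triangle_ineq4)
    also have "\<dots> = 2 * (\<integral>x. cmod (f x) \<partial>lborel)"
      using sh f integral_lborel_shift[OF integrable_norm[OF f], of w] by simp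
    finally show ?thesis .
  qed
  have \<tau>_nonneg: "0 \<le> \<tau> w" for w unfolding \<tau>_def by simp
  have \<tau>_nn: "(\<integral>\<^sup>+x. cmod (f (x - w) - f x) \<partial>lborel) = \<tau> w" for w
    unfolding \<tau>_def using sh f by (subst nn_integral_eq_integral) auto
  have [measurable]: "\<tau> \<in> borel_measurable borel" unfolding \<tau>_def by measurable
  have bnd: "(\<integral>\<^sup>+x. cmod (gconv (\<epsilon> n) f x - f x) \<partial>lborel) \<le> ennreal (\<integral>v. gau v * \<tau> (\<epsilon> n *\<^sub>R v) \<partial>lborel)" for n
  proof -
    have int: "AE x in lborel. integrable lborel (\<lambda>v. f (x - \<epsilon> n *\<^sub>R v) * gau v)"
    proof -
      have "integrable (lborel \<Otimes>\<^sub>M lborel) (\<lambda>(v, x). f (x - \<epsilon> n *\<^sub>R v) * gau v)"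
      proof (rule lborel_pair.Fubini_integrable, goal_cases)
        case 2
        have "(\<lambda>v. \<integral>x. cmod (case (v, x) of (v, x) \<Rightarrow> f (x - \<epsilon> n *\<^sub>R v) * gau v) \<partial>lborel)
           = (\<lambda>v. (\<integral>x. cmod (f x) \<partial>lborel) * gau v)"
          using integral_lborel_shift[OF integrable_norm[OF f]]
          by (simp add: norm_mult gau_nonneg)
        then show ?case using integrable_gau[where 'a='a] by simp
      qed (use sh in auto)
      then have "integrable (lborel \<Otimes>\<^sub>M lborel) (\<lambda>(x, v). f (x - \<epsilon> n *\<^sub>R v) * gau v)"
        by (subst (asm) lborel_pair.integrable_product_swap_iff[symmetric]) (simp add: case_prod_beta')
      from lborel_pair.AE_integrable_fst'[OF this] show ?thesis by simp
    qed
    have "(\<integral>\<^sup>+x. cmod (gconv (\<epsilon> n) f x - f x) \<partial>lborel)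
        \<le> (\<integral>\<^sup>+x. (\<integral>\<^sup>+v. ennreal (cmod (f (x - \<epsilon> n *\<^sub>R v) - f x)) * ennreal (gau v) \<partial>lborel) \<partial>lborel)"
    proof (rule nn_integral_mono_AE, use int in eventually_elim)
      fix x assume i: "integrable lborel (\<lambda>v. f (x - \<epsilon> n *\<^sub>R v) * gau v)"
      have ig: "integrable lborel (\<lambda>v::'a. f x * gau v)" using integrable_gau[where 'a='a] by (simp)
      have "gconv (\<epsilon> n) f x - f x = (\<integral>v. f (x - \<epsilon> n *\<^sub>R v) * gau v \<partial>lborel) - (\<integral>v. f x * gau (v::'a) \<partial>lborel)"
        by (simp add: gconv_def integral_gau)
      also have "\<dots> = (\<integral>v. (f (x - \<epsilon> n *\<^sub>R v) - f x) * gau v \<partial>lborel)"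
        using i ig by (subst Bochner_Integration.integral_diff[symmetric]) (auto simp: left_diff_distrib)
      finally have "ennreal (cmod (gconv (\<epsilon> n) f x - f x)) = ennreal (cmod \<dots>)" by simp
      also have "\<dots> \<le> (\<integral>\<^sup>+v. ennreal (cmod ((f (x - \<epsilon> n *\<^sub>R v) - f x) * gau v)) \<partial>lborel)"
        using i ig by (intro integral_norm_bound_ennreal) (simp add: left_diff_distrib)
      finally show "ennreal (cmod (gconv (\<epsilon> n) f x - f x))
          \<le> (\<integral>\<^sup>+v. ennreal (cmod (f (x - \<epsilon> n *\<^sub>R v) - f x)) * ennreal (gau v) \<partial>lborel)"
        by (simp add: norm_mult gau_nonneg ennreal_mult)
    qed
    also have "\<dots> = (\<integral>\<^sup>+v. (\<integral>\<^sup>+x. ennreal (cmod (f (x - \<epsilon> n *\<^sub>R v) - f x)) * ennreal (gau v) \<partial>lborel) \<partial>lborel)"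
      by (rule lborel_pair.Fubini'[symmetric]) measurable
    also have "\<dots> = (\<integral>\<^sup>+v. ennreal (gau v * \<tau> (\<epsilon> n *\<^sub>R v)) \<partial>lborel)"
      by (intro nn_integral_cong, subst nn_integral_multc)
         (auto simp: \<tau>_nn ennreal_mult gau_nonneg \<tau>_nonneg mult.commute)
    also have "\<dots> = ennreal (\<integral>v. gau v * \<tau> (\<epsilon> n *\<^sub>R v) \<partial>lborel)"
    proof (rule nn_integral_eq_integral)
      show "integrable lborel (\<lambda>v. gau v * \<tau> (\<epsilon> n *\<^sub>R v))"
      proof (rule Bochner_Integration.integrable_bound)
        show "integrable lborel (\<lambda>v::'a. gau v * (2 * (\<integral>x. cmod (f x) \<partial>lborel)))"
          using integrable_gau[where 'a='a] by simp
      qed (auto simp: gau_nonneg \<tau>_nonneg intro!: mult_left_mono order.trans[OF \<tau>_le])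
    qed (auto simp: gau_nonneg \<tau>_nonneg)
    finally show ?thesis .
  qed
  have lim: "(\<lambda>n. \<integral>v. gau (v::'a) * \<tau> (\<epsilon> n *\<^sub>R v) \<partial>lborel) \<longlonglongrightarrow> (\<integral>v. gau (v::'a) * 0 \<partial>lborel)"
  proof (rule integral_dominated_convergence[where w="\<lambda>v. gau v * (2 * (\<integral>x. cmod (f x) \<partial>lborel))"])
    show "integrable lborel (\<lambda>v::'a. gau v * (2 * (\<integral>x. cmod (f x) \<partial>lborel)))"
      using integrable_gau[where 'a='a] by simp
    show "AE v in lborel. (\<lambda>n. gau v * \<tau> (\<epsilon> n *\<^sub>R v)) \<longlonglongrightarrow> gau v * 0"
    proof (intro AE_I2 tendsto_mult tendsto_const)
      fix v :: 'a
      have "(\<lambda>n. \<epsilon> n *\<^sub>R v) \<longlonglongrightarrow> 0 *\<^sub>R v" by (intro tendsto_intros e)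
      then show "(\<lambda>n. \<tau> (\<epsilon> n *\<^sub>R v)) \<longlonglongrightarrow> 0"
        unfolding \<tau>_def by (intro L1_translation_continuous f) simp
    qed
  qed (auto simp: gau_nonneg \<tau>_nonneg intro!: mult_left_mono order.trans[OF \<tau>_le])
  have int: "integrable lborel (\<lambda>x. gconv (\<epsilon> n) f x - f x)" for n
    unfolding integrable_iff_bounded using bnd[of n] by (auto intro: order.strict_trans1)
  have "(\<lambda>n. \<integral>x. cmod (gconv (\<epsilon> n) f x - f x) \<partial>lborel) \<longlonglongrightarrow> 0"
  proof (rule tendsto_sandwich[OF always_eventually _ tendsto_const lim[simplified]])
    show "\<forall>\<^sub>F n in sequentially. (\<integral>x. cmod (gconv (\<epsilon> n) f x - f x) \<partial>lborel) \<le> (\<integral>v. gau v * \<tau> (\<epsilon> n *\<^sub>R v) \<partial>lborel)"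
    proof (intro always_eventually allI)
      fix n
      have "ennreal (\<integral>x. cmod (gconv (\<epsilon> n) f x - f x) \<partial>lborel) \<le> ennreal (\<integral>v. gau v * \<tau> (\<epsilon> n *\<^sub>R v) \<partial>lborel)"
        using bnd[of n] int[of n] by (subst nn_integral_eq_integral[symmetric]) auto
      moreover have "0 \<le> (\<integral>v. gau v * \<tau> (\<epsilon> n *\<^sub>R v) \<partial>lborel)"
        by (simp add: gau_nonneg \<tau>_nonneg)
      ultimately show "(\<integral>x. cmod (gconv (\<epsilon> n) f x - f x) \<partial>lborel) \<le> (\<integral>v. gau v * \<tau> (\<epsilon> n *\<^sub>R v) \<partial>lborel)"
        by (simp add: ennreal_le_iff)
    qed
  qed simp
  from tendsto_L1_AE_subseq[OF int this] obtain r :: "nat \<Rightarrow> nat" where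
    "strict_mono r" "AE x in lborel. (\<lambda>n. gconv (\<epsilon> (r n)) f x - f x) \<longlonglongrightarrow> 0" by auto
  then show thesis
    using that by (simp add: LIM_zero_iff)
qed

lemma gau_scale_tendsto:
  assumes e: "\<epsilon> \<longlonglongrightarrow> 0" shows "(\<lambda>n. gau (\<epsilon> n *\<^sub>R x)) \<longlonglongrightarrow> 1"
proof -
  have "(\<lambda>n. exp (- pi * (norm (\<epsilon> n *\<^sub>R x))\<^sup>2)) \<longlonglongrightarrow> exp (- pi * (norm (0 *\<^sub>R x))\<^sup>2)"
    by (intro tendsto_intros e)
  then show ?thesis by (simp add: gau_def)
qed

text \<open>Passage to the limit in \<open>fourier1_fourier1_gau\<close>: the transforms converge
  everywhere by domination, because \<open>fourier1 f\<close> is integrable, and the mollifications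
  almost everywhere along a subsequence.\<close>

lemma fourier1_inversion:
  fixes f :: "'a::euclidean_space \<Rightarrow> complex"
  assumes f[measurable]: "integrable lborel f" and ff: "integrable lborel (fourier1 f)"
  shows "AE x in lborel. f x = fourier1 (fourier1 f) (- x)"
proof -
  define \<epsilon> where "\<epsilon> = (\<lambda>n. 1 / real (Suc n))"
  have e: "\<epsilon> \<longlonglongrightarrow> 0" "\<And>n. \<epsilon> n > 0"
    unfolding \<epsilon>_def by (rule LIMSEQ_Suc[OF lim_1_over_n]) auto
  obtain r where r: "strict_mono r" "AE x in lborel. (\<lambda>n. gconv (\<epsilon> (r n)) f x) \<longlonglongrightarrow> f x"
    by (rule gconv_L1_conv[OF f e])
  have er: "(\<lambda>n. \<epsilon> (r n)) \<longlonglongrightarrow> 0"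
    using LIMSEQ_subseq_LIMSEQ[OF e(1) r(1)] by (simp add: comp_def)
  have "(\<lambda>n. gconv (\<epsilon> (r n)) f x) \<longlonglongrightarrow> fourier1 (fourier1 f) (- x)" for x
    unfolding fourier1_fourier1_gau[OF f e(2), symmetric]
    unfolding fourier1_def[of _ "-x"]
  proof (rule integral_dominated_convergence[where w="\<lambda>\<gamma>. cmod (fourier1 f \<gamma>)"])
    show "AE \<gamma> in lborel. (\<lambda>n. fourier1 f \<gamma> * complex_of_real (gau (\<epsilon> (r n) *\<^sub>R \<gamma>)) * cis (- 2 * pi * (\<gamma> \<bullet> - x)))
         \<longlonglongrightarrow> fourier1 f \<gamma> * cis (- 2 * pi * (\<gamma> \<bullet> - x))"
      by (intro AE_I2) (auto intro!: tendsto_eq_intros gau_scale_tendsto[OF er])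
  qed (use ff in \<open>auto simp: norm_mult gau_nonneg gau_le1 mult_left_le\<close>)
  with r(2) show ?thesis
    by (auto elim!: eventually_mono intro: LIMSEQ_unique)
qed

text \<open>By the multiplication formula the left side is the pairing of f with its own Gaussian
  mollification. Values lie in [0, \<infinity>], so \<open>L2sq f\<close> may be infinite.\<close>

lemma plancherel_gau_le:
  fixes f :: "'a::euclidean_space \<Rightarrow> complex"
  assumes f[measurable]: "integrable lborel f" and e: "\<epsilon> > 0"
  shows "(\<integral>\<^sup>+\<gamma>. ennreal ((cmod (fourier1 f \<gamma>))\<^sup>2 * gau (\<epsilon> *\<^sub>R \<gamma>)) \<partial>lborel) \<le> L2sq f"
proof -
  define k where "k = (\<lambda>\<gamma>. cnj (fourier1 f \<gamma>) * gau (\<epsilon> *\<^sub>R \<gamma>))"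
  define M where "M = (\<integral>x. cmod (f x) \<partial>lborel)"
  have k: "integrable lborel k"
    unfolding k_def
    by (rule integrable_mult_gau[where B=M]) (use e in \<open>auto simp: M_def intro!: norm_fourier1_le\<close>)
  have hatk: "fourier1 k y = cnj (gconv \<epsilon> f y)" for y
  proof -
    have "fourier1 k y = fourier1 (\<lambda>\<gamma>. cnj (fourier1 f \<gamma> * gau (\<epsilon> *\<^sub>R \<gamma>))) y"
      by (simp add: k_def)
    then show ?thesis
      unfolding fourier1_cnj using fourier1_fourier1_gau[OF f e] by simp
  qed
  have fk: "fourier1 f \<gamma> * k \<gamma> = complex_of_real ((cmod (fourier1 f \<gamma>))\<^sup>2 * gau (\<epsilon> *\<^sub>R \<gamma>))" for \<gamma>
    by (simp only: k_def mult.assoc[symmetric] complex_norm_square[symmetric] of_real_mult)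
  have int: "integrable lborel (\<lambda>\<gamma>. fourier1 f \<gamma> * k \<gamma>)"
  proof (rule Bochner_Integration.integrable_bound)
    show "integrable lborel (\<lambda>\<gamma>. of_real M * k \<gamma>)" using k by simp
    show "(\<lambda>\<gamma>. fourier1 f \<gamma> * k \<gamma>) \<in> borel_measurable lborel" unfolding k_def by measurable
  qed (auto simp: norm_mult M_def intro!: mult_right_mono norm_fourier1_le)
  have intr: "integrable lborel (\<lambda>\<gamma>. (cmod (fourier1 f \<gamma>))\<^sup>2 * gau (\<epsilon> *\<^sub>R \<gamma>))"
    using integrable_Re[OF int] unfolding fk by simp
  have "(\<integral>\<^sup>+\<gamma>. ennreal ((cmod (fourier1 f \<gamma>))\<^sup>2 * gau (\<epsilon> *\<^sub>R \<gamma>)) \<partial>lborel)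
      = ennreal (\<integral>\<gamma>. (cmod (fourier1 f \<gamma>))\<^sup>2 * gau (\<epsilon> *\<^sub>R \<gamma>) \<partial>lborel)"
    by (rule nn_integral_eq_integral[OF intr]) (auto simp: gau_nonneg)
  also have "\<dots> = ennreal (cmod (\<integral>\<gamma>. fourier1 f \<gamma> * k \<gamma> \<partial>lborel))"
    unfolding fk integral_complex_of_real norm_of_real
    by (subst abs_of_nonneg) (auto simp: gau_nonneg)
  also have "\<dots> = ennreal (cmod (\<integral>y. f y * cnj (gconv \<epsilon> f y) \<partial>lborel))"
    unfolding fourier1_multiplication_formula[OF f k] hatk ..
  also have "\<dots> \<le> (\<integral>\<^sup>+y. ennreal (cmod (f y)) * ennreal (cmod (gconv \<epsilon> f y)) \<partial>lborel)"
  \<comment> \<open>A non-integrable function has Bochner integral 0 by convention, and then the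
    bound is trivial; the same split recurs for the inner integral.\<close>
  proof (cases "integrable lborel (\<lambda>y. f y * cnj (gconv \<epsilon> f y))")
    case True
    from integral_norm_bound_ennreal[OF this] show ?thesis
      by (simp add: norm_mult ennreal_mult)
  qed (simp add: not_integrable_integral_eq)
  \<comment> \<open>The inequality ab \<le> (a^2 + b^2) / 2 replaces Cauchy-Schwarz: after Fubini
    and a shift each half carries the Gaussian mass 1 and contributes half of
    \<open>L2sq f\<close>.\<close>
  also have "\<dots> \<le> (\<integral>\<^sup>+y. (\<integral>\<^sup>+v. ennreal (((cmod (f y))\<^sup>2 + (cmod (f (y - \<epsilon> *\<^sub>R v)))\<^sup>2) / 2 * gau v) \<partial>lborel) \<partial>lborel)"
  proof (rule nn_integral_mono)
    fix y
    have "ennreal (cmod (gconv \<epsilon> f y)) \<le> (\<integral>\<^sup>+v. ennreal (cmod (f (y - \<epsilon> *\<^sub>R v) * gau v)) \<partial>lborel)"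
    proof (cases "integrable lborel (\<lambda>v. f (y - \<epsilon> *\<^sub>R v) * gau v)")
      case True
      from integral_norm_bound_ennreal[OF this] show ?thesis
        by (simp add: gconv_def)
    qed (simp add: gconv_def not_integrable_integral_eq)
    then have "ennreal (cmod (f y)) * ennreal (cmod (gconv \<epsilon> f y))
        \<le> ennreal (cmod (f y)) * (\<integral>\<^sup>+v. ennreal (cmod (f (y - \<epsilon> *\<^sub>R v) * gau v)) \<partial>lborel)"
      by (intro mult_left_mono) auto
    also have "\<dots> = (\<integral>\<^sup>+v. ennreal (cmod (f y) * cmod (f (y - \<epsilon> *\<^sub>R v)) * gau v) \<partial>lborel)"
      by (subst nn_integral_cmult[symmetric]) (auto simp: norm_mult gau_nonneg ennreal_mult mult.assoc)
    also have "\<dots> \<le> (\<integral>\<^sup>+v. ennreal (((cmod (f y))\<^sup>2 + (cmod (f (y - \<epsilon> *\<^sub>R v)))\<^sup>2) / 2 * gau v) \<partial>lborel)"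
    proof (intro nn_integral_mono ennreal_leI mult_right_mono gau_nonneg)
      fix v
      show "cmod (f y) * cmod (f (y - \<epsilon> *\<^sub>R v)) \<le> ((cmod (f y))\<^sup>2 + (cmod (f (y - \<epsilon> *\<^sub>R v)))\<^sup>2) / 2"
        using sum_squares_bound[of "cmod (f y)" "cmod (f (y - \<epsilon> *\<^sub>R v))"] by simp
    qed
    finally show "ennreal (cmod (f y)) * ennreal (cmod (gconv \<epsilon> f y)) \<le> \<dots>" .
  qed
  also have "\<dots> = (\<integral>\<^sup>+y. (\<integral>\<^sup>+v. ennreal ((cmod (f y))\<^sup>2 / 2 * gau (v::'a)) \<partial>lborel)
      + (\<integral>\<^sup>+v. ennreal ((cmod (f (y - \<epsilon> *\<^sub>R v)))\<^sup>2 / 2 * gau v) \<partial>lborel) \<partial>lborel)"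
    by (intro nn_integral_cong) (simp add: gau_nonneg distrib_right add_divide_distrib nn_integral_add)
  also have "\<dots> = (\<integral>\<^sup>+y. (\<integral>\<^sup>+v. ennreal ((cmod (f y))\<^sup>2 / 2 * gau (v::'a)) \<partial>lborel) \<partial>lborel)
      + (\<integral>\<^sup>+y. (\<integral>\<^sup>+v. ennreal ((cmod (f (y - \<epsilon> *\<^sub>R v)))\<^sup>2 / 2 * gau v) \<partial>lborel) \<partial>lborel)"
    by (rule nn_integral_add) measurable
  also have "(\<integral>\<^sup>+y. (\<integral>\<^sup>+v. ennreal ((cmod (f (y - \<epsilon> *\<^sub>R v)))\<^sup>2 / 2 * gau v) \<partial>lborel) \<partial>lborel)
      = (\<integral>\<^sup>+v. (\<integral>\<^sup>+y. ennreal ((cmod (f (y - \<epsilon> *\<^sub>R v)))\<^sup>2 / 2 * gau v) \<partial>lborel) \<partial>lborel)"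
    by (rule lborel_pair.Fubini'[symmetric]) measurable
  also have "\<dots> = (\<integral>\<^sup>+v. (\<integral>\<^sup>+y. ennreal ((cmod (f y))\<^sup>2 / 2 * gau (v::'a)) \<partial>lborel) \<partial>lborel)"
    by (intro nn_integral_cong nn_integral_lborel_shift[where f="\<lambda>y. ennreal ((cmod (f y))\<^sup>2 / 2 * gau _)"]) measurable
  also have "\<dots> = (\<integral>\<^sup>+y. (\<integral>\<^sup>+v. ennreal ((cmod (f y))\<^sup>2 / 2 * gau (v::'a)) \<partial>lborel) \<partial>lborel)"
    by (rule lborel_pair.Fubini') measurable
  also have "(\<integral>\<^sup>+y. (\<integral>\<^sup>+v. ennreal ((cmod (f y))\<^sup>2 / 2 * gau (v::'a)) \<partial>lborel) \<partial>lborel)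
      = (\<integral>\<^sup>+y. ennreal ((cmod (f y))\<^sup>2 / 2) \<partial>lborel)"
    by (simp add: ennreal_mult gau_nonneg nn_integral_cmult nn_integral_gau del: times_divide_eq_left)
  also have "\<dots> + \<dots> = L2sq f"
    unfolding L2sq_def
    by (subst nn_integral_add[symmetric]) (auto simp flip: ennreal_plus)
  finally show ?thesis .
qed

text \<open>Fatou, as the Gaussian factor tends to 1.\<close>

lemma plancherel_le:
  fixes f :: "'a::euclidean_space \<Rightarrow> complex"
  assumes f[measurable]: "integrable lborel f"
  shows "L2sq (fourier1 f) \<le> L2sq f"
proof -
  define \<epsilon> where "\<epsilon> = (\<lambda>n. 1 / real (Suc n))"
  have e: "\<epsilon> \<longlonglongrightarrow> 0" "\<And>n. \<epsilon> n > 0"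
    unfolding \<epsilon>_def by (rule LIMSEQ_Suc[OF lim_1_over_n]) auto
  have "L2sq (fourier1 f) = (\<integral>\<^sup>+\<gamma>. liminf (\<lambda>n. ennreal ((cmod (fourier1 f \<gamma>))\<^sup>2 * gau (\<epsilon> n *\<^sub>R \<gamma>))) \<partial>lborel)"
    unfolding L2sq_def
  proof (rule nn_integral_cong)
    fix \<gamma>
    have "(\<lambda>n. ennreal ((cmod (fourier1 f \<gamma>))\<^sup>2 * gau (\<epsilon> n *\<^sub>R \<gamma>))) \<longlonglongrightarrow> ennreal ((cmod (fourier1 f \<gamma>))\<^sup>2 * 1)"
      by (intro tendsto_intros gau_scale_tendsto e)
    then show "sqnorm (fourier1 f \<gamma>) = liminf (\<lambda>n. ennreal ((cmod (fourier1 f \<gamma>))\<^sup>2 * gau (\<epsilon> n *\<^sub>R \<gamma>)))"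
      by (simp add: lim_imp_Liminf)
  qed
  also have "\<dots> \<le> liminf (\<lambda>n. \<integral>\<^sup>+\<gamma>. ennreal ((cmod (fourier1 f \<gamma>))\<^sup>2 * gau (\<epsilon> n *\<^sub>R \<gamma>)) \<partial>lborel)"
    by (rule nn_integral_liminf) measurable
  also have "\<dots> \<le> liminf (\<lambda>n::nat. L2sq f)"
    by (intro Liminf_mono always_eventually allI plancherel_gau_le f e)
  also have "\<dots> = L2sq f" by (simp add: Liminf_const)
  finally show ?thesis .
qed

text \<open>The converse inequality is the first one applied to the inverse transforms \<^term>\<open>gconv \<epsilon> f\<close>, which
  converge to \<open>f\<close> almost everywhere along a subsequence.\<close>

theorem plancherel_L1:
  fixes f :: "'a::euclidean_space \<Rightarrow> complex"
  assumes f[measurable]: "integrable lborel f"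
  shows "L2sq (fourier1 f) = L2sq f"
proof (rule antisym[OF plancherel_le[OF f]])
  define \<epsilon> where "\<epsilon> = (\<lambda>n. 1 / real (Suc n))"
  have e: "\<epsilon> \<longlonglongrightarrow> 0" "\<And>n. \<epsilon> n > 0"
    unfolding \<epsilon>_def by (rule LIMSEQ_Suc[OF lim_1_over_n]) auto
  obtain r where r: "strict_mono r" "AE x in lborel. (\<lambda>n. gconv (\<epsilon> (r n)) f x) \<longlonglongrightarrow> f x"
    by (rule gconv_L1_conv[OF f e])
  have "L2sq f = (\<integral>\<^sup>+x. liminf (\<lambda>n. sqnorm (gconv (\<epsilon> (r n)) f x)) \<partial>lborel)"
    unfolding L2sq_def
  proof (rule nn_integral_cong_AE, use r(2) in eventually_elim)
    fix x assume "(\<lambda>n. gconv (\<epsilon> (r n)) f x) \<longlonglongrightarrow> f x"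
    then have "(\<lambda>n. sqnorm (gconv (\<epsilon> (r n)) f x)) \<longlonglongrightarrow> sqnorm (f x)"
      by (intro tendsto_intros)
    then show "sqnorm (f x) = liminf (\<lambda>n. sqnorm (gconv (\<epsilon> (r n)) f x))"
      by (intro lim_imp_Liminf[symmetric]) simp
  qed
  also have "\<dots> \<le> liminf (\<lambda>n. L2sq (gconv (\<epsilon> (r n)) f))"
    unfolding L2sq_def by (rule nn_integral_liminf) measurable
  also have "\<dots> \<le> liminf (\<lambda>n::nat. L2sq (fourier1 f))"
  proof (intro Liminf_mono always_eventually allI)
    fix n
    let ?g = "\<lambda>\<gamma>. fourier1 f \<gamma> * gau (\<epsilon> (r n) *\<^sub>R \<gamma>)"
    have g: "integrable lborel ?g"
      by (rule integrable_mult_gau[OF _ norm_fourier1_le]) (use e(2)[of "r n"] in auto)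
    have [measurable]: "?g \<in> borel_measurable borel" by measurable
    have "L2sq (gconv (\<epsilon> (r n)) f) = (\<integral>\<^sup>+x. sqnorm (fourier1 ?g (0 - x)) \<partial>lborel)"
      unfolding L2sq_def using fourier1_fourier1_gau[OF f e(2)] by simp
    also have "\<dots> = L2sq (fourier1 ?g)"
      unfolding L2sq_def by (rule nn_integral_lborel_reflect) measurable
    also have "\<dots> \<le> L2sq ?g" by (rule plancherel_le[OF g])
    also have "\<dots> \<le> L2sq (fourier1 f)"
      unfolding L2sq_def
      by (intro nn_integral_mono ennreal_leI power_mono) (auto simp: norm_mult gau_nonneg gau_le1 mult_left_le)
    finally show "L2sq (gconv (\<epsilon> (r n)) f) \<le> L2sq (fourier1 f)" .
  qed
  also have "\<dots> = L2sq (fourier1 f)" by (simp add: Liminf_const)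
  finally show "L2sq f \<le> L2sq (fourier1 f)" .
qed

subsection \<open>Square-integrable functions\<close>

lemma L2fun_iff: "L2fun f \<longleftrightarrow> f \<in> borel_measurable borel \<and> L2sq f < \<infinity>"
  unfolding L2fun_def L2sq_def by (auto simp: integrable_iff_bounded)

lemma L2sq_add_le:
  assumes [measurable]: "f \<in> borel_measurable borel" "g \<in> borel_measurable borel"
  shows "L2sq (\<lambda>x. f x + g x) \<le> 2 * L2sq f + 2 * L2sq g"
proof -
  have "(cmod (f x + g x))\<^sup>2 \<le> 2 * (cmod (f x))\<^sup>2 + 2 * (cmod (g x))\<^sup>2" for x
  proof -
    have "(cmod (f x + g x))\<^sup>2 \<le> (cmod (f x) + cmod (g x))\<^sup>2"
      by (intro power_mono norm_triangle_ineq) auto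
    also have "\<dots> \<le> 2 * (cmod (f x))\<^sup>2 + 2 * (cmod (g x))\<^sup>2"
      using sum_squares_bound[of "cmod (f x)" "cmod (g x)"] by (simp add: power2_sum)
    finally show ?thesis .
  qed
  then have "L2sq (\<lambda>x. f x + g x) \<le> (\<integral>\<^sup>+x. ennreal (2 * (cmod (f x))\<^sup>2 + 2 * (cmod (g x))\<^sup>2) \<partial>lborel)"
    unfolding L2sq_def by (intro nn_integral_mono ennreal_leI)
  also have "\<dots> = (\<integral>\<^sup>+x. 2 * sqnorm (f x) + 2 * sqnorm (g x) \<partial>lborel)"
    by (simp add: ennreal_mult)
  also have "\<dots> = 2 * L2sq f + 2 * L2sq g"
    unfolding L2sq_def by (simp add: nn_integral_add nn_integral_cmult)
  finally show ?thesis .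
qed

lemma L2sq_minus: "L2sq (\<lambda>x. - f x) = L2sq f"
  and L2sq_cnj: "L2sq (\<lambda>x. cnj (f x)) = L2sq f"
  by (simp_all add: L2sq_def)

lemma L2sq_diff_le:
  assumes [measurable]: "f \<in> borel_measurable borel" "g \<in> borel_measurable borel"
  shows "L2sq (\<lambda>x. f x - g x) \<le> 2 * L2sq f + 2 * L2sq g"
  using L2sq_add_le[of f "\<lambda>x. - g x"] by (simp add: L2sq_minus)

lemma L2sq_cmult: "L2sq (\<lambda>x. c * f x) = ennreal ((cmod c)\<^sup>2) * L2sq f"
  if [measurable]: "f \<in> borel_measurable borel"
  by (simp add: L2sq_def norm_mult power_mult_distrib ennreal_mult nn_integral_cmult)

lemma L2fun_add: "L2fun f \<Longrightarrow> L2fun g \<Longrightarrow> L2fun (\<lambda>x. f x + g x)"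
  unfolding L2fun_iff using L2sq_add_le[of f g] by (auto simp: ennreal_mult_less_top elim: order.strict_trans1)

lemma L2fun_diff: "L2fun f \<Longrightarrow> L2fun g \<Longrightarrow> L2fun (\<lambda>x. f x - g x)"
  unfolding L2fun_iff using L2sq_diff_le[of f g] by (auto simp: ennreal_mult_less_top elim: order.strict_trans1)

lemma L2fun_cmult: "L2fun f \<Longrightarrow> L2fun (\<lambda>x. c * f x)"
  unfolding L2fun_iff using L2sq_cmult[of f c] by (auto simp: ennreal_mult_less_top)

lemma L2fun_cnj: "L2fun f \<Longrightarrow> L2fun (\<lambda>x. cnj (f x))"
  unfolding L2fun_iff by (auto simp: L2sq_cnj)

lemma L2fun_mult_integrable:
  assumes f: "L2fun f" and g: "L2fun g"
  shows "integrable lborel (\<lambda>x. f x * g x)"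
proof -
  have [measurable]: "f \<in> borel_measurable borel" "g \<in> borel_measurable borel"
    using f g by (auto simp: L2fun_iff)
  have "integrable lborel (\<lambda>x. (cmod (f x))\<^sup>2 + (cmod (g x))\<^sup>2)"
    using f g by (auto simp: L2fun_def)
  then show ?thesis
  proof (rule Bochner_Integration.integrable_bound)
    have "2 * (cmod (f x) * cmod (g x)) \<le> (cmod (f x))\<^sup>2 + (cmod (g x))\<^sup>2" for x
      using sum_squares_bound[of "cmod (f x)" "cmod (g x)"] by simp
    moreover have "0 \<le> cmod (f x) * cmod (g x)" for x by simp
    ultimately have "cmod (f x) * cmod (g x) \<le> (cmod (f x))\<^sup>2 + (cmod (g x))\<^sup>2" for x
      by (smt (verit))
    then show "AE x in lborel. norm (f x * g x) \<le> norm ((cmod (f x))\<^sup>2 + (cmod (g x))\<^sup>2)"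
      by (auto simp: norm_mult)
  qed measurable
qed

lemma integral_mult_L2_le:
  assumes f: "L2fun f" and g: "L2fun g"
  shows "sqnorm (\<integral>x. f x * g x \<partial>lborel) \<le> L2sq f * L2sq g"
proof -
  have [measurable]: "f \<in> borel_measurable borel" "g \<in> borel_measurable borel"
    using f g by (auto simp: L2fun_iff)
  have "ennreal (cmod (\<integral>x. f x * g x \<partial>lborel)) \<le> (\<integral>\<^sup>+x. ennreal (cmod (f x)) * ennreal (cmod (g x)) \<partial>lborel)"
    using integral_norm_bound_ennreal[OF L2fun_mult_integrable[OF f g]] by (simp add: norm_mult ennreal_mult)
  then have "(ennreal (cmod (\<integral>x. f x * g x \<partial>lborel)))\<^sup>2 \<le> (\<integral>\<^sup>+x. ennreal (cmod (f x)) * ennreal (cmod (g x)) \<partial>lborel)\<^sup>2"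
    by (intro power_mono) auto
  also have "\<dots> \<le> L2sq f * L2sq g"
    unfolding L2sq_def using Cauchy_Schwarz_nn_integral[of "\<lambda>x. ennreal (cmod (f x))" lborel "\<lambda>x. ennreal (cmod (g x))"]
    by (simp add: ennreal_power)
  finally show ?thesis by (simp add: ennreal_power)
qed

lemma tendsto_of_sq_bound:
  fixes z :: "nat \<Rightarrow> complex"
  assumes "\<And>n. sqnorm (z n - l) \<le> b n" "b \<longlonglongrightarrow> 0"
  shows "z \<longlonglongrightarrow> l"
proof -
  have "(\<lambda>n. sqnorm (z n - l)) \<longlonglongrightarrow> ennreal 0"
    using assms by (intro tendsto_sandwich[OF always_eventually always_eventually tendsto_const assms(2)[folded ennreal_0]]) auto
  then have "(\<lambda>n. (cmod (z n - l))\<^sup>2) \<longlonglongrightarrow> 0"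
    by (subst (asm) tendsto_ennreal_iff) auto
  then have "(\<lambda>n. sqrt ((cmod (z n - l))\<^sup>2)) \<longlonglongrightarrow> sqrt 0"
    by (intro tendsto_intros)
  then show ?thesis
    by (simp add: tendsto_norm_zero_iff LIM_zero_iff)
qed

lemma L2_inner_tendsto:
  assumes f: "\<And>n. L2fun (f n)" "L2fun f'" "(\<lambda>n. L2sq (\<lambda>x. f n x - f' x)) \<longlonglongrightarrow> 0"
    and g: "\<And>n. L2fun (g n)" "L2fun g'" "(\<lambda>n. L2sq (\<lambda>x. g n x - g' x)) \<longlonglongrightarrow> 0"
  shows "(\<lambda>n. \<integral>x. f n x * cnj (g n x) \<partial>lborel) \<longlonglongrightarrow> (\<integral>x. f' x * cnj (g' x) \<partial>lborel)"
proof -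
  have fd: "L2fun (\<lambda>x. f n x - f' x)" and gd: "L2fun (\<lambda>x. cnj (g n x - g' x))" for n
    using f g by (auto intro!: L2fun_diff L2fun_cnj simp del: complex_cnj_diff)
  have A: "(\<lambda>n. \<integral>x. (f n x - f' x) * cnj (g n x - g' x) \<partial>lborel) \<longlonglongrightarrow> 0"
  proof (rule tendsto_of_sq_bound)
    show "sqnorm ((\<integral>x. (f n x - f' x) * cnj (g n x - g' x) \<partial>lborel) - 0)
      \<le> L2sq (\<lambda>x. f n x - f' x) * L2sq (\<lambda>x. g n x - g' x)" for n
      using integral_mult_L2_le[OF fd[of n] gd[of n]] by (simp add: L2sq_cnj del: complex_cnj_diff)
    show "(\<lambda>n. L2sq (\<lambda>x. f n x - f' x) * L2sq (\<lambda>x. g n x - g' x)) \<longlonglongrightarrow> 0"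
      using tendsto_mult_ennreal[OF f(3) g(3)] by simp
  qed
  have B: "(\<lambda>n. \<integral>x. (f n x - f' x) * cnj (g' x) \<partial>lborel) \<longlonglongrightarrow> 0"
  proof (rule tendsto_of_sq_bound)
    show "sqnorm ((\<integral>x. (f n x - f' x) * cnj (g' x) \<partial>lborel) - 0)
      \<le> L2sq (\<lambda>x. f n x - f' x) * L2sq g'" for n
      using integral_mult_L2_le[OF fd[of n] L2fun_cnj[OF g(2)]] by (simp add: L2sq_cnj)
    have "L2sq g' \<noteq> top" using g(2) by (auto simp: L2fun_iff)
    then show "(\<lambda>n. L2sq (\<lambda>x. f n x - f' x) * L2sq g') \<longlonglongrightarrow> 0"
      using tendsto_mult_ennreal[OF f(3) tendsto_const[of "L2sq g'"]] by simp
  qed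
  have C: "(\<lambda>n. \<integral>x. f' x * cnj (g n x - g' x) \<partial>lborel) \<longlonglongrightarrow> 0"
  proof (rule tendsto_of_sq_bound)
    show "sqnorm ((\<integral>x. f' x * cnj (g n x - g' x) \<partial>lborel) - 0)
      \<le> L2sq f' * L2sq (\<lambda>x. g n x - g' x)" for n
      using integral_mult_L2_le[OF f(2) gd[of n]] by (simp add: L2sq_cnj del: complex_cnj_diff)
    have "L2sq f' \<noteq> top" using f(2) by (auto simp: L2fun_iff)
    then show "(\<lambda>n. L2sq f' * L2sq (\<lambda>x. g n x - g' x)) \<longlonglongrightarrow> 0"
      using tendsto_mult_ennreal[OF tendsto_const[of "L2sq f'"] g(3)] by simp
  qed
  \<comment> \<open>Each of the first three integrals has at least one factor that tends to 0 in
    L^2; the last one is the limit.\<close>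
  have decomp: "(\<integral>x. f n x * cnj (g n x) \<partial>lborel) = (\<integral>x. (f n x - f' x) * cnj (g n x - g' x) \<partial>lborel)
      + (\<integral>x. (f n x - f' x) * cnj (g' x) \<partial>lborel) + (\<integral>x. f' x * cnj (g n x - g' x) \<partial>lborel)
      + (\<integral>x. f' x * cnj (g' x) \<partial>lborel)" for n
  proof -
    note I = L2fun_mult_integrable[OF fd[of n] gd[of n]] L2fun_mult_integrable[OF fd[of n] L2fun_cnj[OF g(2)]]
      L2fun_mult_integrable[OF f(2) gd[of n]] L2fun_mult_integrable[OF f(2) L2fun_cnj[OF g(2)]]
    have "(\<integral>x. f n x * cnj (g n x) \<partial>lborel) = (\<integral>x. ((f n x - f' x) * cnj (g n x - g' x)
      + (f n x - f' x) * cnj (g' x)) + f' x * cnj (g n x - g' x) + f' x * cnj (g' x) \<partial>lborel)"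
      by (rule Bochner_Integration.integral_cong) (auto simp: algebra_simps)
    also note Bochner_Integration.integral_add[OF Bochner_Integration.integrable_add[OF Bochner_Integration.integrable_add[OF I(1,2)] I(3)] I(4)]
    also note Bochner_Integration.integral_add[OF Bochner_Integration.integrable_add[OF I(1,2)] I(3)]
    also note Bochner_Integration.integral_add[OF I(1,2)]
    finally show ?thesis .
  qed
  show ?thesis
    unfolding decomp using tendsto_add[OF tendsto_add[OF tendsto_add[OF A B] C] tendsto_const] by simp
qed

lemma L2sq_eq_inner:
  assumes "L2fun f"
  shows "complex_of_real (enn2real (L2sq f)) = (\<integral>x. f x * cnj (f x) \<partial>lborel)"
    and "L2sq f = ennreal (enn2real (L2sq f))"
proof -
  have "L2sq f = ennreal (\<integral>x. (cmod (f x))\<^sup>2 \<partial>lborel)"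
    unfolding L2sq_def using assms by (intro nn_integral_eq_integral) (auto simp: L2fun_def)
  then show "complex_of_real (enn2real (L2sq f)) = (\<integral>x. f x * cnj (f x) \<partial>lborel)"
    "L2sq f = ennreal (enn2real (L2sq f))"
    by (simp_all add: complex_norm_square[symmetric] del: of_real_power)
qed

lemma L2fun_fourier1:
  assumes f: "integrable lborel f" "L2fun f"
  shows "L2fun (fourier1 f)"
proof -
  have [measurable]: "f \<in> borel_measurable borel"
    using f by (auto simp: L2fun_iff)
  show ?thesis
    using f plancherel_L1[OF f(1)] by (auto simp: L2fun_iff)
qed

text \<open>Polarisation of \<open>plancherel_L1\<close>: in \<open>eq\<close> below, c = 1 gives
  the real part of the inner product and c = \<i> the imaginary part.\<close>

lemma parseval_L1:
  fixes f g :: "'a::euclidean_space \<Rightarrow> complex"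
  assumes f: "integrable lborel f" "L2fun f" and g: "integrable lborel g" "L2fun g"
  shows "(\<integral>x. f x * cnj (g x) \<partial>lborel) = (\<integral>x. fourier1 f x * cnj (fourier1 g x) \<partial>lborel)"
proof -
  have pol: "(\<integral>x. (u x + c * v x) * cnj (u x + c * v x) \<partial>lborel)
     = (\<integral>x. u x * cnj (u x) \<partial>lborel) + cnj c * (\<integral>x. u x * cnj (v x) \<partial>lborel)
       + c * cnj (\<integral>x. u x * cnj (v x) \<partial>lborel) + c * cnj c * (\<integral>x. v x * cnj (v x) \<partial>lborel)"
    if "L2fun u" "L2fun v" for u v :: "'a \<Rightarrow> complex" and c
  proof -
    note I = L2fun_mult_integrable[OF that(1) L2fun_cnj[OF that(1)]] 
       integrable_mult_right[OF L2fun_mult_integrable[OF that(1) L2fun_cnj[OF that(2)]], of "cnj c"]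
       integrable_mult_right[OF L2fun_mult_integrable[OF that(2) L2fun_cnj[OF that(1)]], of "c"]
       integrable_mult_right[OF L2fun_mult_integrable[OF that(2) L2fun_cnj[OF that(2)]], of "c * cnj c"]
    have sw: "cnj (\<integral>x. u x * cnj (v x) \<partial>lborel) = (\<integral>x. v x * cnj (u x) \<partial>lborel)"
      unfolding Bochner_Integration.integral_cnj[symmetric] by (simp add: mult.commute)
    have "(\<integral>x. (u x + c * v x) * cnj (u x + c * v x) \<partial>lborel)
      = (\<integral>x. ((u x * cnj (u x) + cnj c * (u x * cnj (v x))) + c * (v x * cnj (u x))) + c * cnj c * (v x * cnj (v x)) \<partial>lborel)"
      by (rule Bochner_Integration.integral_cong) (auto simp: algebra_simps)
    also note Bochner_Integration.integral_add[OF Bochner_Integration.integrable_add[OF Bochner_Integration.integrable_add[OF I(1,2)] I(3)] I(4)]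
    also note Bochner_Integration.integral_add[OF Bochner_Integration.integrable_add[OF I(1,2)] I(3)]
    also note Bochner_Integration.integral_add[OF I(1,2)]
    finally show ?thesis
      unfolding sw integral_mult_right_zero .
  qed
  have sq: "(\<integral>x. u x * cnj (u x) \<partial>lborel) = (\<integral>x. fourier1 u x * cnj (fourier1 u x) \<partial>lborel)"
    if "integrable lborel u" "L2fun u" for u :: "'a \<Rightarrow> complex"
    using L2sq_eq_inner(1)[OF that(2)] L2sq_eq_inner(1)[OF L2fun_fourier1[OF that]] plancherel_L1[OF that(1)]
    by simp
  let ?P = "\<integral>x. f x * cnj (g x) \<partial>lborel" and ?Q = "\<integral>x. fourier1 f x * cnj (fourier1 g x) \<partial>lborel"
  have eq: "cnj c * ?P + c * cnj ?P = cnj c * ?Q + c * cnj ?Q" for c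
  proof -
    let ?u = "\<lambda>x. f x + c * g x"
    have u: "integrable lborel ?u" "L2fun ?u" using f g by (auto intro!: L2fun_add L2fun_cmult)
    have fu: "fourier1 ?u x = fourier1 f x + c * fourier1 g x" for x
      using f g fourier1_add[of f "\<lambda>x. c * g x"] by (simp add: fourier1_mult_right)
    show ?thesis
      using sq[OF u] sq[OF f] sq[OF g] pol[OF f(2) g(2), of c]
        pol[OF L2fun_fourier1[OF f] L2fun_fourier1[OF g], of c]
      unfolding fu by simp
  qed
  from eq[of 1] have r: "?P + cnj ?P = ?Q + cnj ?Q" by simp
  from eq[of \<i>] have "\<i> * (cnj ?P - ?P) = \<i> * (cnj ?Q - ?Q)" by (simp add: algebra_simps)
  then have i: "cnj ?P - ?P = cnj ?Q - ?Q" by simp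
  have "2 * ?P = (?P + cnj ?P) - (cnj ?P - ?P)" by simp
  also have "\<dots> = 2 * ?Q" unfolding r i by simp
  finally show ?thesis by simp
qed

text \<open>Arbitrary approximating sequences replace the truncations of \<^const>\<open>is_fourier_L2\<close>, which are
  not stable under translation.\<close>

definition FT2 :: "('a::euclidean_space \<Rightarrow> complex) \<Rightarrow> ('a \<Rightarrow> complex) \<Rightarrow> bool" where
  "FT2 f F \<longleftrightarrow> L2fun f \<and> L2fun F \<and> (\<exists>s. (\<forall>n::nat. integrable lborel (s n) \<and> L2fun (s n)) \<and>
     (\<lambda>n. L2sq (\<lambda>x. s n x - f x)) \<longlonglongrightarrow> 0 \<and> (\<lambda>n. L2sq (\<lambda>x. fourier1 (s n) x - F x)) \<longlonglongrightarrow> 0)"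

lemma FT2_parseval:
  assumes "FT2 f F" "FT2 g G"
  shows "(\<integral>x. f x * cnj (g x) \<partial>lborel) = (\<integral>x. F x * cnj (G x) \<partial>lborel)"
proof -
  obtain s where s: "\<And>n::nat. integrable lborel (s n)" "\<And>n. L2fun (s n)"
     "(\<lambda>n. L2sq (\<lambda>x. s n x - f x)) \<longlonglongrightarrow> 0" "(\<lambda>n. L2sq (\<lambda>x. fourier1 (s n) x - F x)) \<longlonglongrightarrow> 0"
    using assms(1) unfolding FT2_def by blast
  obtain t where t: "\<And>n::nat. integrable lborel (t n)" "\<And>n. L2fun (t n)"
     "(\<lambda>n. L2sq (\<lambda>x. t n x - g x)) \<longlonglongrightarrow> 0" "(\<lambda>n. L2sq (\<lambda>x. fourier1 (t n) x - G x)) \<longlonglongrightarrow> 0"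
    using assms(2) unfolding FT2_def by blast
  have L: "L2fun f" "L2fun F" "L2fun g" "L2fun G" using assms by (auto simp: FT2_def)
  have "(\<lambda>n. \<integral>x. s n x * cnj (t n x) \<partial>lborel) \<longlonglongrightarrow> (\<integral>x. f x * cnj (g x) \<partial>lborel)"
    by (rule L2_inner_tendsto) (use s t L in auto)
  moreover have "(\<lambda>n. \<integral>x. fourier1 (s n) x * cnj (fourier1 (t n) x) \<partial>lborel) \<longlonglongrightarrow> (\<integral>x. F x * cnj (G x) \<partial>lborel)"
    by (rule L2_inner_tendsto) (use s t L in \<open>auto intro!: L2fun_fourier1\<close>)
  ultimately show ?thesis
    using parseval_L1[OF s(1,2) t(1,2)] by (auto intro: LIMSEQ_unique)
qed

lemma FT2_L2sq:
  assumes "FT2 f F" shows "L2sq f = L2sq F"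
proof -
  have L: "L2fun f" "L2fun F" using assms by (auto simp: FT2_def)
  have "enn2real (L2sq f) = enn2real (L2sq F)"
    using FT2_parseval[OF assms assms] L2sq_eq_inner(1)[OF L(1)] L2sq_eq_inner(1)[OF L(2)]
    by (simp flip: of_real_eq_iff[where 'a=complex])
  then show ?thesis using L2sq_eq_inner(2)[OF L(1)] L2sq_eq_inner(2)[OF L(2)] by simp
qed

section \<open>Truncated transforms and uniqueness of the L^2 transform\<close>

lemma L2sq_indicator:
  assumes [measurable]: "A \<in> sets borel"
  shows "L2sq (\<lambda>x::'a::euclidean_space. complex_of_real (indicator A x)) = emeasure lborel A"
proof -
  have "L2sq (\<lambda>x::'a. complex_of_real (indicator A x)) = (\<integral>\<^sup>+x. indicator A x \<partial>lborel)"
    unfolding L2sq_def by (rule nn_integral_cong) (auto split: split_indicator)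
  then show ?thesis by simp
qed

lemma L2fun_indicator:
  assumes "A \<in> sets borel" "emeasure lborel A < \<infinity>"
  shows "L2fun (\<lambda>x::'a::euclidean_space. complex_of_real (indicator A x))"
  using assms by (auto simp: L2fun_iff L2sq_indicator)

text \<open>The defining limit over real radii, taken along the integers, supplies the approximating
  sequence that \<open>FT2\<close> asks for. The truncations are integrable as products of f with
  the square-integrable indicator of a ball.\<close>

lemma is_fourier_L2_sequence:
  fixes f F :: "'a::euclidean_space \<Rightarrow> complex"
  assumes f: "L2fun f" and F: "is_fourier_L2 f F"
  defines "s \<equiv> \<lambda>(n::nat) x. indicator (cball 0 (real n)) x *\<^sub>R f x"
  shows "integrable lborel (s n)" "L2fun (s n)" "(\<lambda>n. L2sq (\<lambda>x. s n x - f x)) \<longlonglongrightarrow> 0"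
    "(\<lambda>n. L2sq (\<lambda>x. fourier1 (s n) x - F x)) \<longlonglongrightarrow> 0"
proof -
  have [measurable]: "f \<in> borel_measurable borel" using f by (auto simp: L2fun_iff)
  have sle: "cmod (s n x) \<le> cmod (f x)" for n x
    by (auto simp: s_def split: split_indicator)
  have [measurable]: "s n \<in> borel_measurable borel" for n
    unfolding s_def by (intro borel_measurable_scaleR borel_measurable_indicator) auto
  show sL: "L2fun (s n)" for n
  proof -
    have "L2sq (s n) \<le> L2sq f"
      unfolding L2sq_def by (intro nn_integral_mono ennreal_leI power_mono sle) auto
    then show ?thesis using f unfolding L2fun_iff by (auto elim: order.strict_trans1)
  qed
  show "integrable lborel (s n)" for n
  proof -
    have "L2fun (\<lambda>x::'a. complex_of_real (indicator (cball 0 (real n)) x))"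
      by (rule L2fun_indicator) (use emeasure_lborel_cball_finite[of "0::'a" "real n"] in auto)
    from L2fun_mult_integrable[OF this f] show ?thesis
      by (simp add: s_def scaleR_conv_of_real[abs_def])
  qed
  have "(\<lambda>n. \<integral>x. (cmod (s n x - f x))\<^sup>2 \<partial>lborel) \<longlonglongrightarrow> (\<integral>x. 0 \<partial>(lborel :: 'a measure))"
  proof (rule integral_dominated_convergence[where w="\<lambda>x. (cmod (f x))\<^sup>2"])
    show "AE x in lborel. (\<lambda>n. (cmod (s n x - f x))\<^sup>2) \<longlonglongrightarrow> 0"
    proof (intro AE_I2 tendsto_eventually)
      fix x :: 'a
      obtain N where "norm x \<le> real N" using real_arch_simple by blast
      then show "\<forall>\<^sub>F n in sequentially. (cmod (s n x - f x))\<^sup>2 = 0"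
        unfolding eventually_sequentially by (intro exI[of _ N]) (auto simp: s_def indicator_def)
    qed
  qed (use f in \<open>auto simp: L2fun_def s_def indicator_def\<close>)
  moreover have "L2sq (\<lambda>x. s n x - f x) = ennreal (\<integral>x. (cmod (s n x - f x))\<^sup>2 \<partial>lborel)" for n
    unfolding L2sq_def using L2fun_diff[OF sL[of n] f] by (intro nn_integral_eq_integral) (auto simp: L2fun_def)
  ultimately show "(\<lambda>n. L2sq (\<lambda>x. s n x - f x)) \<longlonglongrightarrow> 0"
    by (simp add: tendsto_ennreal_iff flip: ennreal_0)
  have "((\<lambda>R::real. \<integral>\<^sup>+ \<gamma>. sqnorm (F \<gamma> -
         (LINT x:cball 0 R|lborel. f x * cis (- 2 * pi * (x \<bullet> \<gamma>)))) \<partial>lborel) \<longlongrightarrow> 0) at_top"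
    using F unfolding is_fourier_L2_def by auto
  from filterlim_compose[OF this filterlim_real_sequentially]
  show "(\<lambda>n. L2sq (\<lambda>x. fourier1 (s n) x - F x)) \<longlonglongrightarrow> 0"
    unfolding L2sq_def set_lebesgue_integral_def fourier1_def s_def
    by (simp add: norm_minus_commute)
qed

lemma is_fourier_L2_FT2:
  assumes f: "L2fun f" and F: "is_fourier_L2 f F"
  shows "FT2 f F"
proof -
  have "L2fun F" using F by (auto simp: is_fourier_L2_def)
  then show ?thesis
    unfolding FT2_def using f is_fourier_L2_sequence[OF f F] by (intro conjI exI allI) assumption+
qed

lemma L2sq_eq_0_iff:
  assumes [measurable]: "f \<in> borel_measurable borel"
  shows "L2sq f = 0 \<longleftrightarrow> (AE x in lborel. f x = 0)"
  unfolding L2sq_def by (subst nn_integral_0_iff_AE) (auto simp: ennreal_eq_0_iff)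

text \<open>Both functions are L^2 limits of the same truncated transforms. Membership in
  \<open>PW\<close> only says that some transform of f vanishes off \<Lambda>; uniqueness carries
  this over to any given transform.\<close>

lemma is_fourier_L2_unique:
  assumes f: "L2fun f" and F: "is_fourier_L2 f F" and F': "is_fourier_L2 f F'"
  shows "AE x in lborel. F x = F' x"
proof -
  have [measurable]: "f \<in> borel_measurable borel" "F \<in> borel_measurable borel" "F' \<in> borel_measurable borel"
    using f F F' by (auto simp: L2fun_iff is_fourier_L2_def)
  define s where "s = (\<lambda>(n::nat) x. indicator (cball 0 (real n)) x *\<^sub>R f x)"
  have [measurable]: "s n \<in> borel_measurable borel" for n
    unfolding s_def by (intro borel_measurable_scaleR borel_measurable_indicator) auto
  have l: "(\<lambda>n. L2sq (\<lambda>x. fourier1 (s n) x - F x)) \<longlonglongrightarrow> 0" "(\<lambda>n. L2sq (\<lambda>x. fourier1 (s n) x - F' x)) \<longlonglongrightarrow> 0"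
    unfolding s_def using is_fourier_L2_sequence(4)[OF f] F F' by auto
  have "(\<lambda>n. 2 * L2sq (\<lambda>x. fourier1 (s n) x - F' x) + 2 * L2sq (\<lambda>x. fourier1 (s n) x - F x)) \<longlonglongrightarrow> 2 * 0 + 2 * 0"
    by (intro tendsto_add tendsto_mult_ennreal tendsto_const l) auto
  moreover have "L2sq (\<lambda>x. F x - F' x) \<le> 2 * L2sq (\<lambda>x. fourier1 (s n) x - F' x) + 2 * L2sq (\<lambda>x. fourier1 (s n) x - F x)" for n
    using L2sq_diff_le[of "\<lambda>x. fourier1 (s n) x - F' x" "\<lambda>x. fourier1 (s n) x - F x"] by simp
  ultimately have "L2sq (\<lambda>x. F x - F' x) \<le> 0"
    by (intro Lim_bounded2[where N=0]) auto
  then have "L2sq (\<lambda>x. F x - F' x) = 0" by simp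
  then show ?thesis by (subst (asm) L2sq_eq_0_iff) auto
qed

section \<open>Time-frequency shifts and the two forms of the short-time transform\<close>

lemma L2sq_shift:
  assumes [measurable]: "f \<in> borel_measurable borel"
  shows "L2sq (\<lambda>x. f (x - a)) = L2sq f"
  unfolding L2sq_def by (rule nn_integral_lborel_shift[where f="\<lambda>x. sqnorm (f x)"]) measurable

lemma L2sq_modulate: "L2sq (\<lambda>x. f x * cis (h x)) = L2sq f"
  by (simp add: L2sq_def norm_mult)

text \<open>Transforming the approximating sequence in the same way leaves all L^2 errors unchanged:
  phases have modulus 1 and Lebesgue measure is translation invariant.\<close>

lemma FT2_shift_modulate:
  assumes "FT2 g G"
  shows "FT2 (\<lambda>t. g (t - x) * cis (2 * pi * (t \<bullet> \<omega>))) (\<lambda>\<gamma>. G (\<gamma> - \<omega>) * cis (- 2 * pi * (x \<bullet> (\<gamma> - \<omega>))))"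
proof -
  obtain s where s: "\<And>n::nat. integrable lborel (s n)" "\<And>n. L2fun (s n)"
     "(\<lambda>n. L2sq (\<lambda>x. s n x - g x)) \<longlonglongrightarrow> 0" "(\<lambda>n. L2sq (\<lambda>x. fourier1 (s n) x - G x)) \<longlonglongrightarrow> 0"
    using assms unfolding FT2_def by blast
  have L: "L2fun g" "L2fun G" using assms by (auto simp: FT2_def)
  have [measurable]: "g \<in> borel_measurable borel" "G \<in> borel_measurable borel" "\<And>n. s n \<in> borel_measurable borel"
    using L s by (auto simp: L2fun_iff)
  define s' where "s' = (\<lambda>n t. s n (t - x) * cis (2 * pi * (t \<bullet> \<omega>)))"
  have f': "fourier1 (s' n) \<gamma> = fourier1 (s n) (\<gamma> - \<omega>) * cis (- 2 * pi * (x \<bullet> (\<gamma> - \<omega>)))" for n \<gamma>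
    unfolding s'_def fourier1_modulate by (simp add: fourier1_shift[OF s(1)])
  show ?thesis
    unfolding FT2_def
  proof (intro conjI exI[of _ s'] allI)
    show "integrable lborel (s' n)" for n
      unfolding s'_def by (rule fourier1_integrand_integrable) (rule integrable_lborel_shift[OF s(1)])
    show "L2fun (s' n)" for n
      using s(2)[of n] unfolding L2fun_iff s'_def by (simp add: L2sq_modulate L2sq_shift)
    have "L2sq (\<lambda>t. s' n t - g (t - x) * cis (2 * pi * (t \<bullet> \<omega>))) = L2sq (\<lambda>x. s n x - g x)" for n
      unfolding s'_def left_diff_distrib[symmetric] L2sq_modulate
      using L2sq_shift[of "\<lambda>x. s n x - g x" x] by simp
    then show "(\<lambda>n. L2sq (\<lambda>t. s' n t - g (t - x) * cis (2 * pi * (t \<bullet> \<omega>)))) \<longlonglongrightarrow> 0"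
      using s(3) by simp
    have "L2sq (\<lambda>\<gamma>. fourier1 (s' n) \<gamma> - G (\<gamma> - \<omega>) * cis (- 2 * pi * (x \<bullet> (\<gamma> - \<omega>)))) = L2sq (\<lambda>x. fourier1 (s n) x - G x)" for n
      unfolding f' left_diff_distrib[symmetric] L2sq_modulate
      using L2sq_shift[of "\<lambda>x. fourier1 (s n) x - G x" \<omega>] by simp
    then show "(\<lambda>n. L2sq (\<lambda>\<gamma>. fourier1 (s' n) \<gamma> - G (\<gamma> - \<omega>) * cis (- 2 * pi * (x \<bullet> (\<gamma> - \<omega>))))) \<longlonglongrightarrow> 0"
      using s(4) by simp
  qed (use L in \<open>auto simp: L2fun_iff L2sq_modulate L2sq_shift\<close>)
qed

text \<open>The fundamental identity of time-frequency analysis: Parseval against a time-frequency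
  shift of g. The remaining phase depends on x and \<omega> only and disappears under the
  modulus.\<close>

lemma cmod_STFT_eq:
  assumes f: "FT2 f F" and g: "FT2 g G"
  shows "cmod (STFT g f x \<omega>) = cmod (STFT G F \<omega> (- x))"
proof -
  have "STFT g f x \<omega> = (\<integral>t. f t * cnj (g (t - x) * cis (2 * pi * (t \<bullet> \<omega>))) \<partial>lborel)"
    unfolding STFT_def by (simp add: cis_cnj mult.assoc)
  also have "\<dots> = (\<integral>\<gamma>. F \<gamma> * cnj (G (\<gamma> - \<omega>) * cis (- 2 * pi * (x \<bullet> (\<gamma> - \<omega>)))) \<partial>lborel)"
    by (rule FT2_parseval[OF f FT2_shift_modulate[OF g]])
  also have "\<dots> = (\<integral>\<gamma>. (F \<gamma> * cnj (G (\<gamma> - \<omega>)) * cis (- 2 * pi * (\<gamma> \<bullet> - x))) * cis (- 2 * pi * (x \<bullet> \<omega>)) \<partial>lborel)"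
  proof (rule Bochner_Integration.integral_cong[OF refl])
    fix \<gamma>
    have "cnj (cis (- 2 * pi * (x \<bullet> (\<gamma> - \<omega>)))) = cis (- 2 * pi * (\<gamma> \<bullet> - x)) * cis (- 2 * pi * (x \<bullet> \<omega>))"
      by (simp add: cis_cnj cis_mult inner_diff_right inner_commute right_diff_distrib)
    then show "F \<gamma> * cnj (G (\<gamma> - \<omega>) * cis (- 2 * pi * (x \<bullet> (\<gamma> - \<omega>))))
       = (F \<gamma> * cnj (G (\<gamma> - \<omega>)) * cis (- 2 * pi * (\<gamma> \<bullet> - x))) * cis (- 2 * pi * (x \<bullet> \<omega>))"
      by (simp add: mult.assoc)
  qed
  also have "\<dots> = STFT G F \<omega> (- x) * cis (- 2 * pi * (x \<bullet> \<omega>))"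
    unfolding STFT_def by (rule integral_mult_left_zero)
  finally show ?thesis by (simp add: norm_mult)
qed

lemma STFT_eq_fourier1: "STFT g f x = fourier1 (\<lambda>t. f t * cnj (g (t - x)))"
  by (simp add: fun_eq_iff STFT_def fourier1_def)

text \<open>Reconciles the argument -x produced by \<open>cmod_STFT_eq\<close> with the argument x
  in part (a).\<close>

lemma stft_energy_reflect:
  fixes E :: "'a::euclidean_space set"
  assumes "\<forall>x\<in>E. - x \<in> E"
  shows "stft_energy E (\<lambda>x. V (- x)) = stft_energy E V"
proof -
  have "bij_betw uminus E E"
    using assms by (intro bij_betw_byWitness[where f'=uminus]) auto
  then show ?thesis
    unfolding stft_energy_def
    by (rule nn_integral_bij_count_space[where f="\<lambda>x. \<integral>\<^sup>+ \<omega>. sqnorm (V x \<omega>) \<partial>lborel"])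
qed

subsection \<open>Band-limited functions\<close>

text \<open>Shifting H by w with w.x = 1/2 changes the sign of its transform at x, so twice the
  modulus there is at most the L^1 translation error of H; the shortest such w has norm 1 / (2
  |x|).\<close>

lemma riemann_lebesgue:
  fixes H :: "'a::euclidean_space \<Rightarrow> complex"
  assumes H: "integrable lborel H"
  shows "(fourier1 H \<longlongrightarrow> 0) at_infinity"
proof (rule ccontr)
  assume "\<not> ?thesis"
  then obtain e where e: "e > 0" "\<And>b. \<exists>x. norm x \<ge> b \<and> cmod (fourier1 H x) \<ge> e"
    unfolding Lim_at_infinity by (auto simp: not_less)
  have "\<exists>x. \<forall>n::nat. norm (x n) \<ge> real (Suc n) \<and> cmod (fourier1 H (x n)) \<ge> e"
    using e(2) by (intro choice) auto
  then obtain x where x: "\<And>n::nat. norm (x n) \<ge> real (Suc n)" "\<And>n. cmod (fourier1 H (x n)) \<ge> e"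
    by blast
  have x0: "x n \<noteq> 0" for n using x(1)[of n] by auto
  define w where "w = (\<lambda>n. (1 / (2 * (norm (x n))\<^sup>2)) *\<^sub>R x n)"
  have wx: "w n \<bullet> x n = 1/2" for n
    using x0[of n] by (simp add: w_def dot_square_norm)
  have "norm (w n) \<le> 1 / real (Suc n)" for n
  proof -
    have "norm (w n) = 1 / (2 * norm (x n))"
      using x0[of n] by (simp add: w_def power2_eq_square)
    also have "\<dots> \<le> 1 / real (Suc n)"
      by (rule divide_left_mono) (use x(1)[of n] x0[of n] in \<open>auto intro!: mult_pos_pos\<close>)
    finally show ?thesis .
  qed
  then have w: "w \<longlonglongrightarrow> 0"
    by (intro Lim_null_comparison[OF always_eventually LIMSEQ_Suc[OF lim_1_over_n]]) auto
  have "2 * e \<le> (\<integral>\<gamma>. cmod (H (\<gamma> - w n) - H \<gamma>) \<partial>lborel)" for n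
  proof -
    have sh: "integrable lborel (\<lambda>\<gamma>. H (\<gamma> - w n))" by (rule integrable_lborel_shift[OF H])
    have "fourier1 (\<lambda>\<gamma>. H (\<gamma> - w n) - H \<gamma>) (x n) = - 2 * fourier1 H (x n)"
    proof -
      have "cis (- 2 * pi * (w n \<bullet> x n)) = -1" by (simp add: wx cis.code complex_eq_iff)
      then show ?thesis using fourier1_diff[OF sh H] fourier1_shift[OF H, of "w n" "x n"] by simp
    qed
    then have "2 * cmod (fourier1 H (x n)) = cmod (fourier1 (\<lambda>\<gamma>. H (\<gamma> - w n) - H \<gamma>) (x n))"
      by (simp add: norm_mult)
    also have "\<dots> \<le> (\<integral>\<gamma>. cmod (H (\<gamma> - w n) - H \<gamma>) \<partial>lborel)"
      by (rule norm_fourier1_le)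
    finally show ?thesis using x(2)[of n] by simp
  qed
  moreover have "\<forall>\<^sub>F n in sequentially. (\<integral>\<gamma>. cmod (H (\<gamma> - w n) - H \<gamma>) \<partial>lborel) < 2 * e"
    using order_tendstoD(2)[OF L1_translation_continuous[OF H w], of "2 * e"] e(1) by simp
  ultimately show False
    by (auto simp: eventually_sequentially not_less[symmetric])
qed

definition PWfun :: "'a::euclidean_space set \<Rightarrow> ('a \<Rightarrow> complex) \<Rightarrow> bool" where
  "PWfun \<Lambda> f \<longleftrightarrow> (\<exists>H. integrable lborel H \<and> (\<forall>\<gamma>. \<gamma> \<notin> \<Lambda> \<longrightarrow> H \<gamma> = 0) \<and> f = fourier1 H)"

lemma PWfun_continuous: "PWfun \<Lambda> f \<Longrightarrow> continuous_on UNIV f"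
  by (auto simp: PWfun_def intro: continuous_on_fourier1)

lemma PWfun_tendsto: "PWfun \<Lambda> f \<Longrightarrow> (f \<longlongrightarrow> 0) at_infinity"
  by (auto simp: PWfun_def intro: riemann_lebesgue)

lemma PWfun_bounded:
  assumes "PWfun \<Lambda> f" obtains M where "M > 0" "\<And>x. cmod (f x) \<le> M"
proof -
  obtain H where H: "f = fourier1 H" using assms by (auto simp: PWfun_def)
  have "cmod (f x) \<le> (\<integral>x. cmod (H x) \<partial>lborel) + 1" for x
    using norm_fourier1_le[of H x] by (simp add: H)
  moreover have "(\<integral>x. cmod (H x) \<partial>lborel) + 1 > 0"
    by (intro add_nonneg_pos) auto
  ultimately show thesis by (rule that[rotated])
qed

lemma PWfun_translate:
  assumes "PWfun \<Lambda> f" shows "PWfun \<Lambda> (\<lambda>x. f (x + y))"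
proof -
  obtain H where H: "integrable lborel H" "\<And>\<gamma>. \<gamma> \<notin> \<Lambda> \<Longrightarrow> H \<gamma> = 0" "f = fourier1 H"
    using assms by (auto simp: PWfun_def)
  show ?thesis
    unfolding PWfun_def
  proof (intro exI[of _ "\<lambda>\<gamma>. H \<gamma> * cis (2 * pi * (\<gamma> \<bullet> - y))"] conjI)
    show "(\<lambda>x. f (x + y)) = fourier1 (\<lambda>\<gamma>. H \<gamma> * cis (2 * pi * (\<gamma> \<bullet> - y)))"
      unfolding fourier1_modulate by (simp add: H fun_eq_iff)
    show "integrable lborel (\<lambda>\<gamma>. H \<gamma> * cis (2 * pi * (\<gamma> \<bullet> - y)))"
      by (rule fourier1_integrand_integrable[OF H(1)])
  qed (use H in auto)
qed

lemma PWfun_cmult: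
  assumes "PWfun \<Lambda> f" shows "PWfun \<Lambda> (\<lambda>x. c * f x)"
proof -
  obtain H where H: "integrable lborel H" "\<And>\<gamma>. \<gamma> \<notin> \<Lambda> \<Longrightarrow> H \<gamma> = 0" "f = fourier1 H"
    using assms by (auto simp: PWfun_def)
  then show ?thesis
    unfolding PWfun_def
    by (intro exI[of _ "\<lambda>\<gamma>. c * H \<gamma>"]) (auto simp: fourier1_mult_right)
qed

lemma PWfun_dilate:
  fixes \<Lambda> :: "'a::euclidean_space set"
  assumes "PWfun ((\<lambda>\<gamma>. t *\<^sub>R \<gamma>) ` \<Lambda>) f" and t: "t > 0"
  shows "PWfun \<Lambda> (\<lambda>x. f ((1 / t) *\<^sub>R x))"
proof -
  obtain H where H: "integrable lborel H" "\<And>\<gamma>. \<gamma> \<notin> (\<lambda>\<gamma>. t *\<^sub>R \<gamma>) ` \<Lambda> \<Longrightarrow> H \<gamma> = 0" "f = fourier1 H"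
    using assms by (auto simp: PWfun_def)
  show ?thesis
    unfolding PWfun_def
  proof (intro exI[of _ "\<lambda>\<gamma>. t ^ DIM('a) *\<^sub>R H (t *\<^sub>R \<gamma>)"] conjI allI impI)
    show "integrable lborel (\<lambda>\<gamma>. t ^ DIM('a) *\<^sub>R H (t *\<^sub>R \<gamma>))"
      using integrable_lborel_affine[OF H(1), of t 0] t by simp
    show "t ^ DIM('a) *\<^sub>R H (t *\<^sub>R \<gamma>) = 0" if "\<gamma> \<notin> \<Lambda>" for \<gamma>
      using that t by (auto intro!: H(2))
    show "(\<lambda>x. f ((1 / t) *\<^sub>R x)) = fourier1 (\<lambda>\<gamma>. t ^ DIM('a) *\<^sub>R H (t *\<^sub>R \<gamma>))"
    proof
      fix x
      have "f ((1 / t) *\<^sub>R x) = \<bar>t\<bar> ^ DIM('a) *\<^sub>R (\<integral>\<gamma>. H (0 + t *\<^sub>R \<gamma>) * cis (- 2 * pi * ((0 + t *\<^sub>R \<gamma>) \<bullet> ((1 / t) *\<^sub>R x))) \<partial>lborel)"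
        unfolding H(3) fourier1_def
        by (rule integral_lborel_affine[OF fourier1_integrand_integrable[OF H(1)]]) (use t in auto)
      also have "\<dots> = fourier1 (\<lambda>\<gamma>. t ^ DIM('a) *\<^sub>R H (t *\<^sub>R \<gamma>)) x"
        unfolding fourier1_def using t by (simp flip: integral_scaleR_right)
      finally show "f ((1 / t) *\<^sub>R x) = fourier1 (\<lambda>\<gamma>. t ^ DIM('a) *\<^sub>R H (t *\<^sub>R \<gamma>)) x" .
    qed
  qed
qed

text \<open>The kernel is the product of the transforms of the indicators of two concentric balls of radii
  \<open>M + 1\<close> and \<open>1\<close>; its transform is a convolution of indicators, constant on the ball of radius \<open>M\<close>.\<close>

lemma reproducing_kernel:
  fixes M :: real
  obtains \<psi> :: "'a::euclidean_space \<Rightarrow> complex"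
  where "integrable lborel \<psi>" "\<And>\<gamma>. norm \<gamma> < M \<Longrightarrow> fourier1 \<psi> \<gamma> = 1"
proof -
  define k1 :: "'a \<Rightarrow> complex" where "k1 = (\<lambda>x. complex_of_real (indicator (ball 0 (M + 1)) x))"
  define k2 :: "'a \<Rightarrow> complex" where "k2 = (\<lambda>x. complex_of_real (indicator (ball 0 1) x))"
  define V where "V = measure lborel (ball (0::'a) 1)"
  have V: "V > 0"
    unfolding V_def by (rule content_ball_pos) auto
  have fin: "emeasure lborel (ball (c::'a) r) < \<infinity>" for c r
    by (rule emeasure_lborel_ball_finite)
  have k: "integrable lborel k1" "L2fun k1" "integrable lborel k2" "L2fun k2"
    unfolding k1_def k2_def using fin by (auto intro!: L2fun_indicator integrable_of_real)
  \<comment> \<open>For |\<gamma>| < M the unit ball about \<gamma> lies in the ball of radius M +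
    1, so the convolution of the indicators equals the volume V there; dividing by V makes the
    plateau 1.\<close>
  define \<psi> where "\<psi> = (\<lambda>x. cnj (fourier1 k1 x) * fourier1 k2 x / V)"
  have int: "integrable lborel (\<lambda>x. cnj (fourier1 k1 x) * fourier1 k2 x)"
    by (intro L2fun_mult_integrable L2fun_cnj L2fun_fourier1 k)
  show thesis
  proof
    show "integrable lborel \<psi>"
      unfolding \<psi>_def using int by simp
    fix \<gamma> :: 'a assume g: "norm \<gamma> < M"
    let ?k = "\<lambda>t. k2 (t - \<gamma>)"
    have k': "integrable lborel ?k" "L2fun ?k"
      using integrable_lborel_shift[OF k(3)] k(4) by (auto simp: L2fun_iff L2sq_shift)
    have "cnj (fourier1 \<psi> \<gamma>) = (\<integral>x. fourier1 k1 x * cnj (fourier1 ?k x) / V \<partial>lborel)"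
      unfolding fourier1_def[of \<psi>] fourier1_shift[OF k(3)]
      unfolding Bochner_Integration.integral_cnj[symmetric] \<psi>_def
      by (rule Bochner_Integration.integral_cong) (simp_all add: cis_cnj inner_commute mult_ac)
    also have "\<dots> = (\<integral>x. fourier1 k1 x * cnj (fourier1 ?k x) \<partial>lborel) / V"
      by simp
    also have "(\<integral>x. fourier1 k1 x * cnj (fourier1 ?k x) \<partial>lborel) = (\<integral>x. k1 x * cnj (?k x) \<partial>lborel)"
      by (rule parseval_L1[symmetric]) (use k k' in auto)
    also have "\<dots> = (\<integral>x. complex_of_real (indicator (ball \<gamma> 1) x) \<partial>lborel)"
    proof (rule Bochner_Integration.integral_cong[OF refl])
      fix x
      have "x \<in> ball 0 (M + 1)" if "x \<in> ball \<gamma> 1"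
        using that g norm_triangle_ineq[of "x - \<gamma>" \<gamma>] by (simp add: dist_norm norm_minus_commute)
      moreover have "x - \<gamma> \<in> ball 0 1 \<longleftrightarrow> x \<in> ball \<gamma> 1" by (simp add: dist_norm norm_minus_commute)
      ultimately show "k1 x * cnj (?k x) = complex_of_real (indicator (ball \<gamma> 1) x)"
        unfolding k1_def k2_def indicator_def by auto
    qed
    also have "\<dots> = V"
      using content_ball_conv_unit_ball[of 1 \<gamma>] by (simp add: V_def)
    finally have "cnj (fourier1 \<psi> \<gamma>) = 1" using V by simp
    then show "fourier1 \<psi> \<gamma> = 1" by (simp add: complex_eq_iff)
  qed
qed

text \<open>Since f is reproduced by pairing with translates of \<psi>, a sup bound on f transfers
  the L^1 translation modulus of \<psi> to f. The modulus depends on M alone, hence serves a whole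
  family of dilated spectra at once.\<close>

lemma PWfun_equicontinuous:
  fixes M :: real
  obtains \<omega> :: "'a::euclidean_space \<Rightarrow> real"
  where "\<And>w::nat \<Rightarrow> 'a. w \<longlonglongrightarrow> 0 \<Longrightarrow> (\<lambda>n. \<omega> (w n)) \<longlonglongrightarrow> 0"
    "\<And>S f x t. PWfun S f \<Longrightarrow> S \<subseteq> ball 0 M \<Longrightarrow> (\<And>x. cmod (f x) \<le> 1) \<Longrightarrow> cmod (f (x + t) - f x) \<le> \<omega> t"
proof -
  obtain \<psi> :: "'a \<Rightarrow> complex" where \<psi>: "integrable lborel \<psi>" "\<And>\<gamma>. norm \<gamma> < M \<Longrightarrow> fourier1 \<psi> \<gamma> = 1"
    using reproducing_kernel by blast
  define \<omega> where "\<omega> = (\<lambda>t. \<integral>v. cmod (\<psi> (v - t) - \<psi> v) \<partial>lborel)"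
  show thesis
  proof
    show "(\<lambda>n. \<omega> (w n)) \<longlonglongrightarrow> 0" if "w \<longlonglongrightarrow> 0" for w :: "nat \<Rightarrow> 'a"
      unfolding \<omega>_def by (rule L1_translation_continuous[OF \<psi>(1) that])
    fix S :: "'a set" and f x t assume f: "PWfun S f" and S: "S \<subseteq> ball 0 M" and f1: "\<And>x. cmod (f x) \<le> 1"
    obtain H where H: "integrable lborel H" "\<And>\<gamma>. \<gamma> \<notin> S \<Longrightarrow> H \<gamma> = 0" "f = fourier1 H"
      using f by (auto simp: PWfun_def)
    have [measurable]: "f \<in> borel_measurable borel"
      using PWfun_continuous[OF f] by (rule borel_measurable_continuous_onI)
    have int: "integrable lborel (\<lambda>v. f v * \<psi> (v - x))" for x :: 'a
      by (rule Bochner_Integration.integrable_bound[OF integrable_lborel_shift[OF \<psi>(1), of x]])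
         (use borel_measurable_integrable[OF \<psi>(1)] in \<open>auto simp: norm_mult intro!: mult_left_le_one_le f1\<close>)
    have rep: "f x = (\<integral>v. f v * \<psi> (v - x) \<partial>lborel)" for x :: 'a
    proof -
      have "f x = (\<integral>\<gamma>. H \<gamma> * fourier1 (\<lambda>v. \<psi> (v - x)) \<gamma> \<partial>lborel)"
        unfolding H(3) fourier1_shift[OF \<psi>(1)] unfolding fourier1_def[of H]
      proof (rule Bochner_Integration.integral_cong[OF refl])
        fix \<gamma>
        show "H \<gamma> * cis (- 2 * pi * (\<gamma> \<bullet> x)) = H \<gamma> * (cis (- 2 * pi * (x \<bullet> \<gamma>)) * fourier1 \<psi> \<gamma>)"
          using H(2)[of \<gamma>] S \<psi>(2)[of \<gamma>] by (cases "\<gamma> \<in> S") (auto simp: inner_commute)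
      qed
      also have "\<dots> = (\<integral>v. f v * \<psi> (v - x) \<partial>lborel)"
        unfolding H(3)
        by (rule fourier1_multiplication_formula[OF H(1) integrable_lborel_shift[OF \<psi>(1)], symmetric])
      finally show ?thesis .
    qed
    have "f (x + t) - f x = (\<integral>v. f v * (\<psi> (v - x - t) - \<psi> (v - x)) \<partial>lborel)"
      unfolding rep[of "x + t"] rep[of x]
      by (subst Bochner_Integration.integral_diff[symmetric, OF int int]) (simp add: algebra_simps)
    also have "cmod \<dots> \<le> (\<integral>v. cmod (\<psi> (v - x - t) - \<psi> (v - x)) \<partial>lborel)"
    proof (rule Bochner_Integration.integral_norm_bound_integral)
      show "integrable lborel (\<lambda>v. f v * (\<psi> (v - x - t) - \<psi> (v - x)))"
        using Bochner_Integration.integrable_diff[OF int[of "x + t"] int[of x]] by (simp add: algebra_simps)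
      show "integrable lborel (\<lambda>v. cmod (\<psi> (v - x - t) - \<psi> (v - x)))"
        using integrable_lborel_shift[OF \<psi>(1), of "x + t"] integrable_lborel_shift[OF \<psi>(1), of x]
        by (simp add: algebra_simps)
    qed (auto simp: norm_mult intro!: mult_left_le_one_le f1)
    also have "\<dots> = \<omega> t"
      unfolding \<omega>_def
      using integral_lborel_shift[of "\<lambda>v. cmod (\<psi> (v - t) - \<psi> v)" x] \<psi>(1) integrable_lborel_shift[OF \<psi>(1), of t]
      by (simp add: algebra_simps)
    finally show "cmod (f (x + t) - f x) \<le> \<omega> t" .
  qed
qed

text \<open>The spectrum of the product is the convolution of the spectra; at a point off C its
  integrand vanishes identically.\<close>

lemma PWfun_mult:
  fixes A B :: "'a::euclidean_space set"
  assumes "PWfun A f" "PWfun B h" and AB: "\<And>a b. a \<in> A \<Longrightarrow> b \<in> B \<Longrightarrow> a + b \<in> C"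
  shows "PWfun C (\<lambda>x. f x * h x)"
proof -
  obtain H where H: "integrable lborel H" "\<And>\<gamma>. \<gamma> \<notin> A \<Longrightarrow> H \<gamma> = 0" "f = fourier1 H"
    using assms by (auto simp: PWfun_def)
  obtain k where k: "integrable lborel k" "\<And>\<gamma>. \<gamma> \<notin> B \<Longrightarrow> k \<gamma> = 0" "h = fourier1 k"
    using assms by (auto simp: PWfun_def)
  have [measurable]: "H \<in> borel_measurable borel" "k \<in> borel_measurable borel"
    using borel_measurable_integrable[OF H(1)] borel_measurable_integrable[OF k(1)] by auto
  let ?C = "\<lambda>\<gamma>. \<integral>\<eta>. H \<eta> * k (\<gamma> - \<eta>) \<partial>lborel"
  have I0: "integrable (lborel \<Otimes>\<^sub>M lborel) (\<lambda>(\<eta>, \<gamma>). H \<eta> * k (\<gamma> - \<eta>))"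
  proof (rule lborel_pair.Fubini_integrable, goal_cases)
    case 2
    have "(\<lambda>\<eta>. \<integral>\<gamma>. cmod (case (\<eta>, \<gamma>) of (\<eta>, \<gamma>) \<Rightarrow> H \<eta> * k (\<gamma> - \<eta>)) \<partial>lborel)
       = (\<lambda>\<eta>. cmod (H \<eta>) * (\<integral>x. cmod (k x) \<partial>lborel))"
      using integral_lborel_shift[OF integrable_norm[OF k(1)]] by (simp add: norm_mult)
    then show ?case using H(1) by simp
  qed (use integrable_lborel_shift[OF k(1)] in auto)
  have I: "integrable (lborel \<Otimes>\<^sub>M lborel) (\<lambda>(\<eta>, \<gamma>). H \<eta> * k (\<gamma> - \<eta>) * cis (- 2 * pi * (\<gamma> \<bullet> x)))" for x
    by (rule Bochner_Integration.integrable_bound[OF I0]) (auto simp: norm_mult)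
  show ?thesis
    unfolding PWfun_def
  proof (intro exI[of _ ?C] conjI allI impI ext)
    show "integrable lborel ?C"
      using lborel_pair.integrable_snd[OF I0] .
    show "?C \<gamma> = 0" if "\<gamma> \<notin> C" for \<gamma>
    proof -
      have "H \<eta> * k (\<gamma> - \<eta>) = 0" for \<eta>
        using AB[of \<eta> "\<gamma> - \<eta>"] that H(2)[of \<eta>] k(2)[of "\<gamma> - \<eta>"] by auto
      then have "(\<lambda>\<eta>. H \<eta> * k (\<gamma> - \<eta>)) = (\<lambda>\<eta>. 0)" by (rule ext)
      then show ?thesis by (simp only: Bochner_Integration.integral_zero)
    qed
    fix x
    have "fourier1 ?C x = (\<integral>\<gamma>. (\<integral>\<eta>. H \<eta> * k (\<gamma> - \<eta>) * cis (- 2 * pi * (\<gamma> \<bullet> x)) \<partial>lborel) \<partial>lborel)"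
      unfolding fourier1_def by simp
    also have "\<dots> = (\<integral>\<eta>. (\<integral>\<gamma>. H \<eta> * k (\<gamma> - \<eta>) * cis (- 2 * pi * (\<gamma> \<bullet> x)) \<partial>lborel) \<partial>lborel)"
      by (rule lborel_pair.Fubini_integral[OF I])
    also have "\<dots> = (\<integral>\<eta>. H \<eta> * fourier1 (\<lambda>\<gamma>. k (\<gamma> - \<eta>)) x \<partial>lborel)"
      unfolding fourier1_def
      by (intro Bochner_Integration.integral_cong refl, subst integral_mult_right_zero[symmetric])
         (simp add: mult.assoc)
    also have "\<dots> = (\<integral>\<eta>. H \<eta> * cis (- 2 * pi * (\<eta> \<bullet> x)) * fourier1 k x \<partial>lborel)"
      by (simp add: fourier1_shift[OF k(1)] mult.assoc)
    also have "\<dots> = f x * h x"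
      unfolding H(3) k(3) fourier1_def[of H] by (rule integral_mult_left_zero)
    finally show "f x * h x = fourier1 ?C x" ..
  qed
qed

subsection \<open>Balayage onto a countable set\<close>

lemma fin_borel_integral_fourier1:
  fixes H :: "'a::euclidean_space \<Rightarrow> complex"
  assumes m: "fin_borel m" and H[measurable]: "integrable lborel H"
  shows "integrable lborel (\<lambda>\<gamma>. H \<gamma> * (\<integral>x. cis (- 2 * pi * (x \<bullet> \<gamma>)) \<partial>m))"
    and "(\<integral>x. fourier1 H x \<partial>m) = (\<integral>\<gamma>. H \<gamma> * (\<integral>x. cis (- 2 * pi * (x \<bullet> \<gamma>)) \<partial>m) \<partial>lborel)"
proof -
  have sets[measurable_cong]: "sets m = sets borel" using m by (simp add: fin_borel_def)
  interpret m: finite_measure m using m by (simp add: fin_borel_def)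
  interpret pair_sigma_finite m lborel ..
  have I: "integrable (m \<Otimes>\<^sub>M lborel) (\<lambda>(x, \<gamma>). H \<gamma> * cis (- 2 * pi * (x \<bullet> \<gamma>)))"
  proof (rule Fubini_integrable, goal_cases)
    case 2 show ?case by (simp add: norm_mult)
  next
    case 3 show ?case
      using fourier1_integrand_integrable[OF H, of "-2*pi"] by (simp add: inner_commute)
  qed measurable
  show "integrable lborel (\<lambda>\<gamma>. H \<gamma> * (\<integral>x. cis (- 2 * pi * (x \<bullet> \<gamma>)) \<partial>m))"
    using integrable_snd[OF I] by simp
  have "(\<integral>x. fourier1 H x \<partial>m) = (\<integral>x. (\<integral>\<gamma>. H \<gamma> * cis (- 2 * pi * (x \<bullet> \<gamma>)) \<partial>lborel) \<partial>m)"
    unfolding fourier1_def by (simp add: inner_commute)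
  also have "\<dots> = (\<integral>\<gamma>. (\<integral>x. H \<gamma> * cis (- 2 * pi * (x \<bullet> \<gamma>)) \<partial>m) \<partial>lborel)"
    by (rule Fubini_integral[OF I, symmetric])
  finally show "(\<integral>x. fourier1 H x \<partial>m) = (\<integral>\<gamma>. H \<gamma> * (\<integral>x. cis (- 2 * pi * (x \<bullet> \<gamma>)) \<partial>m) \<partial>lborel)"
    by simp
qed

text \<open>By Fubini the integral of f against a measure is the integral of H against the transform
  of the measure, where only frequencies in \<Lambda> count.\<close>

lemma cm_integral_PWfun:
  assumes \<mu>: "\<mu> \<in> Mb UNIV" and \<nu>: "\<nu> \<in> Mb UNIV" and eq: "\<forall>\<gamma>\<in>\<Lambda>. cm_fourier \<mu> \<gamma> = cm_fourier \<nu> \<gamma>"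
    and f: "PWfun \<Lambda> f"
  shows "cm_integral \<mu> f = cm_integral \<nu> f"
proof -
  obtain H where H: "integrable lborel H" "\<And>\<gamma>. \<gamma> \<notin> \<Lambda> \<Longrightarrow> H \<gamma> = 0" "f = fourier1 H"
    using f by (auto simp: PWfun_def)
  have *: "cm_integral \<mu> f = (\<integral>\<gamma>. H \<gamma> * cm_fourier \<mu> \<gamma> \<partial>lborel)" if "\<mu> \<in> Mb UNIV" for \<mu>
  proof -
    obtain m1 m2 m3 m4 where mu: "\<mu> = (m1, m2, m3, m4)" by (cases \<mu>)
    have m: "fin_borel m1" "fin_borel m2" "fin_borel m3" "fin_borel m4"
      using that by (auto simp: Mb_def mu cm_parts_def)
    define c where "c = (\<lambda>m \<gamma>. \<integral>x. cis (- 2 * pi * (x \<bullet> \<gamma>)) \<partial>(m :: 'a measure))"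
    have i: "integrable lborel (\<lambda>\<gamma>. H \<gamma> * c m \<gamma>)" "(\<integral>x. fourier1 H x \<partial>m) = (\<integral>\<gamma>. H \<gamma> * c m \<gamma> \<partial>lborel)"
      if "fin_borel m" for m
      unfolding c_def using fin_borel_integral_fourier1[OF that H(1)] by auto
    note j = i(1)[OF m(1)] i(1)[OF m(2)] i(1)[OF m(3)] i(1)[OF m(4)]
    have "(\<integral>\<gamma>. H \<gamma> * cm_fourier \<mu> \<gamma> \<partial>lborel)
       = (\<integral>\<gamma>. (H \<gamma> * c m1 \<gamma> - H \<gamma> * c m2 \<gamma>) + \<i> * (H \<gamma> * c m3 \<gamma> - H \<gamma> * c m4 \<gamma>) \<partial>lborel)"
      by (rule Bochner_Integration.integral_cong)
         (auto simp: cm_fourier_def cm_integral_def mu c_def algebra_simps)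
    also have "\<dots> = cm_integral \<mu> f"
      using j by (simp add: cm_integral_def mu H(3) i(2)[OF m(1)] i(2)[OF m(2)] i(2)[OF m(3)] i(2)[OF m(4)])
    finally show ?thesis ..
  qed
  have "H \<gamma> * cm_fourier \<mu> \<gamma> = H \<gamma> * cm_fourier \<nu> \<gamma>" for \<gamma>
    using eq H(2)[of \<gamma>] by (cases "\<gamma> \<in> \<Lambda>") auto
  then have "(\<lambda>\<gamma>. H \<gamma> * cm_fourier \<mu> \<gamma>) = (\<lambda>\<gamma>. H \<gamma> * cm_fourier \<nu> \<gamma>)" by (rule ext)
  then show ?thesis unfolding *[OF \<mu>] *[OF \<nu>] by (rule arg_cong)
qed

text \<open>A finite measure carried by a countable set is a weighted counting measure, so balayage
  onto E produces absolutely summable series over E.\<close>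

lemma countable_support_integral:
  fixes f :: "'a::euclidean_space \<Rightarrow> complex"
  assumes m: "fin_borel m" "emeasure m (UNIV - E) = 0" and E: "countable E"
    and f[measurable]: "f \<in> borel_measurable borel" and bnd: "\<And>x. cmod (f x) \<le> M"
  shows "integrable (count_space E) (\<lambda>x. measure m {x})"
    and "integral\<^sup>L m f = (\<integral>x. measure m {x} *\<^sub>R f x \<partial>count_space E)"
proof -
  have sets[measurable_cong]: "sets m = sets borel" using m by (simp add: fin_borel_def)
  have sp: "space m = UNIV" using sets_eq_imp_space_eq[OF sets] by simp
  interpret m: finite_measure m using m by (simp add: fin_borel_def)
  have Em: "E \<in> sets m" using E by (simp add: sets sets.countable)
  have em: "emeasure m A = (\<integral>\<^sup>+x. ennreal (measure m {x}) * indicator A x \<partial>count_space E)" if A: "A \<in> sets borel" for A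
  proof -
    have "emeasure m A = emeasure m (A \<inter> E)"
    proof (rule antisym)
      have "emeasure m A \<le> emeasure m (A \<inter> E) + emeasure m (UNIV - E)"
        using A Em sets sp
        by (intro order.trans[OF _ emeasure_subadditive] emeasure_mono) (auto simp: sp)
      then show "emeasure m A \<le> emeasure m (A \<inter> E)" using m by simp
      show "emeasure m (A \<inter> E) \<le> emeasure m A" using A sets by (intro emeasure_mono) auto
    qed
    also have "\<dots> = (\<integral>\<^sup>+x. emeasure m {x} \<partial>count_space (A \<inter> E))"
      using E sets by (intro emeasure_countable_singleton) auto
    also have "\<dots> = (\<integral>\<^sup>+x. emeasure m {x} * indicator A x \<partial>count_space E)"
      using nn_integral_restrict_space[of A "count_space E" "\<lambda>x. emeasure m {x}"]
      by (simp add: restrict_count_space nn_integral_restrict_space)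
    finally show ?thesis by (simp add: m.emeasure_eq_measure)
  qed
  have "(\<integral>\<^sup>+x. ennreal (measure m {x}) \<partial>count_space E) = emeasure m UNIV"
    using em[of UNIV] by simp
  also have "\<dots> < \<infinity>" using m.emeasure_finite[of UNIV] by (simp only: less_top infinity_ennreal_def)
  finally show i: "integrable (count_space E) (\<lambda>x. measure m {x})"
    by (subst integrable_iff_bounded) simp
  \<comment> \<open>Pushing forward along the identity exchanges the power set of E for the Borel
    sets, so that the two measures can be equal.\<close>
  let ?N = "distr (density (count_space E) (\<lambda>x. ennreal (measure m {x}))) borel (\<lambda>x. x)"
  have "m = ?N"
  proof (rule measure_eqI)
    fix A assume "A \<in> sets m"
    then have A: "A \<in> sets borel" by (simp add: sets)
    have "emeasure ?N A = emeasure (density (count_space E) (\<lambda>x. ennreal (measure m {x}))) (A \<inter> E)"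
      using A by (subst emeasure_distr) auto
    also have "\<dots> = (\<integral>\<^sup>+x. ennreal (measure m {x}) * indicator (A \<inter> E) x \<partial>count_space E)"
      by (subst emeasure_density) auto
    also have "\<dots> = (\<integral>\<^sup>+x. ennreal (measure m {x}) * indicator A x \<partial>count_space E)"
      by (rule nn_integral_cong) (auto split: split_indicator)
    finally show "emeasure m A = emeasure ?N A" by (simp add: em[OF A])
  qed (simp add: sets)
  then have "integral\<^sup>L m f = integral\<^sup>L ?N f" by simp
  also have "\<dots> = (\<integral>x. f x \<partial>density (count_space E) (\<lambda>x. ennreal (measure m {x})))"
    by (rule integral_distr) auto
  also have "\<dots> = (\<integral>x. measure m {x} *\<^sub>R f x \<partial>count_space E)"
    by (rule integral_density) auto
  finally show "integral\<^sup>L m f = (\<integral>x. measure m {x} *\<^sub>R f x \<partial>count_space E)" .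
qed

lemma Mb_countable_rep:
  fixes \<nu> :: "'a::euclidean_space cmeasure"
  assumes \<nu>: "\<nu> \<in> Mb E" and E: "countable E"
  obtains c where "integrable (count_space E) c"
    "\<And>f M. f \<in> borel_measurable borel \<Longrightarrow> (\<And>x. cmod (f x) \<le> M) \<Longrightarrow> cm_integral \<nu> f = (\<integral>x. c x * f x \<partial>count_space E)"
proof -
  obtain m1 m2 m3 m4 where nu: "\<nu> = (m1, m2, m3, m4)" by (cases \<nu>)
  have m: "fin_borel m" "emeasure m (UNIV - E) = 0" if "m \<in> {m1, m2, m3, m4}" for m
    using \<nu> that by (auto simp: Mb_def nu cm_parts_def)
  have i: "integrable (count_space E) (\<lambda>x. complex_of_real (measure m {x}))" if "m \<in> {m1, m2, m3, m4}" for m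
    using countable_support_integral(1)[OF m[OF that] E, of "\<lambda>x. 0" 0] by (intro integrable_of_real) auto
  show thesis
  proof (rule that[of "\<lambda>x. cm_val \<nu> {x}"])
    show "integrable (count_space E) (\<lambda>x. cm_val \<nu> {x})"
      using i by (simp add: cm_val_def nu)
    fix f :: "'a \<Rightarrow> complex" and M assume f[measurable]: "f \<in> borel_measurable borel" and bnd: "\<And>x. cmod (f x) \<le> M"
    have j: "integrable (count_space E) (\<lambda>x. measure m {x} *\<^sub>R f x)" if "m \<in> {m1, m2, m3, m4}" for m
    proof (rule Bochner_Integration.integrable_bound)
      show "integrable (count_space E) (\<lambda>x. complex_of_real (measure m {x}) * of_real M)" using i[OF that] by simp
      show "AE x in count_space E. norm (measure m {x} *\<^sub>R f x) \<le> norm (complex_of_real (measure m {x}) * of_real M)"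
        using order.trans[OF bnd abs_ge_self] by (intro AE_I2) (auto simp: norm_mult intro!: mult_left_mono)
    qed auto
    have "(\<integral>x. cm_val \<nu> {x} * f x \<partial>count_space E)
      = (\<integral>x. (measure m1 {x} *\<^sub>R f x - measure m2 {x} *\<^sub>R f x) + \<i> * (measure m3 {x} *\<^sub>R f x - measure m4 {x} *\<^sub>R f x) \<partial>count_space E)"
      by (rule Bochner_Integration.integral_cong) (auto simp: cm_val_def nu scaleR_conv_of_real algebra_simps)
    also have "\<dots> = cm_integral \<nu> f"
      using j countable_support_integral(2)[OF m E f bnd] by (simp add: cm_integral_def nu)
    finally show "cm_integral \<nu> f = (\<integral>x. cm_val \<nu> {x} * f x \<partial>count_space E)" ..
  qed
qed

text \<open>Balayage for functionals on the band-limited functions instead of measures; unlike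
  \<^const>\<open>balayage\<close> it records a bound \<open>K\<close> for the mass, which the compactness arguments need.\<close>

definition swept :: "'a::euclidean_space set \<Rightarrow> 'a set \<Rightarrow> (('a \<Rightarrow> complex) \<Rightarrow> complex) \<Rightarrow> real \<Rightarrow> bool" where
  "swept E \<Lambda> \<phi> K \<longleftrightarrow> (\<exists>c. integrable (count_space E) c \<and> (\<integral>x. cmod (c x) \<partial>count_space E) \<le> K \<and>
     (\<forall>f. PWfun \<Lambda> f \<longrightarrow> \<phi> f = (\<integral>x. c x * f x \<partial>count_space E)))"

lemma integrable_count_space_mult_bounded:
  fixes c f :: "'a \<Rightarrow> complex"
  assumes c: "integrable (count_space E) c" and f: "\<And>x. x \<in> E \<Longrightarrow> cmod (f x) \<le> M"
  shows "integrable (count_space E) (\<lambda>x. c x * f x)"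
    and "cmod (\<integral>x. c x * f x \<partial>count_space E) \<le> (\<integral>x. cmod (c x) \<partial>count_space E) * M"
proof -
  show i: "integrable (count_space E) (\<lambda>x. c x * f x)"
  proof (rule Bochner_Integration.integrable_bound)
    show "integrable (count_space E) (\<lambda>x. c x * of_real M)" using c by simp
  qed (auto simp: norm_mult AE_count_space intro!: mult_left_mono order.trans[OF f])
  have "cmod (\<integral>x. c x * f x \<partial>count_space E) \<le> (\<integral>x. cmod (c x) * M \<partial>count_space E)"
    by (rule order.trans[OF integral_norm_bound integral_mono])
       (use c integrable_norm[OF i] f in \<open>auto simp: norm_mult intro!: mult_left_mono\<close>)
  then show "cmod (\<integral>x. c x * f x \<partial>count_space E) \<le> (\<integral>x. cmod (c x) \<partial>count_space E) * M"
    using c by simp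
qed

lemma swept_mono: "swept E \<Lambda> \<phi> K \<Longrightarrow> K \<le> K' \<Longrightarrow> swept E \<Lambda> \<phi> K'"
  unfolding swept_def by (meson order.trans)

text \<open>The form needed for the gliding hump: a point mass is recovered as a multiple of the
  difference of two swept functionals.\<close>

lemma swept_combine:
  assumes "swept E \<Lambda> \<phi> K" "swept E \<Lambda> \<psi> L"
  shows "swept E \<Lambda> (\<lambda>f. z * (\<phi> f - \<psi> f)) (cmod z * (K + L))"
proof -
  obtain c where c: "integrable (count_space E) c" "(\<integral>x. cmod (c x) \<partial>count_space E) \<le> K"
     "\<And>f. PWfun \<Lambda> f \<Longrightarrow> \<phi> f = (\<integral>x. c x * f x \<partial>count_space E)"
    using assms(1) by (auto simp: swept_def)
  obtain d where d: "integrable (count_space E) d" "(\<integral>x. cmod (d x) \<partial>count_space E) \<le> L"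
     "\<And>f. PWfun \<Lambda> f \<Longrightarrow> \<psi> f = (\<integral>x. d x * f x \<partial>count_space E)"
    using assms(2) by (auto simp: swept_def)
  show ?thesis
    unfolding swept_def
  proof (intro exI[of _ "\<lambda>x. z * (c x - d x)"] conjI allI impI)
    show "integrable (count_space E) (\<lambda>x. z * (c x - d x))" using c d by simp
    have "(\<integral>x. cmod (c x - d x) \<partial>count_space E) \<le> (\<integral>x. cmod (c x) + cmod (d x) \<partial>count_space E)"
      using c d by (intro integral_mono) (auto intro: norm_triangle_ineq4)
    also have "\<dots> \<le> K + L" using c d by simp
    finally have "cmod z * (\<integral>x. cmod (c x - d x) \<partial>count_space E) \<le> cmod z * (K + L)"
      by (rule mult_left_mono) simp
    then show "(\<integral>x. cmod (z * (c x - d x)) \<partial>count_space E) \<le> cmod z * (K + L)"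
      by (simp add: norm_mult)
    fix f assume f: "PWfun \<Lambda> f"
    obtain M where M: "M > 0" "\<And>x. cmod (f x) \<le> M" using PWfun_bounded[OF f] by blast
    have "(\<integral>x. z * (c x - d x) * f x \<partial>count_space E) = (\<integral>x. z * (c x * f x - d x * f x) \<partial>count_space E)"
      by (rule Bochner_Integration.integral_cong) (auto simp: algebra_simps)
    also have "\<dots> = z * (\<phi> f - \<psi> f)"
      using integrable_count_space_mult_bounded(1)[OF c(1), of f M] integrable_count_space_mult_bounded(1)[OF d(1), of f M] M f
      by (simp add: c(3) d(3))
    finally show "z * (\<phi> f - \<psi> f) = (\<integral>x. z * (c x - d x) * f x \<partial>count_space E)" ..
  qed
qed


lemma swept_cong: "(\<And>f. PWfun \<Lambda> f \<Longrightarrow> \<phi> f = \<psi> f) \<Longrightarrow> swept E \<Lambda> \<phi> K \<Longrightarrow> swept E \<Lambda> \<psi> K"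
  unfolding swept_def by auto

text \<open>A summable family of point masses is one finite measure, so balayage applies to the
  family as a whole. The bound it yields depends on the family.\<close>

lemma balayage_swept:
  fixes E \<Lambda> :: "'a::euclidean_space set" and y :: "nat \<Rightarrow> 'a"
  assumes bal: "balayage E \<Lambda>" and E: "countable E"
    and c: "\<And>j. c j \<ge> 0" "summable c"
  shows "\<exists>K. swept E \<Lambda> (\<lambda>f. \<Sum>j. of_real (c j) * f (y j)) K"
proof -
  let ?D = "density (count_space UNIV) (\<lambda>j. ennreal (c j))"
  define m where "m = distr ?D borel y"
  have eD: "emeasure m UNIV < \<infinity>"
  proof -
    have "emeasure m UNIV = (\<integral>\<^sup>+j. ennreal (c j) \<partial>count_space UNIV)"
      unfolding m_def by (subst emeasure_distr) (auto simp: emeasure_density)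
    also have "\<dots> = ennreal (suminf c)"
      using c by (simp add: nn_integral_count_space_nat suminf_ennreal2)
    finally show ?thesis by simp
  qed
  have m: "fin_borel m"
    using eD unfolding fin_borel_def by (auto simp: m_def intro!: finite_measureI)
  have nul: "fin_borel (null_measure borel :: 'a measure)"
    by (auto simp: fin_borel_def intro!: finite_measureI)
  \<comment> \<open>The weights are nonnegative, so one positive component represents the measure
    and the other three are null.\<close>
  define \<mu> where "\<mu> = (m, null_measure borel :: 'a measure, null_measure borel :: 'a measure, null_measure borel :: 'a measure)"
  have \<mu>: "\<mu> \<in> Mb UNIV"
    using m nul by (auto simp: Mb_def \<mu>_def cm_parts_def)
  obtain \<nu> where \<nu>: "\<nu> \<in> Mb E" "\<forall>\<gamma>\<in>\<Lambda>. cm_fourier \<mu> \<gamma> = cm_fourier \<nu> \<gamma>"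
    using bal \<mu> unfolding balayage_def by blast
  have \<nu>': "\<nu> \<in> Mb UNIV" using \<nu>(1) by (auto simp: Mb_def)
  obtain d where d: "integrable (count_space E) d"
    "\<And>f M. f \<in> borel_measurable borel \<Longrightarrow> (\<And>x. cmod (f x) \<le> M) \<Longrightarrow> cm_integral \<nu> f = (\<integral>x. d x * f x \<partial>count_space E)"
    using Mb_countable_rep[OF \<nu>(1) E] by blast
  show ?thesis
    unfolding swept_def
  proof (intro exI[of _ "\<integral>x. cmod (d x) \<partial>count_space E"] exI[of _ d] conjI allI impI d order.refl)
    fix f assume f: "PWfun \<Lambda> f"
    obtain M where M: "M > 0" "\<And>x. cmod (f x) \<le> M" using PWfun_bounded[OF f] by blast
    have [measurable]: "f \<in> borel_measurable borel"
      using PWfun_continuous[OF f] by (rule borel_measurable_continuous_onI)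
    have cf: "integrable (count_space UNIV) (\<lambda>j. c j *\<^sub>R f (y j))"
    proof -
      have "integrable (count_space UNIV) (\<lambda>j. complex_of_real (c j))"
        using c by (intro integrable_of_real) (simp add: integrable_count_space_nat_iff)
      from integrable_count_space_mult_bounded(1)[OF this, of "\<lambda>j. f (y j)" M] M show ?thesis
        by (simp add: scaleR_conv_of_real)
    qed
    have "cm_integral \<mu> f = integral\<^sup>L m f"
      by (simp add: cm_integral_def \<mu>_def)
    also have "\<dots> = (\<integral>j. f (y j) \<partial>?D)"
      unfolding m_def by (rule integral_distr) auto
    also have "\<dots> = (\<integral>j. c j *\<^sub>R f (y j) \<partial>count_space UNIV)"
      using c by (intro integral_density) auto
    also have "\<dots> = (\<Sum>j. of_real (c j) * f (y j))"
      using integral_count_space_nat[OF cf] by (simp add: scaleR_conv_of_real)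
    finally have "(\<Sum>j. of_real (c j) * f (y j)) = cm_integral \<mu> f" ..
    also have "\<dots> = cm_integral \<nu> f"
      by (rule cm_integral_PWfun[OF \<mu> \<nu>' \<nu>(2) f])
    also have "\<dots> = (\<integral>x. d x * f x \<partial>count_space E)"
      by (rule d(2)) (use M in auto)
    finally show "(\<Sum>j. of_real (c j) * f (y j)) = (\<integral>x. d x * f x \<partial>count_space E)" .
  qed
qed

subsection \<open>Weak limits of configurations\<close>

lemma integral_count_space_reindex_inj:
  fixes G :: "nat \<Rightarrow> 'b::{banach, second_countable_topology}"
  assumes h: "inj_on h E" and G: "\<And>k. k \<notin> h ` E \<Longrightarrow> G k = 0"
  shows "integral\<^sup>L (count_space UNIV) G = (\<integral>x. G (h x) \<partial>count_space E)"
    and "integrable (count_space UNIV) G \<longleftrightarrow> integrable (count_space E) (\<lambda>x. G (h x))"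
proof -
  have bij: "bij_betw h E (h ` E)" using h by (rule inj_on_imp_bij_betw)
  have ind: "(\<lambda>k. indicator (h ` E) k *\<^sub>R G k) = G"
    using G by (auto simp: fun_eq_iff indicator_def)
  have r: "count_space (h ` E) = restrict_space (count_space UNIV) (h ` E)"
    by (simp add: restrict_count_space)
  show "integral\<^sup>L (count_space UNIV) G = (\<integral>x. G (h x) \<partial>count_space E)"
    unfolding integral_bij_count_space[OF bij, of G] r
    by (subst integral_restrict_space) (auto simp: ind)
  show "integrable (count_space UNIV) G \<longleftrightarrow> integrable (count_space E) (\<lambda>x. G (h x))"
    unfolding integrable_bij_count_space[OF bij, of G] r
    by (subst integrable_restrict_space) (auto simp: ind)
qed

text \<open>A countable product of compact sets is sequentially compact, which gives coordinatewise
  limits. These suffice against functions vanishing at infinity: only finitely many cells meet a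
  large ball, and the others contribute at most K times a small value.\<close>

lemma weak_limit:
  fixes z :: "nat \<Rightarrow> 'a::euclidean_space" and p :: "nat \<Rightarrow> nat \<Rightarrow> 'a" and a :: "nat \<Rightarrow> nat \<Rightarrow> complex"
  assumes fin: "\<And>R. finite {k. norm (z k) \<le> R}" and pz: "\<And>n k. dist (p n k) (z k) \<le> r"
    and ai: "\<And>n. integrable (count_space UNIV) (a n)"
    and aK: "\<And>n. (\<integral>k. cmod (a n k) \<partial>count_space UNIV) \<le> K"
  shows "\<exists>s q b. strict_mono (s :: nat \<Rightarrow> nat) \<and> (\<forall>k. (\<lambda>n. p (s n) k) \<longlonglongrightarrow> q k) \<and> (\<forall>k. (\<lambda>n. a (s n) k) \<longlonglongrightarrow> b k) \<and>
    integrable (count_space UNIV) b \<and> (\<integral>k. cmod (b k) \<partial>count_space UNIV) \<le> K \<and>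
    (\<forall>\<Lambda> f. PWfun \<Lambda> f \<longrightarrow>
       (\<lambda>n. \<integral>k. a (s n) k * f (p (s n) k) \<partial>count_space UNIV) \<longlonglongrightarrow> (\<integral>k. b k * f (q k) \<partial>count_space UNIV))"
proof -
  have nn: "(\<integral>\<^sup>+k. ennreal (cmod (a n k)) \<partial>count_space UNIV) \<le> ennreal K" for n
    using ai[of n] aK[of n] by (subst nn_integral_eq_integral) (auto intro: ennreal_leI)
  have K0: "0 \<le> K" by (rule order.trans[OF _ aK[of 0]]) auto
  have ak: "cmod (a n k) \<le> K" for n k
  proof -
    have "ennreal (cmod (a n k)) \<le> ennreal K"
      by (rule order.trans[OF nn_integral_ge_point[of k UNIV "\<lambda>k. ennreal (cmod (a n k))"] nn]) auto
    then show ?thesis using K0 by (simp add: ennreal_le_iff)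
  qed
  \<comment> \<open>The k-th coordinate holds the point of cell k together with its coefficient,
    which is bounded by the total mass K.\<close>
  let ?S = "\<lambda>k. cball (z k) r \<times> cball (0::complex) K"
  have "compactin (product_topology (\<lambda>_. euclidean) UNIV) (PiE UNIV ?S)"
    unfolding compactin_PiE by (auto intro!: compact_Times)
  then have "compact (PiE UNIV ?S)"
    by (simp add: euclidean_product_topology)
  then have "seq_compact (PiE UNIV ?S)"
    by (rule compact_imp_seq_compact)
  moreover have "(\<lambda>k. (p n k, a n k)) \<in> PiE UNIV ?S" for n
    using pz ak by (auto simp: dist_commute)
  ultimately obtain l s where ls: "l \<in> PiE UNIV ?S" "strict_mono s" "((\<lambda>n k. (p n k, a n k)) \<circ> s) \<longlonglongrightarrow> l"
    by (auto elim!: seq_compactE)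
  define q where "q = (\<lambda>k. fst (l k))"
  define b where "b = (\<lambda>k. snd (l k))"
  have lk: "(\<lambda>n. (p (s n) k, a (s n) k)) \<longlonglongrightarrow> l k" for k
  proof -
    have "continuous_on UNIV (\<lambda>x::nat \<Rightarrow> 'a \<times> complex. x k)"
      by (rule continuous_on_product_coordinates)
    from continuous_on_tendsto_compose[OF this ls(3)] show ?thesis by (simp add: comp_def)
  qed
  have q: "(\<lambda>n. p (s n) k) \<longlonglongrightarrow> q k" and b: "(\<lambda>n. a (s n) k) \<longlonglongrightarrow> b k" for k
    using tendsto_fst[OF lk[of k]] tendsto_snd[OF lk[of k]] by (auto simp: q_def b_def)
  have qz: "dist (q k) (z k) \<le> r" for k
    using ls(1) by (auto simp: q_def PiE_iff mem_Times_iff dist_commute)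
  \<comment> \<open>Fatou: mass may be lost in the limit but never gained.\<close>
  have "(\<integral>\<^sup>+k. ennreal (cmod (b k)) \<partial>count_space UNIV) = (\<integral>\<^sup>+k. liminf (\<lambda>n. ennreal (cmod (a (s n) k))) \<partial>count_space UNIV)"
    by (intro nn_integral_cong lim_imp_Liminf[symmetric] tendsto_intros b) simp
  also have "\<dots> \<le> liminf (\<lambda>n. \<integral>\<^sup>+k. ennreal (cmod (a (s n) k)) \<partial>count_space UNIV)"
    by (rule nn_integral_liminf) auto
  also have "\<dots> \<le> liminf (\<lambda>n::nat. ennreal K)"
    by (intro Liminf_mono always_eventually allI nn)
  finally have bn: "(\<integral>\<^sup>+k. ennreal (cmod (b k)) \<partial>count_space UNIV) \<le> ennreal K"
    by (simp add: Liminf_const)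
  then have bi: "integrable (count_space UNIV) b"
    by (subst integrable_iff_bounded) (auto elim: order.strict_trans1)
  have bK: "(\<integral>k. cmod (b k) \<partial>count_space UNIV) \<le> K"
    using bn bi K0 by (subst (asm) nn_integral_eq_integral) (auto simp: ennreal_le_iff)
  have conv: "(\<lambda>n. \<integral>k. a (s n) k * f (p (s n) k) \<partial>count_space UNIV) \<longlonglongrightarrow> (\<integral>k. b k * f (q k) \<partial>count_space UNIV)"
    if f: "continuous_on UNIV f" "(f \<longlongrightarrow> 0) at_infinity" "\<And>x. cmod (f x) \<le> M" for f M
  proof -
    have core: "cmod ((\<integral>k. c k * f (w k) \<partial>count_space UNIV) - (\<Sum>k\<in>S. c k * f (w k))) \<le> K * e"
      if c: "integrable (count_space UNIV) c" "(\<integral>k. cmod (c k) \<partial>count_space UNIV) \<le> K"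
        and S: "finite S" and w: "\<And>k. k \<notin> S \<Longrightarrow> cmod (f (w k)) \<le> e" and e: "0 \<le> e"
      for c :: "nat \<Rightarrow> complex" and w :: "nat \<Rightarrow> 'a" and S e
    proof -
      have "(\<Sum>k\<in>S. c k * f (w k)) = (\<integral>k. c k * f (w k) \<partial>count_space S)"
        by (simp add: lebesgue_integral_count_space_finite S)
      also have "\<dots> = (\<integral>k. c k * f (w k) \<partial>restrict_space (count_space UNIV) S)"
        by (simp add: restrict_count_space)
      also have "\<dots> = (\<integral>k. indicator S k *\<^sub>R (c k * f (w k)) \<partial>count_space UNIV)"
        by (rule integral_restrict_space) auto
      also have "\<dots> = (\<integral>k. c k * (if k \<in> S then f (w k) else 0) \<partial>count_space UNIV)"
        by (rule Bochner_Integration.integral_cong) auto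
      finally have "(\<integral>k. c k * f (w k) \<partial>count_space UNIV) - (\<Sum>k\<in>S. c k * f (w k))
        = (\<integral>k. c k * f (w k) \<partial>count_space UNIV) - (\<integral>k. c k * (if k \<in> S then f (w k) else 0) \<partial>count_space UNIV)"
        by simp
      also have "\<dots> = (\<integral>k. c k * f (w k) - c k * (if k \<in> S then f (w k) else 0) \<partial>count_space UNIV)"
      proof (rule Bochner_Integration.integral_diff[symmetric])
        have "0 \<le> M" using order.trans[OF norm_ge_zero f(3)] .
        then show "integrable (count_space UNIV) (\<lambda>k. c k * f (w k))"
          "integrable (count_space UNIV) (\<lambda>k. c k * (if k \<in> S then f (w k) else 0))"
          using f(3) by (auto intro!: integrable_count_space_mult_bounded(1)[OF c(1), where M=M])
      qed
      also have "\<dots> = (\<integral>k. c k * (if k \<in> S then 0 else f (w k)) \<partial>count_space UNIV)"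
        by (rule Bochner_Integration.integral_cong) auto
      also have "cmod \<dots> \<le> (\<integral>k. cmod (c k) \<partial>count_space UNIV) * e"
        by (rule integrable_count_space_mult_bounded(2)[OF c(1)]) (use w e in auto)
      also have "\<dots> \<le> K * e" using c(2) e by (rule mult_right_mono)
      finally show ?thesis .
    qed
    have "\<exists>N. \<forall>n\<ge>N. cmod ((\<integral>k. a (s n) k * f (p (s n) k) \<partial>count_space UNIV) - (\<integral>k. b k * f (q k) \<partial>count_space UNIV)) < \<epsilon>"
      if \<epsilon>: "\<epsilon> > 0" for \<epsilon>
    proof -
      \<comment> \<open>Two tails of at most K e \<le> \<epsilon>/4 and a finite part below
        \<epsilon>/4 stay under \<epsilon>; K + 1 avoids a zero denominator.\<close>
      define e where "e = \<epsilon> / (4 * (K + 1))"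
      have e: "e > 0" "K * e \<le> \<epsilon> / 4"
        using \<epsilon> K0 by (auto simp: e_def field_simps)
      obtain R where R: "\<And>x. norm x \<ge> R \<Longrightarrow> cmod (f x) < e"
        using f(2) e(1) unfolding Lim_at_infinity by auto
      \<comment> \<open>A point may lie at distance r from \<open>z k\<close>, hence the radius R +
        r: outside S every admissible point has norm beyond R.\<close>
      define S where "S = {k. norm (z k) \<le> R + r}"
      have S: "finite S" unfolding S_def by (rule fin)
      have far: "cmod (f w) \<le> e" if "k \<notin> S" "dist w (z k) \<le> r" for k w
      proof -
        have "norm (z k) \<le> norm w + dist w (z k)"
          using norm_triangle_sub[of "z k" w] by (simp add: dist_norm norm_minus_commute)
        then show ?thesis using that by (intro less_imp_le R) (auto simp: S_def)
      qed
      have "(\<lambda>n. \<Sum>k\<in>S. a (s n) k * f (p (s n) k)) \<longlonglongrightarrow> (\<Sum>k\<in>S. b k * f (q k))"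
        by (intro tendsto_sum tendsto_mult b continuous_on_tendsto_compose[OF f(1) q]) auto
      from LIMSEQ_D[OF this, of "\<epsilon>/4"] \<epsilon> obtain N where
        N: "\<And>n. n \<ge> N \<Longrightarrow> cmod ((\<Sum>k\<in>S. a (s n) k * f (p (s n) k)) - (\<Sum>k\<in>S. b k * f (q k))) < \<epsilon> / 4"
        by auto
      have "cmod ((\<integral>k. a (s n) k * f (p (s n) k) \<partial>count_space UNIV) - (\<integral>k. b k * f (q k) \<partial>count_space UNIV)) < \<epsilon>" if n: "n \<ge> N" for n
      proof -
        have 1: "cmod ((\<integral>k. a (s n) k * f (p (s n) k) \<partial>count_space UNIV) - (\<Sum>k\<in>S. a (s n) k * f (p (s n) k))) \<le> K * e"
          by (rule core[OF ai aK S]) (use far pz e in auto)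
        have 2: "cmod ((\<integral>k. b k * f (q k) \<partial>count_space UNIV) - (\<Sum>k\<in>S. b k * f (q k))) \<le> K * e"
          by (rule core[OF bi bK S]) (use far qz e in auto)
        have tri: "cmod (u - v) \<le> cmod (u - u') + cmod (u' - v') + cmod (v - v')" for u v u' v' :: complex
          using norm_triangle_ineq[of "u - u'" "u' - v"] norm_triangle_ineq[of "u' - v'" "v' - v"]
          by (simp add: norm_minus_commute)
        have "cmod ((\<integral>k. a (s n) k * f (p (s n) k) \<partial>count_space UNIV) - (\<integral>k. b k * f (q k) \<partial>count_space UNIV))
            \<le> K * e + \<epsilon> / 4 + K * e"
          by (rule order.trans[OF tri[of _ _ "\<Sum>k\<in>S. a (s n) k * f (p (s n) k)" "\<Sum>k\<in>S. b k * f (q k)"]])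
             (intro add_mono 1 2 less_imp_le[OF N[OF n]])
        also have "\<dots> < \<epsilon>" using e \<epsilon> by simp
        finally show ?thesis .
      qed
      then show ?thesis by blast
    qed
    then show ?thesis by (intro LIMSEQ_I) auto
  qed
  have "(\<lambda>n. \<integral>k. a (s n) k * f (p (s n) k) \<partial>count_space UNIV) \<longlonglongrightarrow> (\<integral>k. b k * f (q k) \<partial>count_space UNIV)"
    if f: "PWfun \<Lambda> f" for \<Lambda> f
  proof -
    obtain M where M: "M > 0" "\<And>x. cmod (f x) \<le> M" using PWfun_bounded[OF f] by blast
    show ?thesis by (rule conv[OF PWfun_continuous[OF f] PWfun_tendsto[OF f] M(2)])
  qed
  then show ?thesis
    using ls(2) q b bi bK by blast
qed

text \<open>Each shell between consecutive integer radii is covered by finitely many balls centred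
  in that shell, and a bounded set meets finitely many shells.\<close>

lemma proper_net:
  assumes r: "r > 0"
  obtains z :: "nat \<Rightarrow> 'a::euclidean_space"
  where "\<And>x. \<exists>k. dist x (z k) \<le> r" "\<And>R. finite {k. norm (z k) \<le> R}"
proof -
  let ?A = "\<lambda>m::nat. cball (0::'a) (Suc m) - ball 0 m"
  have "\<exists>Z. Z \<subseteq> ?A m \<and> finite Z \<and> ?A m \<subseteq> (\<Union>x\<in>Z. ball x r)" for m
  proof -
    have "compact (?A m)" by (intro compact_diff) auto
    then obtain Z where "Z \<subseteq> ?A m" "finite Z" "?A m \<subseteq> (\<Union>x\<in>Z. ball x r)"
      by (rule compactE_image[where C="?A m" and f="\<lambda>x. ball x r"]) (use r in auto)
    then show ?thesis by blast
  qed
  then have "\<exists>Z. \<forall>m. Z m \<subseteq> ?A m \<and> finite (Z m) \<and> ?A m \<subseteq> (\<Union>x\<in>Z m. ball x r)"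
    by (intro choice allI)
  then obtain Z where Z: "\<And>m. Z m \<subseteq> ?A m" "\<And>m. finite (Z m)" "\<And>m. ?A m \<subseteq> (\<Union>x\<in>Z m. ball x r)"
    by blast
  define W where "W = (\<Union>m. Z m)"
  have cover: "\<exists>w\<in>W. dist x w \<le> r" for x
  proof -
    have "x \<in> ?A (nat \<lfloor>norm x\<rfloor>)"
      by simp linarith
    with Z(3) obtain w where "w \<in> Z (nat \<lfloor>norm x\<rfloor>)" "x \<in> ball w r" by blast
    then show ?thesis unfolding W_def by (intro bexI[of _ w]) (auto simp: dist_commute)
  qed
  have fin: "finite {w \<in> W. norm w \<le> R}" for R
  proof (rule finite_subset)
    show "{w \<in> W. norm w \<le> R} \<subseteq> (\<Union>m\<le>nat \<lceil>R\<rceil>. Z m)"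
    proof
      fix w assume "w \<in> {w \<in> W. norm w \<le> R}"
      then obtain m where m: "w \<in> Z m" "norm w \<le> R" by (auto simp: W_def)
      then have "real m \<le> R" using Z(1)[of m] by auto
      then show "w \<in> (\<Union>m\<le>nat \<lceil>R\<rceil>. Z m)" using m by (intro UN_I[of m]) (auto, linarith)
    qed
  qed (use Z in auto)
  have cW: "countable W" unfolding W_def using Z(2) by (auto intro: countable_finite)
  \<comment> \<open>Infinity of W makes it enumerable by all natural numbers without repetition; a
    finite W could not cover an unbounded space.\<close>
  have iW: "infinite W"
  proof
    assume "finite W"
    then obtain B where B: "\<And>w. w \<in> W \<Longrightarrow> norm w \<le> B"
      using finite_imp_bounded[of W] by (auto simp: bounded_iff)
    obtain u :: 'a where u: "norm u = \<bar>B\<bar> + r + 1"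
      using vector_choose_size[of "\<bar>B\<bar> + r + 1"] r by auto
    obtain w where w: "w \<in> W" "dist u w \<le> r" using cover by blast
    have "norm u \<le> norm w + dist u w" using norm_triangle_sub[of u w] by (simp add: dist_norm)
    then show False using B[OF w(1)] w(2) u by linarith
  qed
  define z where "z = from_nat_into W"
  have bij: "bij_betw z UNIV W" unfolding z_def by (rule bij_betw_from_nat_into[OF cW iW])
  show thesis
  proof
    show "\<exists>k. dist x (z k) \<le> r" for x
      using cover[of x] bij by (metis bij_betw_imp_surj_on imageE)
    fix R
    have "z ` {k. norm (z k) \<le> R} \<subseteq> {w \<in> W. norm w \<le> R}" using bij by (auto simp: bij_betw_def)
    then have "finite (z ` {k. norm (z k) \<le> R})" using fin finite_subset by blast
    then show "finite {k. norm (z k) \<le> R}"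
      using bij by (subst (asm) finite_image_iff) (auto simp: bij_betw_def intro: inj_on_subset)
  qed
qed

text \<open>A separated set, translated by \<open>- y\<close>, is indexed by the cells of a fixed net, so that
  configurations for different translations become comparable coordinate by coordinate.\<close>

lemma separated_net:
  fixes E :: "'a::euclidean_space set"
  assumes "separated E"
  shows "\<exists>(z :: nat \<Rightarrow> 'a) (h :: 'a \<Rightarrow> nat) r. (\<forall>R. finite {k. norm (z k) \<le> R}) \<and>
    (\<forall>x. dist x (z (h x)) \<le> r) \<and> (\<forall>y. inj_on (\<lambda>x. h (x - y)) E)"
proof -
  obtain \<delta> where \<delta>: "\<delta> > 0" "\<And>x y. x \<in> E \<Longrightarrow> y \<in> E \<Longrightarrow> x \<noteq> y \<Longrightarrow> \<delta> \<le> dist x y"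
    using assms unfolding separated_def by blast
  \<comment> \<open>Two points of the same cell are at most 2\<delta>/3 apart, which is below the
    separation of E.\<close>
  obtain z :: "nat \<Rightarrow> 'a" where z: "\<And>x. \<exists>k. dist x (z k) \<le> \<delta> / 3" "\<And>R. finite {k. norm (z k) \<le> R}"
    using proper_net[of "\<delta> / 3"] \<delta> by auto
  obtain h where h: "\<And>x. dist x (z (h x)) \<le> \<delta> / 3" using choice[of "\<lambda>x k. dist x (z k) \<le> \<delta> / 3"] z(1) by blast
  show ?thesis
  proof (intro exI conjI allI)
    show "finite {k. norm (z k) \<le> R}" for R by (rule z(2))
    show "dist x (z (h x)) \<le> \<delta> / 3" for x by (rule h)
    show "inj_on (\<lambda>x. h (x - y)) E" for y
    proof (rule inj_onI)
      fix u v assume uv: "u \<in> E" "v \<in> E" "h (u - y) = h (v - y)"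
      have "dist u v = dist (u - y) (v - y)" by (simp add: dist_norm)
      also have "\<dots> \<le> dist (u - y) (z (h (u - y))) + dist (v - y) (z (h (v - y)))"
        using uv(3) dist_triangle2[of "u - y" "v - y" "z (h (u - y))"] by simp
      also have "\<dots> \<le> \<delta> / 3 + \<delta> / 3" by (intro add_mono h)
      also have "\<dots> < \<delta>" using \<delta> by simp
      finally show "u = v" using \<delta>(2)[OF uv(1,2)] by force
    qed
  qed
qed

text \<open>Coefficients move from points x of E to the cell of x - y. Since they vanish at empty
  cells, p may be arbitrary there.\<close>

lemma swept_reindex:
  fixes E :: "'a::euclidean_space set" and h :: "'a \<Rightarrow> nat"
  assumes \<phi>: "swept E \<Lambda> \<phi> K" and h: "inj_on (\<lambda>x. h (x - y)) E"
  obtains a where "integrable (count_space UNIV) a" "(\<integral>k. cmod (a k) \<partial>count_space UNIV) \<le> K"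
    "\<And>k. k \<notin> (\<lambda>x. h (x - y)) ` E \<Longrightarrow> a k = 0"
    "\<And>f p. PWfun \<Lambda> f \<Longrightarrow> (\<And>x. x \<in> E \<Longrightarrow> p (h (x - y)) = x - y) \<Longrightarrow> \<phi> f = (\<integral>k. a k * f (p k + y) \<partial>count_space UNIV)"
proof -
  let ?h = "\<lambda>x. h (x - y)"
  obtain c where c: "integrable (count_space E) c" "(\<integral>x. cmod (c x) \<partial>count_space E) \<le> K"
     "\<And>f. PWfun \<Lambda> f \<Longrightarrow> \<phi> f = (\<integral>x. c x * f x \<partial>count_space E)"
    using \<phi> by (auto simp: swept_def)
  define a where "a = (\<lambda>k. if k \<in> ?h ` E then c (inv_into E ?h k) else 0)"
  have ah: "a (?h x) = c x" if "x \<in> E" for x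
    using that inv_into_f_f[OF h that] by (simp add: a_def)
  show thesis
  proof (rule that[of a])
    show "integrable (count_space UNIV) a"
    proof (subst integral_count_space_reindex_inj(2)[OF h])
      have "integrable (count_space E) (\<lambda>x. a (?h x)) \<longleftrightarrow> integrable (count_space E) c"
        by (rule Bochner_Integration.integrable_cong) (auto simp: ah)
      then show "integrable (count_space E) (\<lambda>x. a (?h x))" using c(1) by simp
    qed (auto simp: a_def)
    have "(\<integral>k. cmod (a k) \<partial>count_space UNIV) = (\<integral>x. cmod (a (?h x)) \<partial>count_space E)"
      by (rule integral_count_space_reindex_inj(1)[OF h]) (auto simp: a_def)
    also have "\<dots> = (\<integral>x. cmod (c x) \<partial>count_space E)"
      by (rule Bochner_Integration.integral_cong) (auto simp: ah)
    finally show "(\<integral>k. cmod (a k) \<partial>count_space UNIV) \<le> K" using c(2) by simp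
    show "a k = 0" if "k \<notin> ?h ` E" for k using that by (auto simp: a_def)
    fix f p assume f: "PWfun \<Lambda> f" and p: "\<And>x. x \<in> E \<Longrightarrow> p (h (x - y)) = x - y"
    have "(\<integral>k. a k * f (p k + y) \<partial>count_space UNIV) = (\<integral>x. a (?h x) * f (p (?h x) + y) \<partial>count_space E)"
      by (rule integral_count_space_reindex_inj(1)[OF h]) (auto simp: a_def)
    also have "\<dots> = (\<integral>x. c x * f x \<partial>count_space E)"
      by (rule Bochner_Integration.integral_cong) (auto simp: ah p)
    finally show "\<phi> f = (\<integral>k. a k * f (p k + y) \<partial>count_space UNIV)" using c(3)[OF f] by simp
  qed
qed

text \<open>Weak-star closedness of a ball of summable sequences on E. The points do not move with
  n, so coefficients converge while the support stays in E.\<close>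

lemma swept_closed:
  fixes E :: "'a::euclidean_space set"
  assumes E: "separated E" and \<phi>n: "\<And>n::nat. swept E \<Lambda> (\<phi>n n) K"
    and lim: "\<And>f. PWfun \<Lambda> f \<Longrightarrow> (\<lambda>n. \<phi>n n f) \<longlonglongrightarrow> \<phi> f"
  shows "swept E \<Lambda> \<phi> K"
proof -
  obtain z :: "nat \<Rightarrow> 'a" and h :: "'a \<Rightarrow> nat" and r :: real where z: "\<And>R. finite {k. norm (z k) \<le> R}"
    "\<And>x. dist x (z (h x)) \<le> r" "\<And>y. inj_on (\<lambda>x. h (x - y)) E"
    using separated_net[OF E] by blast
  have h: "inj_on h E" using z(3)[of 0] by simp
  define p where "p = (\<lambda>k. if k \<in> h ` E then inv_into E h k else z k)"
  have ph: "p (h x) = x" if "x \<in> E" for x using that inv_into_f_f[OF h that] by (simp add: p_def)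
  have r0: "0 \<le> r" using order.trans[OF zero_le_dist z(2)] .
  have pz: "dist (p k) (z k) \<le> r" for k
  proof (cases "k \<in> h ` E")
    case True
    then obtain x where "x \<in> E" "k = h x" by auto
    then show ?thesis using ph z(2) by simp
  qed (use r0 in \<open>auto simp: p_def\<close>)
  have "\<exists>a. integrable (count_space UNIV) a \<and> (\<integral>k. cmod (a k) \<partial>count_space UNIV) \<le> K \<and>
     (\<forall>k. k \<notin> h ` E \<longrightarrow> a k = 0) \<and> (\<forall>f. PWfun \<Lambda> f \<longrightarrow> \<phi>n n f = (\<integral>k. a k * f (p k) \<partial>count_space UNIV))" for n
  proof -
    from swept_reindex[OF \<phi>n[of n] z(3)[of 0]] obtain a where
      a: "integrable (count_space UNIV) a" "(\<integral>k. cmod (a k) \<partial>count_space UNIV) \<le> K"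
    "\<And>k. k \<notin> (\<lambda>x. h (x - 0)) ` E \<Longrightarrow> a k = 0"
    "\<And>f p. PWfun \<Lambda> f \<Longrightarrow> (\<And>x. x \<in> E \<Longrightarrow> p (h (x - 0)) = x - 0) \<Longrightarrow> \<phi>n n f = (\<integral>k. a k * f (p k + 0) \<partial>count_space UNIV)"
      by blast
    show ?thesis
      using a(1-3) a(4)[of _ p] ph by (intro exI[of _ a]) auto
  qed
  then have "\<exists>a. \<forall>n. integrable (count_space UNIV) (a n) \<and> (\<integral>k. cmod (a n k) \<partial>count_space UNIV) \<le> K \<and>
     (\<forall>k. k \<notin> h ` E \<longrightarrow> a n k = 0) \<and> (\<forall>f. PWfun \<Lambda> f \<longrightarrow> \<phi>n n f = (\<integral>k. a n k * f (p k) \<partial>count_space UNIV))"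
    by (intro choice allI)
  then obtain a where a: "\<And>n. integrable (count_space UNIV) (a n)" "\<And>n. (\<integral>k. cmod (a n k) \<partial>count_space UNIV) \<le> K"
    "\<And>n k. k \<notin> h ` E \<Longrightarrow> a n k = 0" "\<And>n f. PWfun \<Lambda> f \<Longrightarrow> \<phi>n n f = (\<integral>k. a n k * f (p k) \<partial>count_space UNIV)"
    by blast
  obtain s q b where s: "strict_mono (s :: nat \<Rightarrow> nat)" "\<And>k. (\<lambda>n. p k) \<longlonglongrightarrow> q k" "\<And>k. (\<lambda>n. a (s n) k) \<longlonglongrightarrow> b k"
    "integrable (count_space UNIV) b" "(\<integral>k. cmod (b k) \<partial>count_space UNIV) \<le> K"
    "\<And>f. PWfun \<Lambda> f \<Longrightarrow>
       (\<lambda>n. \<integral>k. a (s n) k * f (p k) \<partial>count_space UNIV) \<longlonglongrightarrow> (\<integral>k. b k * f (q k) \<partial>count_space UNIV)"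
    using weak_limit[where a=a and p="\<lambda>_. p", OF z(1) pz a(1,2)] by blast
  have qp: "q k = p k" for k by (rule LIMSEQ_unique[OF s(2) tendsto_const])
  \<comment> \<open>Empty cells stay empty in the limit, so b can be read back as a family on
    E.\<close>
  have b0: "b k = 0" if "k \<notin> h ` E" for k
    using LIMSEQ_unique[OF s(3)[of k]] a(3)[OF that] tendsto_const[of "0::complex" sequentially] by simp
  show ?thesis
    unfolding swept_def
  proof (intro exI[of _ "\<lambda>x. b (h x)"] conjI allI impI)
    show "integrable (count_space E) (\<lambda>x. b (h x))"
      using s(4) integral_count_space_reindex_inj(2)[OF h, of b] b0 by simp
    show "(\<integral>x. cmod (b (h x)) \<partial>count_space E) \<le> K"
      using s(5) integral_count_space_reindex_inj(1)[OF h, of "\<lambda>k. cmod (b k)"] b0 by simp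
    fix f assume f: "PWfun \<Lambda> f"
    have "(\<lambda>n. \<phi>n (s n) f) \<longlonglongrightarrow> (\<integral>k. b k * f (p k) \<partial>count_space UNIV)"
      using s(6)[OF f] unfolding a(4)[OF f] qp .
    moreover have "(\<lambda>n. \<phi>n (s n) f) \<longlonglongrightarrow> \<phi> f"
      using LIMSEQ_subseq_LIMSEQ[OF lim[OF f] s(1)] by (simp add: comp_def)
    ultimately have "\<phi> f = (\<integral>k. b k * f (p k) \<partial>count_space UNIV)" by (rule LIMSEQ_unique[rotated])
    also have "\<dots> = (\<integral>x. b (h x) * f (p (h x)) \<partial>count_space E)"
      by (rule integral_count_space_reindex_inj(1)[OF h]) (auto simp: b0)
    also have "\<dots> = (\<integral>x. b (h x) * f x \<partial>count_space E)"
      by (rule Bochner_Integration.integral_cong) (auto simp: ph)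
    finally show "\<phi> f = (\<integral>x. b (h x) * f x \<partial>count_space E)" .
  qed
qed

subsection \<open>Sampling\<close>

text \<open>The contrapositive of \<open>swept_closed\<close> for perturbations measured in the norm
  dual to the sup norm: swept perturbations of size 1 / (n + 1) would converge to \<phi>.\<close>

lemma not_swept_open:
  fixes E :: "'a::euclidean_space set"
  assumes E: "separated E" and \<phi>: "\<not> swept E \<Lambda> \<phi> K"
  shows "\<exists>\<eta>>0. \<forall>\<psi>. (\<forall>f M. PWfun \<Lambda> f \<longrightarrow> (\<forall>x. cmod (f x) \<le> M) \<longrightarrow> cmod (\<psi> f) \<le> \<eta> * M)
     \<longrightarrow> \<not> swept E \<Lambda> (\<lambda>f. \<phi> f + \<psi> f) K"
proof (rule ccontr)
  assume "\<not> ?thesis"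
  then have "\<exists>\<psi>. (\<forall>f M. PWfun \<Lambda> f \<longrightarrow> (\<forall>x. cmod (f x) \<le> M) \<longrightarrow> cmod (\<psi> f) \<le> 1 / real (Suc n) * M)
     \<and> swept E \<Lambda> (\<lambda>f. \<phi> f + \<psi> f) K" for n
    by (meson of_nat_0_less_iff zero_less_Suc zero_less_divide_1_iff)
  then have "\<exists>\<psi>. \<forall>n. (\<forall>f M. PWfun \<Lambda> f \<longrightarrow> (\<forall>x. cmod (f x) \<le> M) \<longrightarrow> cmod (\<psi> n f) \<le> 1 / real (Suc n) * M)
     \<and> swept E \<Lambda> (\<lambda>f. \<phi> f + \<psi> n f) K"
    by (intro choice allI)
  then obtain \<psi> where \<psi>: "\<And>n f M. PWfun \<Lambda> f \<Longrightarrow> (\<And>x. cmod (f x) \<le> M) \<Longrightarrow> cmod (\<psi> n f) \<le> 1 / real (Suc n) * M"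
     "\<And>n. swept E \<Lambda> (\<lambda>f. \<phi> f + \<psi> n f) K"
    by blast
  have "swept E \<Lambda> \<phi> K"
  proof (rule swept_closed[OF E \<psi>(2)])
    fix f assume f: "PWfun \<Lambda> f"
    obtain M where M: "M > 0" "\<And>x. cmod (f x) \<le> M" using PWfun_bounded[OF f] by blast
    have "(\<lambda>n. 1 / real (Suc n) * M) \<longlonglongrightarrow> 0 * M"
      by (intro tendsto_mult tendsto_const LIMSEQ_Suc[OF lim_1_over_n])
    then have "(\<lambda>n. \<psi> n f) \<longlonglongrightarrow> 0"
      by (intro Lim_null_comparison[OF always_eventually, of "\<lambda>n. \<psi> n f" "\<lambda>n. 1 / real (Suc n) * M"] allI \<psi>(1)[OF f M(2)]) simp
    then show "(\<lambda>n. \<phi> f + \<psi> n f) \<longlonglongrightarrow> \<phi> f"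
      using tendsto_add[OF tendsto_const] by fastforce
  qed
  then show False using \<phi> by simp
qed

text \<open>A gliding hump replaces the open mapping theorem: if the optimal masses for point masses were
  unbounded, a suitable series of point masses could not be swept onto \<open>E\<close> at all.\<close>

lemma swept_uniform:
  fixes E \<Lambda> :: "'a::euclidean_space set"
  assumes E: "separated E" "countable E" and bal: "balayage E \<Lambda>"
  shows "\<exists>K. \<forall>y. swept E \<Lambda> (\<lambda>f. f y) K"
proof (rule ccontr)
  assume "\<not> ?thesis"
  then have no: "\<And>K. \<exists>y. \<not> swept E \<Lambda> (\<lambda>f. f y) K" by blast
  define small where "small = (\<lambda>\<eta> \<psi>. \<forall>f M. PWfun \<Lambda> f \<longrightarrow> (\<forall>x. cmod (f x) \<le> M) \<longrightarrow> cmod (\<psi> f) \<le> \<eta> * M)"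
  \<comment> \<open>No functional within \<eta> of \<phi> can be swept with mass n. Each stage of
    the construction preserves this for all later ones.\<close>
  define good where "good = (\<lambda>n \<eta> \<phi>. \<eta> > 0 \<and> (\<forall>\<psi>. small \<eta> \<psi> \<longrightarrow> \<not> swept E \<Lambda> (\<lambda>f. \<phi> f + \<psi> f) (real n)))"
  have small_mono: "small \<eta>' \<psi>" if "small \<eta> \<psi>" "\<eta> \<le> \<eta>'" for \<eta> \<eta>' \<psi>
    unfolding small_def
  proof (intro allI impI)
    fix f M assume f: "PWfun \<Lambda> f" "\<forall>x. cmod (f x) \<le> M"
    have "0 \<le> M" using f(2) norm_ge_zero order.trans by blast
    then have "\<eta> * M \<le> \<eta>' * M" using that(2) by (intro mult_right_mono)
    moreover have "cmod (\<psi> f) \<le> \<eta> * M" using that(1) f unfolding small_def by blast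
    ultimately show "cmod (\<psi> f) \<le> \<eta>' * M" by linarith
  qed
  have mk_good: "\<exists>\<eta>'. \<eta>' \<le> \<eta> \<and> good n \<eta>' \<phi>" if nr: "\<not> swept E \<Lambda> \<phi> (real n)" and pos: "\<eta> > 0" for n \<eta> \<phi>
  proof -
    obtain \<eta>0 where \<eta>0: "\<eta>0 > 0" "\<And>\<psi>. small \<eta>0 \<psi> \<Longrightarrow> \<not> swept E \<Lambda> (\<lambda>f. \<phi> f + \<psi> f) (real n)"
      using not_swept_open[OF E(1) nr] unfolding small_def by blast
    then have "good n (min \<eta> \<eta>0) \<phi>"
      using pos small_mono[of "min \<eta> \<eta>0" _ \<eta>0] unfolding good_def by auto
    then show ?thesis using min.cobounded1 by blast
  qed
  have step: "\<exists>y c \<eta>'. 0 \<le> c \<and> c \<le> \<eta> / 2 \<and> \<eta>' \<le> \<eta> / 2 \<and> good (Suc n) \<eta>' (\<lambda>f. \<phi> f + of_real c * f y)"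
    if g: "good n \<eta> \<phi>" for n \<eta> \<phi>
  proof -
    have \<eta>: "\<eta> > 0" using g by (simp add: good_def)
    define \<rho> where "\<rho> = \<eta> / 2"
    have \<rho>: "\<rho> > 0" using \<eta> by (simp add: \<rho>_def)
    \<comment> \<open>If both \<open>\<phi>\<close> and \<open>\<phi>\<close> plus \<rho> times the
      mass at y were swept with mass n + 1, their difference divided by \<rho> would sweep the point
      mass at y with exactly this bound.\<close>
    obtain y where y: "\<not> swept E \<Lambda> (\<lambda>f. f y) (1 / \<rho> * (real (Suc n) + real (Suc n)))" using no by blast
    \<comment> \<open>One of two nonnegative weights always works; nonnegativity is what
      \<open>balayage_swept\<close> requires of the final series.\<close>
    have "\<exists>c\<in>{0, \<rho>}. \<not> swept E \<Lambda> (\<lambda>f. \<phi> f + of_real c * f y) (real (Suc n))"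
    proof (rule ccontr)
      assume "\<not> ?thesis"
      then have r: "swept E \<Lambda> (\<lambda>f. \<phi> f + of_real \<rho> * f y) (real (Suc n))" "swept E \<Lambda> (\<lambda>f. \<phi> f) (real (Suc n))" by auto
      from swept_combine[OF r, of "of_real (1 / \<rho>)"] have
        "swept E \<Lambda> (\<lambda>f. of_real (1 / \<rho>) * (\<phi> f + of_real \<rho> * f y - \<phi> f)) (1 / \<rho> * (real (Suc n) + real (Suc n)))"
        unfolding norm_of_real using \<rho> by (simp only: abs_of_pos zero_less_divide_1_iff)
      then have "swept E \<Lambda> (\<lambda>f. f y) (1 / \<rho> * (real (Suc n) + real (Suc n)))"
        by (rule swept_cong[rotated]) (use \<rho> in auto)
      then show False using y by simp
    qed
    then obtain c where c: "c \<in> {0, \<rho>}" "\<not> swept E \<Lambda> (\<lambda>f. \<phi> f + of_real c * f y) (real (Suc n))" by blast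
    obtain \<eta>' where "\<eta>' \<le> \<eta> / 2" "good (Suc n) \<eta>' (\<lambda>f. \<phi> f + of_real c * f y)"
      using mk_good[OF c(2), of "\<eta> / 2"] \<eta> by auto
    moreover have "0 \<le> c" "c \<le> \<eta> / 2" using c(1) \<rho> by (auto simp: \<rho>_def)
    ultimately show ?thesis by blast
  qed
  \<comment> \<open>A state consists of the functional, its tolerance, the newest point and the
    newest weight.\<close>
  define P where "P = (\<lambda>n (st :: (('a \<Rightarrow> complex) \<Rightarrow> complex) \<times> real \<times> 'a \<times> real). good n (fst (snd st)) (fst st))"
  define Q where "Q = (\<lambda>(n::nat) (st :: (('a \<Rightarrow> complex) \<Rightarrow> complex) \<times> real \<times> 'a \<times> real) (st' :: (('a \<Rightarrow> complex) \<Rightarrow> complex) \<times> real \<times> 'a \<times> real).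
    0 \<le> snd (snd (snd st')) \<and> snd (snd (snd st')) \<le> fst (snd st) / 2 \<and> fst (snd st') \<le> fst (snd st) / 2 \<and>
    fst st' = (\<lambda>f. fst st f + of_real (snd (snd (snd st'))) * f (fst (snd (snd st')))))"
  obtain y0 where y0: "\<not> swept E \<Lambda> (\<lambda>f. f y0) (real 0)" using no by blast
  obtain \<eta>0 where \<eta>0: "good 0 \<eta>0 (\<lambda>f. f y0)" using mk_good[OF y0, of 1] by auto
  \<comment> \<open>The initial weight 1 makes the starting functional the term of index 0 of the
    series.\<close>
  have "\<exists>S. (\<forall>n. P n (S n)) \<and> (\<forall>n. Q n (S n) (S (Suc n))) \<and> S 0 = ((\<lambda>f. f y0), \<eta>0, y0, 1)"
  proof -
    have "\<exists>S. \<forall>n. (P n (S n) \<and> (n = 0 \<longrightarrow> S n = ((\<lambda>f. f y0), \<eta>0, y0, 1))) \<and> Q n (S n) (S (Suc n))"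
    proof (rule dependent_nat_choice)
      show "\<exists>x. P 0 x \<and> (0 = (0::nat) \<longrightarrow> x = ((\<lambda>f. f y0), \<eta>0, y0, 1))"
        using \<eta>0 by (auto simp: P_def)
      fix st n assume "P n st \<and> (n = 0 \<longrightarrow> st = ((\<lambda>f. f y0), \<eta>0, y0, 1))"
      then have "good n (fst (snd st)) (fst st)" by (simp add: P_def)
      from step[OF this] obtain y c \<eta>' where
        "0 \<le> c" "c \<le> fst (snd st) / 2" "\<eta>' \<le> fst (snd st) / 2" "good (Suc n) \<eta>' (\<lambda>f. fst st f + of_real c * f y)"
        by blast
      then show "\<exists>st'. (P (Suc n) st' \<and> (Suc n = 0 \<longrightarrow> st' = ((\<lambda>f. f y0), \<eta>0, y0, 1))) \<and> Q n st st'"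
        by (intro exI[of _ "(\<lambda>f. fst st f + of_real c * f y, \<eta>', y, c)"]) (auto simp: P_def Q_def)
    qed
    then show ?thesis by blast
  qed
  then obtain S where S: "\<And>n. P n (S n)" "\<And>n. Q n (S n) (S (Suc n))" "S 0 = ((\<lambda>f. f y0), \<eta>0, y0, 1)"
    by blast
  define \<phi> where "\<phi> = (\<lambda>n. fst (S n))"
  define \<eta> where "\<eta> = (\<lambda>n. fst (snd (S n)))"
  define y where "y = (\<lambda>n. fst (snd (snd (S n))))"
  define c where "c = (\<lambda>n. snd (snd (snd (S n))))"
  have good: "good n (\<eta> n) (\<phi> n)" for n using S(1)[of n] by (simp add: P_def \<eta>_def \<phi>_def)
  have c0: "0 \<le> c n" for n using S(2)[of "n - 1"] S(3) by (cases n) (auto simp: Q_def c_def)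
  have cs: "c (Suc n) \<le> \<eta> n / 2" and \<eta>s: "\<eta> (Suc n) \<le> \<eta> n / 2" for n
    using S(2)[of n] by (auto simp: Q_def c_def \<eta>_def)
  have \<phi>_sum: "\<phi> n f = (\<Sum>j<Suc n. of_real (c j) * f (y j))" for n and f :: "'a \<Rightarrow> complex"
  proof (induction n)
    case 0 then show ?case by (simp add: \<phi>_def c_def y_def S(3))
  next
    case (Suc n)
    have "\<phi> (Suc n) f = \<phi> n f + of_real (c (Suc n)) * f (y (Suc n))"
      using S(2)[of n] by (auto simp: Q_def \<phi>_def c_def y_def)
    then show ?case using Suc by simp
  qed
  have \<eta>_dec: "\<eta> (n + i) \<le> \<eta> n * (1/2) ^ i" for n i
  proof (induction i)
    case (Suc i) then show ?case using \<eta>s[of "n + i"] by simp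
  qed simp
  \<comment> \<open>The tolerances at least halve at each stage, so all weights added after stage n
    sum to at most \<open>\<eta> n\<close>, and the tail stays inside the neighbourhood excluded at
    stage n.\<close>
  have c_dec: "c (i + Suc n) \<le> \<eta> n * (1/2) ^ Suc i" for n i
    using cs[of "n + i"] \<eta>_dec[of n i] by (simp add: add.commute)
  have geo: "(\<lambda>i. (1/2::real) ^ Suc i) sums 1" by (rule power_half_series)
  have cS: "summable (\<lambda>i. c (i + Suc n))" for n
    by (rule summable_comparison_test[of _ "\<lambda>i. \<eta> n * (1/2) ^ Suc i"])
       (use c_dec[of _ n] c0 geo in \<open>auto simp del: power_Suc intro!: summable_mult simp: sums_iff\<close>)
  have csum: "summable c" using cS[of 0] by (simp only: summable_iff_shift)
  have tail: "(\<Sum>i. c (i + Suc n)) \<le> \<eta> n" for n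
  proof -
    have "(\<Sum>i. c (i + Suc n)) \<le> (\<Sum>i. \<eta> n * (1/2) ^ Suc i)"
      by (rule suminf_le[OF c_dec cS]) (use geo in \<open>auto simp del: power_Suc intro!: summable_mult simp: sums_iff\<close>)
    also have "\<dots> = \<eta> n" using geo by (subst suminf_mult) (auto simp: sums_iff)
    finally show ?thesis .
  qed
  obtain K where K: "swept E \<Lambda> (\<lambda>f. \<Sum>j. of_real (c j) * f (y j)) K"
    using balayage_swept[OF bal E(2), of c y] c0 csum by blast
  \<comment> \<open>Balayage sweeps the whole series with some mass K; stage n \<ge> K has ruled
    this out.\<close>
  define n where "n = nat \<lceil>K\<rceil>"
  have K': "swept E \<Lambda> (\<lambda>f. \<Sum>j. of_real (c j) * f (y j)) (real n)"
    by (rule swept_mono[OF K]) (simp add: n_def real_nat_ceiling_ge)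
  define \<psi> where "\<psi> = (\<lambda>f :: 'a \<Rightarrow> complex. \<Sum>i. of_real (c (i + Suc n)) * f (y (i + Suc n)))"
  have summ: "summable (\<lambda>i. norm (complex_of_real (c (i + m)) * f (y (i + m))))" and
    bd: "cmod (complex_of_real (c (i + m)) * f (y (i + m))) \<le> c (i + m) * M"
    if "\<forall>x. cmod (f x) \<le> M" for f :: "'a \<Rightarrow> complex" and M m i
  proof -
    show bd: "cmod (complex_of_real (c (i + m)) * f (y (i + m))) \<le> c (i + m) * M" for i
      using that c0 by (auto simp: norm_mult intro!: mult_left_mono)
    show "summable (\<lambda>i. norm (complex_of_real (c (i + m)) * f (y (i + m))))"
      by (rule summable_comparison_test[of _ "\<lambda>i. c (i + m) * M"])
         (use bd csum in \<open>auto intro!: summable_mult2 simp: summable_iff_shift\<close>)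
  qed
  have "small (\<eta> n) \<psi>"
    unfolding small_def
  proof (intro allI impI)
    fix f M assume f: "PWfun \<Lambda> f" "\<forall>x. cmod (f x) \<le> M"
    have M0: "0 \<le> M" using f(2) norm_ge_zero order.trans by blast
    have "cmod (\<psi> f) \<le> (\<Sum>i. norm (complex_of_real (c (i + Suc n)) * f (y (i + Suc n))))"
      unfolding \<psi>_def by (rule summable_norm[OF summ[OF f(2)]])
    also have "\<dots> \<le> (\<Sum>i. c (i + Suc n) * M)"
      by (rule suminf_le[OF bd[OF f(2)] summ[OF f(2)]]) (use cS in \<open>auto intro!: summable_mult2\<close>)
    also have "\<dots> = (\<Sum>i. c (i + Suc n)) * M" by (rule suminf_mult2[OF cS, symmetric])
    also have "\<dots> \<le> \<eta> n * M" by (rule mult_right_mono[OF tail M0])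
    finally show "cmod (\<psi> f) \<le> \<eta> n * M" .
  qed
  then have "\<not> swept E \<Lambda> (\<lambda>f. \<phi> n f + \<psi> f) (real n)"
    using good[of n] unfolding good_def by blast
  moreover have "swept E \<Lambda> (\<lambda>f. \<phi> n f + \<psi> f) (real n)"
  proof (rule swept_cong[OF _ K'])
    fix f assume f: "PWfun \<Lambda> f"
    obtain M where M: "M > 0" "\<And>x. cmod (f x) \<le> M" using PWfun_bounded[OF f] by blast
    have "summable (\<lambda>j. of_real (c j) * f (y j))"
      using summable_norm_cancel[OF summ[of f M 0]] M by simp
    then show "(\<Sum>j. of_real (c j) * f (y j)) = \<phi> n f + \<psi> f"
      unfolding \<phi>_sum \<psi>_def by (subst suminf_split_initial_segment[where k="Suc n"]) simp_all
  qed
  ultimately show False by simp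
qed

text \<open>Sup-norm sampling survives a small dilation of the spectrum. Otherwise a normalised sequence of
  counterexamples, recentred at its near-maxima and dilated back into \<open>\<Lambda>\<close>, would be reproduced at the
  origin by a limiting summable configuration on which it tends to zero.\<close>

lemma sampling_dilated:
  fixes E \<Lambda> :: "'a::euclidean_space set"
  assumes E: "separated E" "countable E" and bal: "balayage E \<Lambda>" and bnd: "bounded \<Lambda>"
  shows "\<exists>\<epsilon>>0. \<exists>K. \<forall>f y s. PWfun ((\<lambda>\<gamma>. (1 + \<epsilon>) *\<^sub>R \<gamma>) ` \<Lambda>) f \<longrightarrow> 0 \<le> s \<longrightarrow> (\<forall>x\<in>E. cmod (f x) \<le> s) \<longrightarrow>
     cmod (f y) \<le> K * s"
proof (rule ccontr)
  assume neg: "\<not> ?thesis"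
  define t where "t = (\<lambda>n::nat. 1 + 1 / real (Suc n))"
  have t1: "t n > 1" "t n \<le> 2" for n by (auto simp: t_def)
  have tlim: "t \<longlonglongrightarrow> 1"
    unfolding t_def using tendsto_add[OF tendsto_const LIMSEQ_Suc[OF lim_1_over_n], of "1::real"] by simp
  have "\<exists>f. PWfun ((\<lambda>\<gamma>. t n *\<^sub>R \<gamma>) ` \<Lambda>) f \<and> (\<forall>x. cmod (f x) \<le> 1) \<and> cmod (f 0) \<ge> 1/2 \<and>
      (\<exists>y. \<forall>x. x + y \<in> E \<longrightarrow> cmod (f x) \<le> 1 / real (Suc n))" for n
  proof -
    \<comment> \<open>The negated claim is used with dilation 1 / (n + 1) and constant n + 1
      simultaneously.\<close>
    have "\<exists>f y s. PWfun ((\<lambda>\<gamma>. (1 + 1 / real (Suc n)) *\<^sub>R \<gamma>) ` \<Lambda>) f \<and> 0 \<le> s \<and> (\<forall>x\<in>E. cmod (f x) \<le> s) \<and>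
     \<not> cmod (f y) \<le> real (Suc n) * s"
    proof (rule ccontr)
      assume *: "\<not> ?thesis"
      have "(1 / real (Suc n)) > 0" by simp
      with * show False using neg by blast
    qed
    then obtain f y s where f: "PWfun ((\<lambda>\<gamma>. t n *\<^sub>R \<gamma>) ` \<Lambda>) f" and s: "0 \<le> s" "\<And>x. x \<in> E \<Longrightarrow> cmod (f x) \<le> s"
      and y: "cmod (f y) > real (Suc n) * s"
      by (auto simp: t_def not_le)
    obtain M where M: "M > 0" "\<And>x. cmod (f x) \<le> M" using PWfun_bounded[OF f] by blast
    \<comment> \<open>Dividing by the supremum B and recentring at a point w with value above B / 2
      gives bound 1, modulus at least 1/2 at the origin, and samples of size at most s / B < 1 / (n
      + 1).\<close>
    define B where "B = (SUP x. cmod (f x))"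
    have bdd: "bdd_above (range (\<lambda>x. cmod (f x)))" using M(2) by (auto intro!: bdd_aboveI)
    have B: "cmod (f x) \<le> B" for x unfolding B_def by (rule cSUP_upper[OF _ bdd]) simp
    have sB: "real (Suc n) * s < B" using y B[of y] by simp
    have B0: "B > 0" using s(1) sB by (smt (verit) mult_nonneg_nonneg of_nat_0_le_iff)
    have "\<exists>w. B / 2 < cmod (f w)"
      using B0 less_cSUP_iff[of UNIV "\<lambda>x. cmod (f x)" "B/2"] bdd unfolding B_def by auto
    then obtain w where w: "B / 2 < cmod (f w)" by blast
    show ?thesis
    proof (intro exI[of _ "\<lambda>x. of_real (1 / B) * f (x + w)"] conjI)
      show "PWfun ((\<lambda>\<gamma>. t n *\<^sub>R \<gamma>) ` \<Lambda>) (\<lambda>x. of_real (1 / B) * f (x + w))"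
        by (intro PWfun_cmult PWfun_translate f)
      have nm: "cmod (of_real (1 / B) * u) = cmod u / B" for u
        using B0 by (simp add: norm_mult norm_divide)
      show "\<forall>x. cmod (of_real (1 / B) * f (x + w)) \<le> 1"
        unfolding nm using B B0 by simp
      show "1/2 \<le> cmod (of_real (1 / B) * f (0 + w))"
        unfolding nm using w B0 by (simp add: field_simps)
      show "\<exists>y. \<forall>x. x + y \<in> E \<longrightarrow> cmod (of_real (1 / B) * f (x + w)) \<le> 1 / real (Suc n)"
        unfolding nm
      proof (intro exI[of _ w] allI impI)
        fix x assume "x + w \<in> E"
        then have "cmod (f (x + w)) / B \<le> s / B" using s(2) B0 by (intro divide_right_mono) auto
        also have "\<dots> \<le> 1 / real (Suc n)" using sB B0 by (simp add: field_simps)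
        finally show "cmod (f (x + w)) / B \<le> 1 / real (Suc n)" .
      qed
    qed
  qed
  then have "\<exists>f. \<forall>n. PWfun ((\<lambda>\<gamma>. t n *\<^sub>R \<gamma>) ` \<Lambda>) (f n) \<and> (\<forall>x. cmod (f n x) \<le> 1) \<and> cmod (f n 0) \<ge> 1/2 \<and>
      (\<exists>y. \<forall>x. x + y \<in> E \<longrightarrow> cmod (f n x) \<le> 1 / real (Suc n))"
    by (intro choice allI)
  then obtain f where f: "\<And>n. PWfun ((\<lambda>\<gamma>. t n *\<^sub>R \<gamma>) ` \<Lambda>) (f n)" "\<And>n x. cmod (f n x) \<le> 1" "\<And>n. cmod (f n 0) \<ge> 1/2"
    and "\<And>n. \<exists>y. \<forall>x. x + y \<in> E \<longrightarrow> cmod (f n x) \<le> 1 / real (Suc n)" by blast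
  then obtain y where y: "\<And>n x. x + y n \<in> E \<Longrightarrow> cmod (f n x) \<le> 1 / real (Suc n)" by metis
  \<comment> \<open>Stretching the argument brings the spectrum back into \<Lambda> and keeps the
    value at the origin.\<close>
  define g where "g = (\<lambda>n x. f n ((1 / t n) *\<^sub>R x))"
  have g: "PWfun \<Lambda> (g n)" for n
    unfolding g_def using PWfun_dilate[OF f(1)] t1(1)[of n] by simp
  obtain R where R: "R > 0" "\<And>\<gamma>. \<gamma> \<in> \<Lambda> \<Longrightarrow> norm \<gamma> \<le> R" using bnd by (auto simp: bounded_pos)
  \<comment> \<open>Dilations by at most 2 keep the spectra within 2R; 3R leaves room for the open
    ball in the equicontinuity lemma.\<close>
  have sub: "(\<lambda>\<gamma>. t n *\<^sub>R \<gamma>) ` \<Lambda> \<subseteq> ball 0 (3 * R)" for n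
  proof -
    have "t n * norm \<gamma> < 3 * R" if "\<gamma> \<in> \<Lambda>" for \<gamma>
    proof -
      have "t n * norm \<gamma> \<le> 2 * R" using t1[of n] R(2)[OF that] by (intro mult_mono) auto
      then show ?thesis using R(1) by simp
    qed
    then show ?thesis using t1[of n] by auto
  qed
  obtain \<omega> :: "'a \<Rightarrow> real" where \<omega>: "\<And>w::nat \<Rightarrow> 'a. w \<longlonglongrightarrow> 0 \<Longrightarrow> (\<lambda>n. \<omega> (w n)) \<longlonglongrightarrow> 0"
    "\<And>S f x t. PWfun S f \<Longrightarrow> S \<subseteq> ball 0 (3 * R) \<Longrightarrow> (\<And>x. cmod (f x) \<le> 1) \<Longrightarrow> cmod (f (x + t) - f x) \<le> \<omega> t"
    using PWfun_equicontinuous[where M="3 * R" and 'a='a] by blast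
  obtain K where K: "\<And>y. swept E \<Lambda> (\<lambda>f. f y) K" using swept_uniform[OF E bal] by blast
  obtain z :: "nat \<Rightarrow> 'a" and h :: "'a \<Rightarrow> nat" and r :: real where z: "\<And>R. finite {k. norm (z k) \<le> R}"
    "\<And>x. dist x (z (h x)) \<le> r" "\<And>y. inj_on (\<lambda>x. h (x - y)) E"
    using separated_net[OF E(1)] by blast
  have r0: "0 \<le> r" using order.trans[OF zero_le_dist z(2)] .
  define H where "H = (\<lambda>n x. h (x - y n))"
  \<comment> \<open>Occupied cells carry the actual point of E - y n; empty cells get the dummy
    point \<open>z k\<close>, and their coefficient is 0.\<close>
  define p where "p = (\<lambda>n k. if k \<in> H n ` E then inv_into E (H n) k - y n else z k)"
  have pH: "p n (h (x - y n)) = x - y n" if "x \<in> E" for n x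
  proof -
    have "inv_into E (H n) (H n x) = x" using inv_into_f_f[OF _ that] z(3) unfolding H_def by blast
    then show ?thesis using that by (auto simp: p_def H_def)
  qed
  have pE: "p n k + y n \<in> E \<and> dist (p n k) (z k) \<le> r" if k: "k \<in> H n ` E" for n k
  proof -
    obtain x where x: "x \<in> E" "k = h (x - y n)" using k by (auto simp: H_def)
    then show ?thesis using pH[OF x(1), of n] z(2)[of "x - y n"] by simp
  qed
  have pz: "dist (p n k) (z k) \<le> r" for n k
    using pE[of k n] r0 by (cases "k \<in> H n ` E") (auto simp: p_def)
  have "\<exists>a. integrable (count_space UNIV) a \<and> (\<integral>k. cmod (a k) \<partial>count_space UNIV) \<le> K \<and>
     (\<forall>k. k \<notin> H n ` E \<longrightarrow> a k = 0) \<and> (\<forall>f. PWfun \<Lambda> f \<longrightarrow> f 0 = (\<integral>k. a k * f (p n k) \<partial>count_space UNIV))" for n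
  proof -
    from swept_reindex[OF K[of "y n"] z(3)[of "y n"]] obtain a where
      a: "integrable (count_space UNIV) a" "(\<integral>k. cmod (a k) \<partial>count_space UNIV) \<le> K"
    "\<And>k. k \<notin> (\<lambda>x. h (x - y n)) ` E \<Longrightarrow> a k = 0"
    "\<And>f p. PWfun \<Lambda> f \<Longrightarrow> (\<And>x. x \<in> E \<Longrightarrow> p (h (x - y n)) = x - y n) \<Longrightarrow> f (y n) = (\<integral>k. a k * f (p k + y n) \<partial>count_space UNIV)"
      by blast
    have "f 0 = (\<integral>k. a k * f (p n k) \<partial>count_space UNIV)" if "PWfun \<Lambda> f" for f
      using a(4)[OF PWfun_translate[OF that, of "- y n"], of "p n"] pH by simp
    then show ?thesis
      using a(1-3) by (intro exI[of _ a]) (auto simp: H_def)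
  qed
  then have "\<exists>a. \<forall>n. integrable (count_space UNIV) (a n) \<and> (\<integral>k. cmod (a n k) \<partial>count_space UNIV) \<le> K \<and>
     (\<forall>k. k \<notin> H n ` E \<longrightarrow> a n k = 0) \<and> (\<forall>f. PWfun \<Lambda> f \<longrightarrow> f 0 = (\<integral>k. a n k * f (p n k) \<partial>count_space UNIV))"
    by (intro choice allI)
  then obtain a where a: "\<And>n. integrable (count_space UNIV) (a n)" "\<And>n. (\<integral>k. cmod (a n k) \<partial>count_space UNIV) \<le> K"
     "\<And>n k. k \<notin> H n ` E \<Longrightarrow> a n k = 0" "\<And>n f. PWfun \<Lambda> f \<Longrightarrow> f 0 = (\<integral>k. a n k * f (p n k) \<partial>count_space UNIV)"
    by blast
  obtain s q b where s: "strict_mono (s :: nat \<Rightarrow> nat)" "\<And>k. (\<lambda>n. p (s n) k) \<longlonglongrightarrow> q k" "\<And>k. (\<lambda>n. a (s n) k) \<longlonglongrightarrow> b k"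
    "integrable (count_space UNIV) b"
    "\<And>f. PWfun \<Lambda> f \<Longrightarrow> (\<lambda>n. \<integral>k. a (s n) k * f (p (s n) k) \<partial>count_space UNIV) \<longlonglongrightarrow> (\<integral>k. b k * f (q k) \<partial>count_space UNIV)"
    using weak_limit[where a=a and p=p, OF z(1) pz a(1,2)] by blast
  \<comment> \<open>Along the subsequence the sums are constantly \<open>f 0\<close>, so the limit
    configuration also reproduces the value at the origin.\<close>
  have rep: "f 0 = (\<integral>k. b k * f (q k) \<partial>count_space UNIV)" if "PWfun \<Lambda> f" for f
    using LIMSEQ_unique[OF s(5)[OF that], of "f 0"] a(4)[OF that, symmetric] by simp
  have slim: "(\<lambda>n. 1 / real (Suc (s n))) \<longlonglongrightarrow> 0"
    using LIMSEQ_subseq_LIMSEQ[OF LIMSEQ_Suc[OF lim_1_over_n] s(1)] by (simp add: comp_def)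
  have tslim: "(\<lambda>n. t (s n)) \<longlonglongrightarrow> 1"
    using LIMSEQ_subseq_LIMSEQ[OF tlim s(1)] by (simp add: comp_def)
  \<comment> \<open>If \<open>b k\<close> is nonzero, cell k is occupied for large n, so f is small
    at \<open>p (s n) k\<close>. The point where \<open>g (s n)\<close> evaluates f tends to the
    same limit, and equicontinuity carries the smallness over.\<close>
  have pt: "(\<lambda>n. b k * g (s n) (q k)) \<longlonglongrightarrow> 0" for k
  proof (cases "b k = 0")
    case False
    have ev: "\<forall>\<^sub>F n in sequentially. p (s n) k + y (s n) \<in> E"
    proof -
      have "\<forall>\<^sub>F n in sequentially. a (s n) k \<noteq> 0"
        using tendsto_imp_eventually_ne[OF s(3)[of k] False] .
      then show ?thesis by (rule eventually_mono) (use a(3) pE in blast)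
    qed
    let ?w = "\<lambda>n. (1 / t (s n)) *\<^sub>R q k - p (s n) k"
    have "?w \<longlonglongrightarrow> (1 / 1) *\<^sub>R q k - q k"
      by (intro tendsto_intros tslim s(2)) auto
    then have w: "(\<lambda>n. \<omega> (?w n)) \<longlonglongrightarrow> 0" by (intro \<omega>(1)) simp
    have "(\<lambda>n. g (s n) (q k)) \<longlonglongrightarrow> 0"
    proof (rule Lim_null_comparison)
      show "(\<lambda>n. 1 / real (Suc (s n)) + \<omega> (?w n)) \<longlonglongrightarrow> 0"
        using tendsto_add[OF slim w] by simp
      show "\<forall>\<^sub>F n in sequentially. norm (g (s n) (q k)) \<le> 1 / real (Suc (s n)) + \<omega> (?w n)"
        using ev
      proof eventually_elim
        case (elim n)
        have "norm (g (s n) (q k)) \<le> norm (f (s n) (p (s n) k)) + norm (f (s n) (p (s n) k + ?w n) - f (s n) (p (s n) k))"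
          unfolding g_def using norm_triangle_sub by (simp add: add.commute)
        also have "\<dots> \<le> 1 / real (Suc (s n)) + \<omega> (?w n)"
          by (intro add_mono y elim \<omega>(2)[OF f(1) sub f(2)])
        finally show ?case .
      qed
    qed
    then show ?thesis using tendsto_mult[OF tendsto_const, of "\<lambda>n. g (s n) (q k)" 0 sequentially "b k"] by simp
  qed simp
  \<comment> \<open>The sums equal \<open>f (s n) 0\<close>, whose modulus is at least 1/2, yet
    domination by the summable b forces them to 0.\<close>
  have "(\<lambda>n. \<integral>k. b k * g (s n) (q k) \<partial>count_space UNIV) \<longlonglongrightarrow> (\<integral>k. 0 \<partial>(count_space UNIV :: nat measure))"
  proof (rule integral_dominated_convergence[where w="\<lambda>k. cmod (b k)"])
    show "AE k in count_space UNIV. (\<lambda>n. b k * g (s n) (q k)) \<longlonglongrightarrow> 0" using pt by simp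
    show "AE k in count_space UNIV. norm (b k * g (s n) (q k)) \<le> cmod (b k)" for n
      using f(2) by (auto simp: norm_mult g_def intro!: mult_left_le)
  qed (use s(4) in auto)
  then have "(\<lambda>n. f (s n) 0) \<longlonglongrightarrow> 0"
    using rep[OF g] by (simp add: g_def)
  from tendsto_norm[OF this] have "1/2 \<le> norm (0::complex)"
    by (rule LIMSEQ_le_const) (use f(3) in auto)
  then show False by simp
qed

text \<open>If a ball about c lies in \<Lambda>, then v is the midpoint of c + v and -(c - v), both
  of which belong to \<Lambda>.\<close>

lemma convex_symmetric_absorbs:
  fixes \<Lambda> :: "'a::euclidean_space set"
  assumes cvx: "convex \<Lambda>" and sym: "\<forall>\<gamma>\<in>\<Lambda>. - \<gamma> \<in> \<Lambda>" and int: "interior \<Lambda> \<noteq> {}"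
  obtains \<rho> where "\<rho> > 0" "cball 0 \<rho> \<subseteq> \<Lambda>"
proof -
  obtain c e where ce: "e > 0" "cball c e \<subseteq> \<Lambda>"
    using int by (metis ex_in_conv mem_interior_cball)
  have "cball 0 e \<subseteq> \<Lambda>"
  proof
    fix v assume "v \<in> cball (0::'a) e"
    then have "c + v \<in> \<Lambda>" "c - v \<in> \<Lambda>" using ce(2) by (auto simp: dist_norm)
    then have "c + v \<in> \<Lambda>" "- (c - v) \<in> \<Lambda>" using sym by auto
    then have "(1/2) *\<^sub>R (c + v) + (1/2) *\<^sub>R (- (c - v)) \<in> \<Lambda>" by (intro convexD[OF cvx]) auto
    then show "v \<in> \<Lambda>" by (simp add: algebra_simps flip: scaleR_left_distrib)
  qed
  then show thesis using that ce(1) by blast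
qed

lemma fourier_frame_lower_bound:
  fixes E \<Lambda> :: "'a::euclidean_space set"
  assumes E: "separated E" "countable E" and bal: "balayage E \<Lambda>" and bnd: "bounded \<Lambda>"
    and cvx: "convex \<Lambda>" and sym: "\<forall>\<gamma>\<in>\<Lambda>. - \<gamma> \<in> \<Lambda>" and int: "interior \<Lambda> \<noteq> {}"
  shows "\<exists>A>0. \<forall>H. integrable lborel H \<longrightarrow> (\<forall>\<gamma>. \<gamma> \<notin> \<Lambda> \<longrightarrow> H \<gamma> = 0) \<longrightarrow>
     ennreal A * L2sq H \<le> (\<integral>\<^sup>+x. sqnorm (fourier1 H x) \<partial>count_space E)"
proof -
  obtain \<epsilon> K0 where \<epsilon>: "\<epsilon> > 0" and K0: "\<And>f y s. PWfun ((\<lambda>\<gamma>. (1 + \<epsilon>) *\<^sub>R \<gamma>) ` \<Lambda>) f \<Longrightarrow> 0 \<le> s \<Longrightarrow>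
      (\<forall>x\<in>E. cmod (f x) \<le> s) \<Longrightarrow> cmod (f y) \<le> K0 * s"
    using sampling_dilated[OF E bal bnd] by blast
  \<comment> \<open>Positivity matters where the sum \<open>S y\<close> is infinite: with K = 0 the
    product in \<open>ennreal\<close> would be 0 instead of \<infinity>.\<close>
  define K where "K = max K0 1"
  have Kpos: "K > 0" by (simp add: K_def)
  have K: "cmod (f y) \<le> K * s"
    if "PWfun ((\<lambda>\<gamma>. (1 + \<epsilon>) *\<^sub>R \<gamma>) ` \<Lambda>) f" "0 \<le> s" "\<forall>x\<in>E. cmod (f x) \<le> s" for f y s
    by (rule order.trans[OF K0[OF that]]) (use that(2) in \<open>auto simp: K_def intro: mult_right_mono\<close>)
  obtain \<rho> where \<rho>: "\<rho> > 0" "cball 0 \<rho> \<subseteq> \<Lambda>"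
    using convex_symmetric_absorbs[OF cvx sym int] by blast
  define b where "b = ball (0::'a) (\<epsilon> * \<rho>)"
  \<comment> \<open>With v / \<epsilon> in \<Lambda>, the sum u + v is 1 + \<epsilon> times a convex
    combination of u and v / \<epsilon>.\<close>
  have b_add: "u + v \<in> (\<lambda>\<gamma>. (1 + \<epsilon>) *\<^sub>R \<gamma>) ` \<Lambda>" if "u \<in> \<Lambda>" "v \<in> b" for u v
  proof -
    have "norm v \<le> \<epsilon> * \<rho>" using that(2) by (simp add: b_def)
    then have "(1 / \<epsilon>) *\<^sub>R v \<in> \<Lambda>" using \<rho>(2) \<epsilon> by (intro subsetD[OF \<rho>(2)]) (auto simp: field_simps)
    then have "(1 / (1 + \<epsilon>)) *\<^sub>R u + (\<epsilon> / (1 + \<epsilon>)) *\<^sub>R ((1 / \<epsilon>) *\<^sub>R v) \<in> \<Lambda>"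
      using that(1) \<epsilon> by (intro convexD[OF cvx]) (auto simp: field_simps)
    moreover have "u + v = (1 + \<epsilon>) *\<^sub>R ((1 / (1 + \<epsilon>)) *\<^sub>R u + (\<epsilon> / (1 + \<epsilon>)) *\<^sub>R ((1 / \<epsilon>) *\<^sub>R v))"
      using \<epsilon> by (simp add: scaleR_add_right)
    ultimately show ?thesis by (rule image_eqI[rotated])
  qed
  define V where "V = measure lborel b"
  have V: "V > 0" unfolding V_def b_def using \<epsilon> \<rho> by (intro content_ball_pos) auto
  define k :: "'a \<Rightarrow> complex" where "k = (\<lambda>x. complex_of_real (indicator b x))"
  have bm: "b \<in> sets borel" "emeasure lborel b < \<infinity>"
    using emeasure_lborel_ball_finite[of "0::'a" "\<epsilon> * \<rho>"] unfolding b_def by auto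
  have k: "integrable lborel k" "L2fun k"
    unfolding k_def using bm by (auto intro!: L2fun_indicator integrable_of_real)
  define h where "h = fourier1 k"
  have h: "PWfun b h" unfolding PWfun_def h_def by (intro exI[of _ k]) (use k in \<open>auto simp: k_def\<close>)
  have h0: "h 0 = of_real V" using bm by (simp add: h_def fourier1_def k_def V_def)
  have [measurable]: "h \<in> borel_measurable borel"
    using PWfun_continuous[OF h] by (rule borel_measurable_continuous_onI)
  obtain L where L: "L2sq h = ennreal L" "L \<ge> 0"
    using L2sq_eq_inner(2)[OF L2fun_fourier1[OF k]] by (simp add: h_def)
  \<comment> \<open>The summand 1 keeps the denominator positive without a lower bound for
    L.\<close>
  define A where "A = V\<^sup>2 / (K\<^sup>2 * L + 1)"
  have den: "K\<^sup>2 * L + 1 > 0" using L(2) by (intro add_nonneg_pos) auto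
  have A: "A > 0" using V den by (simp add: A_def)
  show ?thesis
  proof (intro exI[of _ A] conjI A allI impI)
    fix H :: "'a \<Rightarrow> complex" assume H: "integrable lborel H" "\<forall>\<gamma>. \<gamma> \<notin> \<Lambda> \<longrightarrow> H \<gamma> = 0"
    define f where "f = fourier1 H"
    have f: "PWfun \<Lambda> f" unfolding PWfun_def f_def using H by blast
    have [measurable]: "f \<in> borel_measurable borel"
      using PWfun_continuous[OF f] by (rule borel_measurable_continuous_onI)
    define S where "S = (\<lambda>y. \<integral>\<^sup>+x. sqnorm (f x) * sqnorm (h (x - y)) \<partial>count_space E)"
    \<comment> \<open>Sampling applied to f times the translate of h by y: each single sample is at
      most the square root of the full sum \<open>S y\<close>, and at y itself the product is V
      times \<open>f y\<close>.\<close>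
    have pt: "ennreal (V\<^sup>2) * sqnorm (f y) \<le> ennreal (K\<^sup>2) * S y" for y
    proof (cases "S y = top")
      case True
      then show ?thesis using Kpos by (simp add: ennreal_mult_top)
    next
      case False
      define s where "s = sqrt (enn2real (S y))"
      have Sy: "S y = ennreal (s\<^sup>2)" using False by (simp add: s_def less_top)
      have "cmod (f y * h (y + - y)) \<le> K * s"
      proof (rule K[where f="\<lambda>x. f x * h (x + - y)"])
        show "PWfun ((\<lambda>\<gamma>. (1 + \<epsilon>) *\<^sub>R \<gamma>) ` \<Lambda>) (\<lambda>x. f x * h (x + - y))"
          by (rule PWfun_mult[OF f PWfun_translate[OF h] b_add])
        show "0 \<le> s" by (simp add: s_def)
        show "\<forall>x\<in>E. cmod (f x * h (x + - y)) \<le> s"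
        proof
          fix x assume "x \<in> E"
          then have "sqnorm (f x) * sqnorm (h (x - y)) \<le> S y"
            unfolding S_def by (rule nn_integral_ge_point)
          then have "sqnorm (f x * h (x + - y)) \<le> ennreal (s\<^sup>2)"
            by (simp add: Sy norm_mult power_mult_distrib ennreal_mult)
          then have "(cmod (f x * h (x + - y)))\<^sup>2 \<le> s\<^sup>2" by (simp add: ennreal_le_iff)
          then show "cmod (f x * h (x + - y)) \<le> s" by (rule power2_le_imp_le) (simp add: s_def)
        qed
      qed
      then have "(cmod (f y) * V)\<^sup>2 \<le> (K * s)\<^sup>2"
        using V h0 by (intro power_mono) (auto simp: norm_mult)
      then have "ennreal (V\<^sup>2 * (cmod (f y))\<^sup>2) \<le> ennreal (K\<^sup>2 * s\<^sup>2)"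
        by (intro ennreal_leI) (simp add: power_mult_distrib mult.commute)
      then show ?thesis by (simp add: Sy ennreal_mult)
    qed
    have "ennreal (V\<^sup>2) * L2sq f = (\<integral>\<^sup>+y. ennreal (V\<^sup>2) * sqnorm (f y) \<partial>lborel)"
      unfolding L2sq_def by (simp add: nn_integral_cmult)
    also have "\<dots> \<le> (\<integral>\<^sup>+y. ennreal (K\<^sup>2) * S y \<partial>lborel)"
      using pt by (intro nn_integral_mono) simp
    also have "\<dots> = (\<integral>\<^sup>+y. (\<integral>\<^sup>+x. ennreal (K\<^sup>2) * (sqnorm (f x) * sqnorm (h (x - y))) \<partial>count_space E) \<partial>lborel)"
      unfolding S_def by (simp add: nn_integral_cmult)
    \<comment> \<open>Integrating in y first gives the energy L of h for every x, which leaves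
      exactly the sum of squares over E.\<close>
    also have "\<dots> = (\<integral>\<^sup>+x. (\<integral>\<^sup>+y. ennreal (K\<^sup>2) * (sqnorm (f x) * sqnorm (h (x - y))) \<partial>lborel) \<partial>count_space E)"
      by (rule nn_integral_count_space_nn_integral[OF E(2)]) measurable
    also have "\<dots> = (\<integral>\<^sup>+x. ennreal (K\<^sup>2) * (sqnorm (f x) * ennreal L) \<partial>count_space E)"
    proof (rule nn_integral_cong)
      fix x
      have "(\<integral>\<^sup>+y. sqnorm (h (x - y)) \<partial>lborel) = ennreal L"
        using nn_integral_lborel_reflect[of "\<lambda>y. sqnorm (h y)" x] L by (simp add: L2sq_def)
      then show "(\<integral>\<^sup>+y. ennreal (K\<^sup>2) * (sqnorm (f x) * sqnorm (h (x - y))) \<partial>lborel)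
          = ennreal (K\<^sup>2) * (sqnorm (f x) * ennreal L)"
        by (simp add: nn_integral_cmult)
    qed
    also have "\<dots> = (\<integral>\<^sup>+x. ennreal (K\<^sup>2 * L) * sqnorm (f x) \<partial>count_space E)"
      using L(2) by (simp add: ennreal_mult mult_ac)
    also have "\<dots> = ennreal (K\<^sup>2 * L) * (\<integral>\<^sup>+x. sqnorm (f x) \<partial>count_space E)"
      by (rule nn_integral_cmult) simp
    also have "\<dots> \<le> ennreal (K\<^sup>2 * L + 1) * (\<integral>\<^sup>+x. sqnorm (f x) \<partial>count_space E)"
      by (intro mult_right_mono ennreal_leI) auto
    finally have main: "ennreal (V\<^sup>2) * L2sq f \<le> ennreal (K\<^sup>2 * L + 1) * (\<integral>\<^sup>+x. sqnorm (f x) \<partial>count_space E)" .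
    have "ennreal A * L2sq H = ennreal (1 / (K\<^sup>2 * L + 1)) * (ennreal (V\<^sup>2) * L2sq f)"
      using den plancherel_L1[OF H(1)] by (simp add: A_def f_def mult.assoc[symmetric] ennreal_mult[symmetric])
    also have "\<dots> \<le> ennreal (1 / (K\<^sup>2 * L + 1)) * (ennreal (K\<^sup>2 * L + 1) * (\<integral>\<^sup>+x. sqnorm (f x) \<partial>count_space E))"
      by (rule mult_left_mono[OF main]) simp
    also have "\<dots> = (\<integral>\<^sup>+x. sqnorm (f x) \<partial>count_space E)"
      using den by (simp add: mult.assoc[symmetric] ennreal_mult[symmetric] del: ennreal_plus)
    finally show "ennreal A * L2sq H \<le> (\<integral>\<^sup>+x. sqnorm (fourier1 H x) \<partial>count_space E)"
      by (simp add: f_def)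
  qed
qed

subsection \<open>The short-time Fourier transform over a separated set\<close>

text \<open>Sum-integral comparison: the balls of radius \<delta>/2 about E are disjoint, and on
  each of them the summand is dominated by a wider Gaussian, uniformly in u.\<close>

lemma gaussian_sum_finite:
  fixes E :: "'a::euclidean_space set"
  assumes sep: "separated E" and E: "countable E"
  shows "(SUP u. \<integral>\<^sup>+ x. ennreal (exp (- (norm (x - u))\<^sup>2)) \<partial>count_space E) < \<infinity>"
proof -
  obtain \<delta> where \<delta>: "\<delta> > 0" "\<And>x y. x \<in> E \<Longrightarrow> y \<in> E \<Longrightarrow> x \<noteq> y \<Longrightarrow> \<delta> \<le> dist x y"
    using sep unfolding separated_def by blast
  define r where "r = \<delta> / 2"
  have r: "r > 0" using \<delta> by (simp add: r_def)
  define V where "V = measure lborel (ball (0::'a) r)"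
  have V: "V > 0" unfolding V_def using r by (rule content_ball_pos)
  have ball: "emeasure lborel (ball x r) = ennreal V" for x :: 'a
    using emeasure_lborel_ball_finite[of x r] content_ball_conv_unit_ball[of r x] content_ball_conv_unit_ball[of r "0::'a"] r
    by (simp add: emeasure_eq_ennreal_measure V_def)
  define G where "G = (\<lambda>w::'a. exp (- (norm w)\<^sup>2 / 2))"
  have [measurable]: "G \<in> borel_measurable borel" unfolding G_def by measurable
  define I where "I = (\<integral>\<^sup>+w. ennreal (G w) \<partial>lborel)"
  have I: "I < \<infinity>"
  proof -
    have "G = (\<lambda>w. gau (0 + (1 / sqrt (2 * pi)) *\<^sub>R w))"
      by (simp add: fun_eq_iff G_def gau_def power_mult_distrib power_divide)
    moreover have "integrable lborel (\<lambda>w::'a. gau (0 + (1 / sqrt (2 * pi)) *\<^sub>R w))"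
      by (rule integrable_lborel_affine[OF integrable_gau]) simp
    ultimately have "integrable lborel G" by simp
    then show ?thesis unfolding I_def integrable_iff_bounded by (simp add: G_def)
  qed
  \<comment> \<open>From |y - u|^2 \<le> 2 |x - u|^2 + 2 |y - x|^2 come the halved exponent in G and
    the factor exp(r^2).\<close>
  have key: "exp (- (norm (x - u))\<^sup>2) \<le> exp (r\<^sup>2) * G (y - u)" if "y \<in> ball x r" for x y u :: 'a
  proof -
    have "norm (y - u) \<le> norm (x - u) + norm (y - x)"
      using norm_triangle_ineq[of "x - u" "y - x"] by simp
    then have "(norm (y - u))\<^sup>2 \<le> (norm (x - u) + norm (y - x))\<^sup>2" by (intro power_mono) auto
    also have "\<dots> \<le> 2 * (norm (x - u))\<^sup>2 + 2 * (norm (y - x))\<^sup>2"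
      using sum_squares_bound[of "norm (x - u)" "norm (y - x)"] by (simp add: power2_sum)
    finally have *: "(norm (y - u))\<^sup>2 \<le> 2 * (norm (x - u))\<^sup>2 + 2 * (norm (y - x))\<^sup>2" .
    have "(norm (y - x))\<^sup>2 \<le> r\<^sup>2"
      using that by (intro power_mono) (auto simp: dist_norm norm_minus_commute)
    with * have "- (norm (x - u))\<^sup>2 \<le> r\<^sup>2 + - (norm (y - u))\<^sup>2 / 2" by simp
    then show ?thesis unfolding G_def by (simp flip: exp_add)
  qed
  have bound: "(\<integral>\<^sup>+ x. ennreal (exp (- (norm (x - u))\<^sup>2)) \<partial>count_space E) \<le> ennreal (1 / V) * (ennreal (exp (r\<^sup>2)) * I)" for u
  proof -
    \<comment> \<open>Separation: two balls containing y would have centres less than \<delta>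
      apart.\<close>
    have one: "(\<integral>\<^sup>+x. indicator (ball x r) y \<partial>count_space E) \<le> (1::ennreal)" for y
    proof (cases "\<exists>x0\<in>E. y \<in> ball x0 r")
      case True
      then obtain x0 where x0: "x0 \<in> E" "y \<in> ball x0 r" by blast
      have uniq: "x = x0" if "x \<in> E" "y \<in> ball x r" for x
      proof (rule ccontr)
        assume "x \<noteq> x0"
        from \<delta>(2)[OF that(1) x0(1) this] that(2) x0(2) dist_triangle2[of x x0 y] show False
          by (simp add: r_def)
      qed
      have "(\<integral>\<^sup>+x. indicator (ball x r) y \<partial>count_space E) = (\<integral>\<^sup>+x. indicator {x0} x \<partial>count_space E)"
      proof (rule nn_integral_cong)
        fix x assume "x \<in> space (count_space E)"
        then have "y \<in> ball x r \<longleftrightarrow> x = x0" using uniq[of x] x0(2) by (auto simp del: mem_ball)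
        then show "indicator (ball x r) y = (indicator {x0} x :: ennreal)"
          by (simp add: indicator_def del: mem_ball)
      qed
      then show ?thesis using x0(1) by simp
    next
      case False
      then have "(\<integral>\<^sup>+x. indicator (ball x r) y \<partial>count_space E) = (\<integral>\<^sup>+x. 0 \<partial>count_space E)"
        by (intro nn_integral_cong) (auto simp: indicator_def simp del: mem_ball)
      then show ?thesis by simp
    qed
    have "ennreal V * (\<integral>\<^sup>+ x. ennreal (exp (- (norm (x - u))\<^sup>2)) \<partial>count_space E)
        = (\<integral>\<^sup>+ x. (\<integral>\<^sup>+y. ennreal (exp (- (norm (x - u))\<^sup>2)) * indicator (ball x r) y \<partial>lborel) \<partial>count_space E)"
      by (simp add: nn_integral_cmult nn_integral_cmult_indicator ball mult.commute[of _ "ennreal V"])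
    also have "\<dots> \<le> (\<integral>\<^sup>+ x. (\<integral>\<^sup>+y. ennreal (exp (r\<^sup>2) * G (y - u)) * indicator (ball x r) y \<partial>lborel) \<partial>count_space E)"
      using key by (intro nn_integral_mono) (auto split: split_indicator intro: ennreal_leI)
    also have "\<dots> = (\<integral>\<^sup>+ y. (\<integral>\<^sup>+x. ennreal (exp (r\<^sup>2) * G (y - u)) * indicator (ball x r) y \<partial>count_space E) \<partial>lborel)"
    proof (rule nn_integral_count_space_nn_integral[OF E, symmetric])
      show "(\<lambda>y. ennreal (exp (r\<^sup>2) * G (y - u)) * indicator (ball x r) y) \<in> borel_measurable lborel" for x
        by (rule borel_measurable_times_ennreal[OF _ borel_measurable_indicator]) simp_all
    qed
    also have "\<dots> = (\<integral>\<^sup>+ y. ennreal (exp (r\<^sup>2) * G (y - u)) * (\<integral>\<^sup>+x. indicator (ball x r) y \<partial>count_space E) \<partial>lborel)"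
      by (intro nn_integral_cong nn_integral_cmult) simp
    also have "\<dots> \<le> (\<integral>\<^sup>+ y. ennreal (exp (r\<^sup>2) * G (y - u)) * 1 \<partial>lborel)"
      by (intro nn_integral_mono mult_left_mono one) auto
    also have "\<dots> = ennreal (exp (r\<^sup>2)) * I"
      using nn_integral_lborel_shift[of "\<lambda>y. ennreal (G y)" u]
      by (simp add: ennreal_mult G_def I_def nn_integral_cmult)
    finally have "ennreal (1 / V) * (ennreal V * (\<integral>\<^sup>+ x. ennreal (exp (- (norm (x - u))\<^sup>2)) \<partial>count_space E)) \<le> ennreal (1 / V) * (ennreal (exp (r\<^sup>2)) * I)"
      by (rule mult_left_mono) simp
    then show ?thesis using V by (simp add: mult.assoc[symmetric] ennreal_mult[symmetric])
  qed
  have "(SUP u. \<integral>\<^sup>+ x. ennreal (exp (- (norm (x - u))\<^sup>2)) \<partial>count_space E) \<le> ennreal (1 / V) * (ennreal (exp (r\<^sup>2)) * I)"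
    by (intro SUP_least bound)
  also have "\<dots> < \<infinity>" using I by (simp add: ennreal_mult_less_top)
  finally show ?thesis .
qed

section \<open>Positivity of the constant in (b)\<close>

lemma gaussian_sum_pos:
  fixes E :: "'a::euclidean_space set"
  assumes "E \<noteq> {}"
  shows "(SUP u. \<integral>\<^sup>+ x. ennreal (exp (- (norm (x - u))\<^sup>2)) \<partial>count_space E) > 0"
proof -
  obtain x0 where x0: "x0 \<in> E" using assms by blast
  have "(0::ennreal) < ennreal (exp (- (norm (x0 - x0))\<^sup>2))" by simp
  also have "\<dots> \<le> (\<integral>\<^sup>+ x. ennreal (exp (- (norm (x - x0))\<^sup>2)) \<partial>count_space E)"
    by (rule nn_integral_ge_point[OF x0])
  also have "\<dots> \<le> (SUP u. \<integral>\<^sup>+ x. ennreal (exp (- (norm (x - u))\<^sup>2)) \<partial>count_space E)"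
    by (rule SUP_upper) simp
  finally show ?thesis .
qed

text \<open>A measure carried by the empty set has no mass.\<close>

lemma strict_multiplicity_nonempty:
  fixes \<Lambda> :: "'a::euclidean_space set"
  assumes "strict_multiplicity \<Lambda>" shows "\<Lambda> \<noteq> {}"
proof
  assume \<Lambda>: "\<Lambda> = {}"
  obtain \<mu> :: "'a cmeasure" where \<mu>: "\<mu> \<in> Mb {}" "\<not> cm_zero \<mu>"
    using assms unfolding strict_multiplicity_def \<Lambda> by blast
  obtain m1 m2 m3 m4 where mu: "\<mu> = (m1, m2, m3, m4)" by (cases \<mu>)
  have "measure m A = 0" if "m \<in> {m1, m2, m3, m4}" for m A
  proof -
    have m: "fin_borel m" "emeasure m UNIV = 0" using \<mu>(1) that by (auto simp: Mb_def mu cm_parts_def)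
    then have "UNIV \<in> sets m" by (simp add: fin_borel_def)
    then have "emeasure m A \<le> emeasure m UNIV" by (rule emeasure_mono[rotated]) simp
    then show ?thesis using m by (simp add: measure_def)
  qed
  then show False using \<mu>(2) by (simp add: cm_zero_def cm_val_def mu)
qed

text \<open>The unit mass at 0 has transform 1 everywhere, while measures carried by the empty set
  have transform 0.\<close>

lemma balayage_nonempty:
  fixes E \<Lambda> :: "'a::euclidean_space set"
  assumes bal: "balayage E \<Lambda>" and \<Lambda>: "\<Lambda> \<noteq> {}"
  shows "E \<noteq> {}"
proof
  assume E: "E = {}"
  obtain \<gamma> where \<gamma>: "\<gamma> \<in> \<Lambda>" using \<Lambda> by blast
  define \<mu> :: "'a cmeasure" where "\<mu> = (return borel 0, null_measure borel, null_measure borel, null_measure borel)"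
  have nul: "fin_borel (null_measure borel :: 'a measure)"
    by (auto simp: fin_borel_def intro!: finite_measureI)
  have "fin_borel (return borel (0::'a))"
    by (auto simp: fin_borel_def intro!: finite_measureI)
  then have "\<mu> \<in> Mb UNIV" using nul by (auto simp: \<mu>_def Mb_def cm_parts_def)
  then obtain \<nu> where \<nu>: "\<nu> \<in> Mb E" "cm_fourier \<mu> \<gamma> = cm_fourier \<nu> \<gamma>"
    using bal \<gamma> unfolding balayage_def by blast
  obtain c where c: "\<And>f M. f \<in> borel_measurable borel \<Longrightarrow> (\<And>x. cmod (f x) \<le> M) \<Longrightarrow> cm_integral \<nu> f = (\<integral>x. c x * f x \<partial>count_space E)"
    using Mb_countable_rep[OF \<nu>(1)] E by blast
  have "cm_fourier \<nu> \<gamma> = (\<integral>x. c x * cis (- 2 * pi * (x \<bullet> \<gamma>)) \<partial>count_space E)"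
    unfolding cm_fourier_def by (rule c[where M=1]) auto
  also have "\<dots> = 0" using E by (simp add: lebesgue_integral_count_space_finite)
  finally have "cm_fourier \<mu> \<gamma> = 0" using \<nu>(2) by simp
  moreover have "cm_fourier \<mu> \<gamma> = 1"
    unfolding cm_fourier_def cm_integral_def \<mu>_def by (simp add: integral_return)
  ultimately show False by simp
qed

text \<open>For fixed x this is Plancherel for an integrable product of two L^2 functions. The
  product may fail to be square integrable; the identity then reads \<infinity> =
  \<infinity>.\<close>

lemma STFT_energy_slice:
  assumes f: "L2fun f" and g: "L2fun g"
  shows "(\<integral>\<^sup>+\<omega>. sqnorm (STFT g f x \<omega>) \<partial>lborel) = (\<integral>\<^sup>+t. sqnorm (f t) * sqnorm (g (t - x)) \<partial>lborel)"
    and "integrable lborel (\<lambda>t. f t * cnj (g (t - x)))"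
proof -
  have gs: "L2fun (\<lambda>t. g (t - x))" using g by (auto simp: L2fun_iff L2sq_shift)
  show i: "integrable lborel (\<lambda>t. f t * cnj (g (t - x)))"
    by (intro L2fun_mult_integrable f L2fun_cnj gs)
  show "(\<integral>\<^sup>+\<omega>. sqnorm (STFT g f x \<omega>) \<partial>lborel) = (\<integral>\<^sup>+t. sqnorm (f t) * sqnorm (g (t - x)) \<partial>lborel)"
    using plancherel_L1[OF i] unfolding STFT_eq_fourier1 L2sq_def
    by (simp add: norm_mult power_mult_distrib ennreal_mult)
qed

lemma STFT_measurable [measurable]:
  assumes [measurable]: "f \<in> borel_measurable borel" "g \<in> borel_measurable borel"
  shows "(\<lambda>p. STFT g f (fst p) (snd p)) \<in> borel_measurable (borel \<Otimes>\<^sub>M borel)"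
  unfolding STFT_def by measurable

text \<open>The frame bound is applied for each \<omega> to the integrable product of F with the
  shifted window.\<close>

lemma stft_lower_bound:
  fixes E \<Lambda> :: "'a::euclidean_space set"
  assumes E: "separated E" "countable E" and bal: "balayage E \<Lambda>" and cpt: "compact \<Lambda>"
    and cvx: "convex \<Lambda>" and sym: "\<forall>\<gamma>\<in>\<Lambda>. - \<gamma> \<in> \<Lambda>"
    and G: "L2fun G" "L2sq G = 1"
  shows "\<exists>A>0. \<forall>F. L2fun F \<longrightarrow> (AE \<gamma> in lborel. \<gamma> \<notin> \<Lambda> \<longrightarrow> F \<gamma> = 0) \<longrightarrow>
     ennreal A * L2sq F \<le> stft_energy E (\<lambda>x \<omega>. STFT G F \<omega> x)"
proof (cases "interior \<Lambda> = {}")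
  case True
  have "AE \<gamma> in lborel. \<gamma> \<notin> \<Lambda>"
  proof -
    have "\<Lambda> \<in> null_sets lebesgue"
      using True negligible_convex_interior[OF cvx] by (simp add: negligible_iff_null_sets)
    then have "\<Lambda> \<in> null_sets lborel"
      using cpt by (simp add: null_sets_completion_iff borel_compact)
    then show ?thesis by (rule AE_not_in)
  qed
  then have "L2sq F = 0" if "L2fun F" "AE \<gamma> in lborel. \<gamma> \<notin> \<Lambda> \<longrightarrow> F \<gamma> = 0" for F
    using that by (subst L2sq_eq_0_iff) (auto simp: L2fun_iff)
  then show ?thesis by (intro exI[of _ 1]) simp
next
  case False
  obtain A where A: "A > 0" and low: "\<And>H. integrable lborel H \<Longrightarrow> (\<forall>\<gamma>. \<gamma> \<notin> \<Lambda> \<longrightarrow> H \<gamma> = 0) \<Longrightarrow>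
     ennreal A * L2sq H \<le> (\<integral>\<^sup>+x. sqnorm (fourier1 H x) \<partial>count_space E)"
    using fourier_frame_lower_bound[OF E bal compact_imp_bounded[OF cpt] cvx sym False] by blast
  show ?thesis
  proof (intro exI[of _ A] conjI A allI impI)
    fix F :: "'a \<Rightarrow> complex" assume F: "L2fun F" "AE \<gamma> in lborel. \<gamma> \<notin> \<Lambda> \<longrightarrow> F \<gamma> = 0"
    have [measurable]: "F \<in> borel_measurable borel" "G \<in> borel_measurable borel" "\<Lambda> \<in> sets borel"
      using F G cpt by (auto simp: L2fun_iff borel_compact)
    \<comment> \<open>The frame bound asks for support in \<Lambda> at every point, while F vanishes
      off \<Lambda> only almost everywhere; the integrals do not see the change.\<close>
    define F0 where "F0 = (\<lambda>t. indicator \<Lambda> t *\<^sub>R F t)"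
    have [measurable]: "F0 \<in> borel_measurable borel" unfolding F0_def by measurable
    have F0: "AE t in lborel. F t = F0 t" using F(2) by (auto simp: F0_def elim!: eventually_mono)
    have sq: "L2sq F0 = L2sq F"
      unfolding L2sq_def using F0 by (intro nn_integral_cong_AE) (auto elim!: eventually_mono)
    have F0L: "L2fun F0" using F(1) sq by (auto simp: L2fun_iff)
    have st: "STFT G F \<omega> x = STFT G F0 \<omega> x" for \<omega> x
      unfolding STFT_def using F0 by (intro integral_cong_AE) (auto elim!: eventually_mono)
    \<comment> \<open>The norm of F is spread over \<omega>: each t sees the whole energy of the
      window, which is 1.\<close>
    have "ennreal A * L2sq F = ennreal A * (\<integral>\<^sup>+\<omega>. (\<integral>\<^sup>+t. sqnorm (F0 t) * sqnorm (G (t - \<omega>)) \<partial>lborel) \<partial>lborel)"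
    proof -
      have "(\<integral>\<^sup>+\<omega>. (\<integral>\<^sup>+t. sqnorm (F0 t) * sqnorm (G (t - \<omega>)) \<partial>lborel) \<partial>lborel)
          = (\<integral>\<^sup>+t. (\<integral>\<^sup>+\<omega>. sqnorm (F0 t) * sqnorm (G (t - \<omega>)) \<partial>lborel) \<partial>lborel)"
        by (rule lborel_pair.Fubini') measurable
      also have "\<dots> = (\<integral>\<^sup>+t. sqnorm (F0 t) * L2sq G \<partial>lborel)"
      proof (rule nn_integral_cong)
        fix t
        show "(\<integral>\<^sup>+\<omega>. sqnorm (F0 t) * sqnorm (G (t - \<omega>)) \<partial>lborel) = sqnorm (F0 t) * L2sq G"
          using nn_integral_lborel_reflect[of "\<lambda>y. sqnorm (G y)" t]
          by (simp add: nn_integral_cmult L2sq_def)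
      qed
      also have "\<dots> = L2sq F" using G(2) sq by (simp add: L2sq_def)
      finally show ?thesis by simp
    qed
    also have "\<dots> = (\<integral>\<^sup>+\<omega>. ennreal A * (\<integral>\<^sup>+t. sqnorm (F0 t) * sqnorm (G (t - \<omega>)) \<partial>lborel) \<partial>lborel)"
      by (rule nn_integral_cmult[symmetric]) measurable
    also have "\<dots> \<le> (\<integral>\<^sup>+\<omega>. (\<integral>\<^sup>+x. sqnorm (STFT G F0 \<omega> x) \<partial>count_space E) \<partial>lborel)"
    proof (rule nn_integral_mono)
      fix \<omega> :: 'a
      let ?H = "\<lambda>t. F0 t * cnj (G (t - \<omega>))"
      have "ennreal A * L2sq ?H \<le> (\<integral>\<^sup>+x. sqnorm (fourier1 ?H x) \<partial>count_space E)"
        by (rule low[OF STFT_energy_slice(2)[OF F0L G(1)]]) (auto simp: F0_def)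
      then show "ennreal A * (\<integral>\<^sup>+t. sqnorm (F0 t) * sqnorm (G (t - \<omega>)) \<partial>lborel)
          \<le> (\<integral>\<^sup>+x. sqnorm (STFT G F0 \<omega> x) \<partial>count_space E)"
        unfolding STFT_eq_fourier1 by (simp add: L2sq_def norm_mult power_mult_distrib ennreal_mult)
    qed
    also have "\<dots> = (\<integral>\<^sup>+x. (\<integral>\<^sup>+\<omega>. sqnorm (STFT G F0 \<omega> x) \<partial>lborel) \<partial>count_space E)"
      by (rule nn_integral_count_space_nn_integral[OF E(2)]) (unfold STFT_def, measurable)
    also have "\<dots> = stft_energy E (\<lambda>x \<omega>. STFT G F \<omega> x)"
      unfolding stft_energy_def st ..
    finally show "ennreal A * L2sq F \<le> stft_energy E (\<lambda>x \<omega>. STFT G F \<omega> x)" .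
  qed
qed

section \<open>The Gaussian window and the Feichtinger algebra\<close>

lemma cmod_gauss0: "cmod (gauss0 x) = 2 powr (real DIM('a) / 4) * gau x"
  for x :: "'a::euclidean_space"
  by (simp add: gauss0_def gau_def norm_mult)

lemma gauss0_measurable [measurable]: "gauss0 \<in> borel_measurable borel"
  unfolding gauss0_def by measurable

lemma cmod_gauss0_sq: "(cmod (gauss0 x))\<^sup>2 = 2 powr (real DIM('a) / 2) * gau (sqrt 2 *\<^sub>R x)"
  for x :: "'a::euclidean_space"
proof -
  have "(2 powr (real DIM('a) / 4))\<^sup>2 = 2 powr (real DIM('a) / 2)"
    by (simp add: power2_eq_square flip: powr_add)
  moreover have "(gau x)\<^sup>2 = gau (sqrt 2 *\<^sub>R x)"
    by (simp add: gau_def power_mult_distrib flip: exp_double)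
  ultimately show ?thesis by (simp add: cmod_gauss0 power_mult_distrib)
qed

lemma L2sq_gauss0: "L2sq (gauss0 :: 'a::euclidean_space \<Rightarrow> complex) = 1"
proof -
  have "1 = (\<integral>\<^sup>+x. ennreal (gau (x::'a)) \<partial>lborel)" by (simp add: nn_integral_gau)
  also have "\<dots> = ennreal (\<bar>sqrt 2\<bar> ^ DIM('a)) * (\<integral>\<^sup>+x. ennreal (gau (0 + sqrt 2 *\<^sub>R (x::'a))) \<partial>lborel)"
    by (rule nn_integral_lborel_affine) auto
  also have "\<bar>sqrt 2\<bar> ^ DIM('a) = 2 powr (real DIM('a) / 2)"
    by (simp add: powr_half_sqrt[symmetric] powr_powr flip: powr_realpow)
  also have "ennreal \<dots> * (\<integral>\<^sup>+x. ennreal (gau (0 + sqrt 2 *\<^sub>R (x::'a))) \<partial>lborel) = L2sq (gauss0 :: 'a \<Rightarrow> complex)"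
    unfolding L2sq_def cmod_gauss0_sq by (simp add: ennreal_mult gau_nonneg nn_integral_cmult)
  finally show ?thesis ..
qed

lemma L2fun_gauss0: "L2fun gauss0"
  by (simp add: L2fun_iff L2sq_gauss0)

text \<open>Finiteness at y says that the slice at y is integrable in frequency, which is what
  \<open>fourier1_inversion\<close> needs; integrating over y gives \<open>S0norm\<close>.\<close>

definition stft_marginal :: "('a::euclidean_space \<Rightarrow> complex) \<Rightarrow> 'a \<Rightarrow> ennreal" where
  "stft_marginal g y = (\<integral>\<^sup>+\<omega>. ennreal (cmod (STFT gauss0 g y \<omega>)) \<partial>lborel)"

lemma stft_marginal_measurable [measurable]:
  assumes [measurable]: "g \<in> borel_measurable borel"
  shows "stft_marginal g \<in> borel_measurable borel"
  unfolding stft_marginal_def STFT_def by measurable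

lemma S0norm_eq:
  assumes [measurable]: "g \<in> borel_measurable borel"
  shows "S0norm g = (\<integral>\<^sup>+y. stft_marginal g y \<partial>lborel)"
proof -
  have "(\<integral>\<^sup>+y. (\<integral>\<^sup>+\<omega>. (\<lambda>p. ennreal (cmod (STFT gauss0 g (fst p) (snd p)))) (y, \<omega>) \<partial>lborel) \<partial>lborel)
     = (\<integral>\<^sup>+p. ennreal (cmod (STFT gauss0 g (fst p) (snd p))) \<partial>(lborel \<Otimes>\<^sub>M lborel))"
    by (rule lborel.nn_integral_fst) measurable
  then show ?thesis by (simp add: S0norm_def stft_marginal_def)
qed

definition gauss_smooth :: "('a::euclidean_space \<Rightarrow> complex) \<Rightarrow> 'a \<Rightarrow> ennreal" where
  "gauss_smooth g t = (\<integral>\<^sup>+y. stft_marginal g y * ennreal (cmod (gauss0 (t - y))) \<partial>lborel)"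

lemma gauss_smooth_measurable [measurable]:
  assumes [measurable]: "g \<in> borel_measurable borel"
  shows "gauss_smooth g \<in> borel_measurable borel"
  unfolding gauss_smooth_def by measurable

text \<open>Inversion on the slice at y bounds |g(t)| times the window at t - y by the marginal at
  y. A second factor of the window, integrated over y, removes the first, since the window has L^2
  norm 1.\<close>

lemma Feichtinger_pointwise_bound:
  fixes g :: "'a::euclidean_space \<Rightarrow> complex"
  assumes g: "g \<in> Feichtinger"
  shows "AE t in lborel. ennreal (cmod (g t)) \<le> gauss_smooth g t"
proof -
  have gL: "L2fun g" and gS: "S0norm g < \<infinity>" using g by (auto simp: Feichtinger_def)
  have [measurable]: "g \<in> borel_measurable borel" using gL by (auto simp: L2fun_iff)
  have "AE y in lborel. stft_marginal g y \<noteq> \<infinity>"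
    using gS by (intro nn_integral_PInf_AE) (auto simp: S0norm_eq)
  then have "AE y in lborel. AE t in lborel. ennreal (cmod (g t)) * ennreal (cmod (gauss0 (t - y))) \<le> stft_marginal g y"
  proof eventually_elim
    case (elim y)
    let ?H = "\<lambda>t. g t * cnj (gauss0 (t - y))"
    have H: "integrable lborel ?H" by (rule STFT_energy_slice(2)[OF gL L2fun_gauss0])
    have fH: "integrable lborel (fourier1 ?H)"
      using elim unfolding integrable_iff_bounded stft_marginal_def STFT_eq_fourier1 by (auto simp: less_top)
    have "AE t in lborel. ?H t = fourier1 (fourier1 ?H) (- t)"
      by (rule fourier1_inversion[OF H fH])
    then show ?case
    proof eventually_elim
      case (elim t)
      have "ennreal (cmod (?H t)) \<le> ennreal (\<integral>x. cmod (fourier1 ?H x) \<partial>lborel)"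
        unfolding elim by (intro ennreal_leI norm_fourier1_le)
      also have "\<dots> = stft_marginal g y"
        unfolding stft_marginal_def STFT_eq_fourier1 using fH
        by (intro nn_integral_eq_integral[symmetric]) auto
      finally show ?case by (simp add: norm_mult ennreal_mult)
    qed
  qed
  \<comment> \<open>The null set of t depended on y; exchanging the quantifiers gives one null set
    of t, for whose complement the bound can be integrated over y.\<close>
  then have "AE t in lborel. AE y in lborel. ennreal (cmod (g t)) * ennreal (cmod (gauss0 (t - y))) \<le> stft_marginal g y"
    by (subst lborel_pair.AE_commute) measurable
  then show ?thesis
  proof eventually_elim
    case (elim t)
    have "(\<integral>\<^sup>+y. sqnorm (gauss0 (t - y)) \<partial>lborel) = 1"
      using nn_integral_lborel_reflect[of "\<lambda>y. sqnorm (gauss0 y)" t] L2sq_gauss0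
      by (simp add: L2sq_def)
    then have "ennreal (cmod (g t)) = (\<integral>\<^sup>+y. ennreal (cmod (g t)) * sqnorm (gauss0 (t - y)) \<partial>lborel)"
      by (simp add: nn_integral_cmult)
    also have "\<dots> = (\<integral>\<^sup>+y. (ennreal (cmod (g t)) * ennreal (cmod (gauss0 (t - y)))) * ennreal (cmod (gauss0 (t - y))) \<partial>lborel)"
      by (simp add: power2_eq_square ennreal_mult mult.assoc)
    also have "\<dots> \<le> gauss_smooth g t"
      unfolding gauss_smooth_def using elim
      by (intro nn_integral_mono_AE) (auto elim!: eventually_mono intro: mult_right_mono)
    finally show ?case .
  qed
qed

text \<open>A vanishing norm would make the majorant \<open>gauss_smooth g\<close> of |g| vanish as
  well.\<close>

lemma Feichtinger_S0norm_pos: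
  assumes g: "g \<in> Feichtinger" and g1: "L2sq g \<noteq> 0"
  shows "S0norm g > 0"
proof (rule ccontr)
  assume "\<not> S0norm g > 0"
  have [measurable]: "g \<in> borel_measurable borel" using g by (auto simp: Feichtinger_def L2fun_iff)
  have "(\<integral>\<^sup>+y. stft_marginal g y \<partial>lborel) = 0" using \<open>\<not> S0norm g > 0\<close> by (simp add: S0norm_eq not_gr_zero)
  then have "AE y in lborel. stft_marginal g y = 0" by (subst (asm) nn_integral_0_iff_AE) auto
  then have "gauss_smooth g t = 0" for t
    unfolding gauss_smooth_def by (subst nn_integral_0_iff_AE) (auto elim!: eventually_mono)
  then have "AE t in lborel. g t = 0"
    using Feichtinger_pointwise_bound[OF g] by (auto elim!: eventually_mono)
  then show False using g1 by (simp add: L2sq_eq_0_iff)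
qed

text \<open>Cauchy-Schwarz moves the square from the convolution onto the window alone; the sum over
  E then meets only Gaussians and is bounded uniformly in t and y.\<close>

lemma gauss_smooth_sq_sum:
  fixes E :: "'a::euclidean_space set"
  assumes E: "countable E" and [measurable]: "g \<in> borel_measurable borel"
  defines "C \<equiv> (SUP u. \<integral>\<^sup>+ x. ennreal (exp (- (norm (x - u))\<^sup>2)) \<partial>count_space E)"
  shows "(\<integral>\<^sup>+x. (gauss_smooth g (t - x))\<^sup>2 \<partial>count_space E) \<le> ennreal (2 powr (real DIM('a) / 2)) * C * (S0norm g)\<^sup>2"
proof -
  let ?\<Phi> = "stft_marginal g"
  have cs: "(gauss_smooth g s)\<^sup>2 \<le> S0norm g * (\<integral>\<^sup>+y. ?\<Phi> y * sqnorm (gauss0 (s - y)) \<partial>lborel)" for s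
  proof -
    \<comment> \<open>Cauchy-Schwarz with the constant 1 in the measure with density the marginal,
      whose total mass is \<open>S0norm g\<close>.\<close>
    have "(\<integral>\<^sup>+y. 1 * ennreal (cmod (gauss0 (s - y))) \<partial>density lborel ?\<Phi>)\<^sup>2
       \<le> (\<integral>\<^sup>+y. 1\<^sup>2 \<partial>density lborel ?\<Phi>) * (\<integral>\<^sup>+y. (ennreal (cmod (gauss0 (s - y))))\<^sup>2 \<partial>density lborel ?\<Phi>)"
      by (rule Cauchy_Schwarz_nn_integral) measurable
    then show ?thesis
      unfolding gauss_smooth_def S0norm_eq[OF assms(2)]
      by (simp add: nn_integral_density emeasure_density ennreal_power)
  qed
  have sum: "(\<integral>\<^sup>+x. sqnorm (gauss0 (t - x - y)) \<partial>count_space E) \<le> ennreal (2 powr (real DIM('a) / 2)) * C" for y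
  proof -
    have "(\<integral>\<^sup>+x. sqnorm (gauss0 (t - x - y)) \<partial>count_space E)
        \<le> (\<integral>\<^sup>+x. ennreal (2 powr (real DIM('a) / 2)) * ennreal (exp (- (norm (x - (t - y)))\<^sup>2)) \<partial>count_space E)"
    proof (rule nn_integral_mono)
      fix x
      have "gau (sqrt 2 *\<^sub>R (t - x - y)) \<le> exp (- (norm (x - (t - y)))\<^sup>2)"
      proof -
        have n: "norm (t - x - y) = norm (x - (t - y))" by (metis diff_diff_eq diff_diff_eq2 norm_minus_commute add.commute)
        \<comment> \<open>The squared window decays like exp(-2 pi |.|^2); weakening 2 pi to 1
          yields the Gaussian in C.\<close>
        have "1 * (norm (x - (t - y)))\<^sup>2 \<le> (pi * 2) * (norm (x - (t - y)))\<^sup>2"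
          using pi_ge_two by (intro mult_right_mono) auto
        then show ?thesis by (simp add: gau_def power_mult_distrib n)
      qed
      then have "(cmod (gauss0 (t - x - y)))\<^sup>2 \<le> 2 powr (real DIM('a) / 2) * exp (- (norm (x - (t - y)))\<^sup>2)"
        unfolding cmod_gauss0_sq by (intro mult_left_mono) auto
      then show "sqnorm (gauss0 (t - x - y)) \<le> ennreal (2 powr (real DIM('a) / 2)) * ennreal (exp (- (norm (x - (t - y)))\<^sup>2))"
        by (simp add: ennreal_leI flip: ennreal_mult)
    qed
    also have "\<dots> = ennreal (2 powr (real DIM('a) / 2)) * (\<integral>\<^sup>+x. ennreal (exp (- (norm (x - (t - y)))\<^sup>2)) \<partial>count_space E)"
      by (rule nn_integral_cmult) simp
    also have "\<dots> \<le> ennreal (2 powr (real DIM('a) / 2)) * C"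
      unfolding C_def by (intro mult_left_mono SUP_upper) auto
    finally show ?thesis .
  qed
  have "(\<integral>\<^sup>+x. (gauss_smooth g (t - x))\<^sup>2 \<partial>count_space E)
      \<le> (\<integral>\<^sup>+x. S0norm g * (\<integral>\<^sup>+y. ?\<Phi> y * sqnorm (gauss0 (t - x - y)) \<partial>lborel) \<partial>count_space E)"
    by (intro nn_integral_mono cs)
  also have "\<dots> = S0norm g * (\<integral>\<^sup>+x. (\<integral>\<^sup>+y. ?\<Phi> y * sqnorm (gauss0 (t - x - y)) \<partial>lborel) \<partial>count_space E)"
    by (rule nn_integral_cmult) simp
  also have "\<dots> \<le> S0norm g * (S0norm g * (ennreal (2 powr (real DIM('a) / 2)) * C))"
  proof (rule mult_left_mono)
    have "(\<integral>\<^sup>+x. (\<integral>\<^sup>+y. ?\<Phi> y * sqnorm (gauss0 (t - x - y)) \<partial>lborel) \<partial>count_space E)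
       = (\<integral>\<^sup>+y. (\<integral>\<^sup>+x. ?\<Phi> y * sqnorm (gauss0 (t - x - y)) \<partial>count_space E) \<partial>lborel)"
      by (rule nn_integral_count_space_nn_integral[OF E, symmetric]) measurable
    also have "\<dots> = (\<integral>\<^sup>+y. ?\<Phi> y * (\<integral>\<^sup>+x. sqnorm (gauss0 (t - x - y)) \<partial>count_space E) \<partial>lborel)"
      by (intro nn_integral_cong nn_integral_cmult) simp
    also have "\<dots> \<le> (\<integral>\<^sup>+y. ?\<Phi> y * (ennreal (2 powr (real DIM('a) / 2)) * C) \<partial>lborel)"
      by (intro nn_integral_mono mult_left_mono sum) auto
    also have "\<dots> = S0norm g * (ennreal (2 powr (real DIM('a) / 2)) * C)"
      by (simp add: nn_integral_multc S0norm_eq)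
    finally show "(\<integral>\<^sup>+x. (\<integral>\<^sup>+y. ?\<Phi> y * sqnorm (gauss0 (t - x - y)) \<partial>lborel) \<partial>count_space E)
       \<le> S0norm g * (ennreal (2 powr (real DIM('a) / 2)) * C)" .
  qed simp
  finally show ?thesis
    by (simp add: power2_eq_square mult_ac)
qed

text \<open>After Plancherel on each slice the sum over E acts on the window alone, with a bound
  uniform in t, so f enters only through its norm.\<close>

lemma stft_upper_bound:
  fixes E :: "'a::euclidean_space set"
  assumes E: "countable E" and g: "g \<in> Feichtinger" and f: "L2fun f"
  defines "C \<equiv> (SUP u. \<integral>\<^sup>+ x. ennreal (exp (- (norm (x - u))\<^sup>2)) \<partial>count_space E)"
  shows "stft_energy E (\<lambda>x \<omega>. STFT g f x \<omega>) \<le> ennreal (2 powr (real DIM('a) / 2)) * C * (S0norm g)\<^sup>2 * L2sq f"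
proof -
  have gL: "L2fun g" using g by (auto simp: Feichtinger_def)
  have [measurable]: "g \<in> borel_measurable borel" "f \<in> borel_measurable borel" using gL f by (auto simp: L2fun_iff)
  let ?u = "gauss_smooth g"
  have slice: "(\<integral>\<^sup>+\<omega>. sqnorm (STFT g f x \<omega>) \<partial>lborel) \<le> (\<integral>\<^sup>+t. sqnorm (f t) * (?u (t - x))\<^sup>2 \<partial>lborel)" for x
  proof -
    \<comment> \<open>Shifting t by x and back lets the almost-everywhere bound be used at
      \<open>g t\<close> itself, without translating its null set.\<close>
    have "(\<integral>\<^sup>+\<omega>. sqnorm (STFT g f x \<omega>) \<partial>lborel)
        = (\<integral>\<^sup>+t. sqnorm (f ((t - x) + x)) * sqnorm (g (t - x)) \<partial>lborel)"
      by (simp add: STFT_energy_slice(1)[OF f gL])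
    also have "\<dots> = (\<integral>\<^sup>+t. sqnorm (f (t + x)) * sqnorm (g t) \<partial>lborel)"
      by (rule nn_integral_lborel_shift[where f="\<lambda>t. sqnorm (f (t + x)) * sqnorm (g t)"]) measurable
    also have "\<dots> \<le> (\<integral>\<^sup>+t. sqnorm (f (t + x)) * (?u t)\<^sup>2 \<partial>lborel)"
    proof (rule nn_integral_mono_AE, use Feichtinger_pointwise_bound[OF g] in eventually_elim)
      fix t assume "ennreal (cmod (g t)) \<le> ?u t"
      then have "(ennreal (cmod (g t)))\<^sup>2 \<le> (?u t)\<^sup>2" by (rule power_mono) simp
      then show "sqnorm (f (t + x)) * sqnorm (g t) \<le> sqnorm (f (t + x)) * (?u t)\<^sup>2"
        by (intro mult_left_mono) (auto simp: ennreal_power)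
    qed
    also have "\<dots> = (\<integral>\<^sup>+t. sqnorm (f ((t - x) + x)) * (?u (t - x))\<^sup>2 \<partial>lborel)"
      by (rule nn_integral_lborel_shift[symmetric, where f="\<lambda>t. sqnorm (f (t + x)) * (?u t)\<^sup>2"]) measurable
    finally show ?thesis by simp
  qed
  have "stft_energy E (\<lambda>x \<omega>. STFT g f x \<omega>)
      \<le> (\<integral>\<^sup>+x. (\<integral>\<^sup>+t. sqnorm (f t) * (?u (t - x))\<^sup>2 \<partial>lborel) \<partial>count_space E)"
    unfolding stft_energy_def by (intro nn_integral_mono slice)
  also have "\<dots> = (\<integral>\<^sup>+t. (\<integral>\<^sup>+x. sqnorm (f t) * (?u (t - x))\<^sup>2 \<partial>count_space E) \<partial>lborel)"
    by (rule nn_integral_count_space_nn_integral[OF E, symmetric]) measurable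
  also have "\<dots> = (\<integral>\<^sup>+t. sqnorm (f t) * (\<integral>\<^sup>+x. (?u (t - x))\<^sup>2 \<partial>count_space E) \<partial>lborel)"
    by (intro nn_integral_cong nn_integral_cmult) simp
  also have "\<dots> \<le> (\<integral>\<^sup>+t. sqnorm (f t) * (ennreal (2 powr (real DIM('a) / 2)) * C * (S0norm g)\<^sup>2) \<partial>lborel)"
    unfolding C_def by (intro nn_integral_mono mult_left_mono gauss_smooth_sq_sum E) auto
  also have "\<dots> = ennreal (2 powr (real DIM('a) / 2)) * C * (S0norm g)\<^sup>2 * L2sq f"
    by (simp add: nn_integral_multc L2sq_def mult.commute)
  finally show ?thesis .
qed

theorem theorem3p2:
  fixes E \<Lambda> :: "'a::euclidean_space set" and g G :: "'a \<Rightarrow> complex"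
  assumes sepE: "separated E" and countE: "countable E"
    and symE: "\<forall>x\<in>E. - x \<in> E"
    and Sset: "S_set \<Lambda>" and strict: "strict_multiplicity \<Lambda>"
    and cpt: "compact \<Lambda>" and cvx: "convex \<Lambda>" and symL: "\<forall>\<gamma>\<in>\<Lambda>. - \<gamma> \<in> \<Lambda>"
    and bal: "balayage E \<Lambda>"
    and gL2: "L2fun g" and gG: "is_fourier_L2 g G" and gnorm: "L2sq g = 1"
  shows
    "(\<exists>A>0. \<forall>f \<in> PW \<Lambda> - {\<lambda>_. 0}. \<forall>F. is_fourier_L2 f F \<longrightarrow>
        ennreal A * L2sq f = ennreal A * L2sq F \<and>
        ennreal A * L2sq F \<le> stft_energy E (\<lambda>x \<omega>. STFT G F \<omega> x) \<and>
        stft_energy E (\<lambda>x \<omega>. STFT G F \<omega> x) = stft_energy E (\<lambda>x \<omega>. STFT g f x \<omega>))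
     \<and>
     (g \<in> Feichtinger \<longrightarrow>
       (let C = (SUP u. \<integral>\<^sup>+ x. ennreal (exp (- (norm (x - u))\<^sup>2)) \<partial>count_space E);
            B = ennreal (2 powr (real DIM('a) / 2)) * C * (S0norm g)\<^sup>2
        in 0 < B \<and> B < \<infinity> \<and>
          (\<forall>f \<in> PW \<Lambda> - {\<lambda>_. 0}. \<forall>F. is_fourier_L2 f F \<longrightarrow>
             stft_energy E (\<lambda>x \<omega>. STFT g f x \<omega>) = stft_energy E (\<lambda>x \<omega>. STFT G F \<omega> (- x)) \<and>
             stft_energy E (\<lambda>x \<omega>. STFT G F \<omega> (- x)) \<le> B * L2sq F \<and>
             B * L2sq F = B * L2sq f)))"
proof -
  have gFT: "FT2 g G" by (rule is_fourier_L2_FT2[OF gL2 gG])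
  have G: "L2fun G" "L2sq G = 1" using gFT FT2_L2sq[OF gFT] gnorm by (auto simp: FT2_def)
  have L2: "L2fun f" if "f \<in> PW \<Lambda>" for f using that by (simp add: PW_def)
  have eqn: "L2sq f = L2sq F" if "f \<in> PW \<Lambda>" "is_fourier_L2 f F" for f F
    by (rule FT2_L2sq[OF is_fourier_L2_FT2[OF L2[OF that(1)] that(2)]])
  have supp: "AE \<gamma> in lborel. \<gamma> \<notin> \<Lambda> \<longrightarrow> F \<gamma> = 0" if f: "f \<in> PW \<Lambda>" and F: "is_fourier_L2 f F" for f F
  proof -
    obtain F' where F': "is_fourier_L2 f F'" "AE \<gamma> in lborel. \<gamma> \<notin> \<Lambda> \<longrightarrow> F' \<gamma> = 0"
      using f by (auto simp: PW_def)
    show ?thesis using is_fourier_L2_unique[OF L2[OF f] F F'(1)] F'(2) by eventually_elim simp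
  qed
  have refl: "stft_energy E (\<lambda>x \<omega>. STFT g f x \<omega>) = stft_energy E (\<lambda>x \<omega>. STFT G F \<omega> (- x))"
    if "f \<in> PW \<Lambda>" "is_fourier_L2 f F" for f F
    unfolding stft_energy_def cmod_STFT_eq[OF is_fourier_L2_FT2[OF L2[OF that(1)] that(2)] gFT] ..
  have sym: "stft_energy E (\<lambda>x \<omega>. STFT G F \<omega> (- x)) = stft_energy E (\<lambda>x \<omega>. STFT G F \<omega> x)" for F
    by (rule stft_energy_reflect[OF symE, where V="\<lambda>x \<omega>. STFT G F \<omega> x"])
  obtain A where A: "A > 0" "\<And>F. L2fun F \<Longrightarrow> (AE \<gamma> in lborel. \<gamma> \<notin> \<Lambda> \<longrightarrow> F \<gamma> = 0) \<Longrightarrow>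
     ennreal A * L2sq F \<le> stft_energy E (\<lambda>x \<omega>. STFT G F \<omega> x)"
    using stft_lower_bound[OF sepE countE bal cpt cvx symL G] by blast
  have a: "\<exists>A>0. \<forall>f \<in> PW \<Lambda> - {\<lambda>_. 0}. \<forall>F. is_fourier_L2 f F \<longrightarrow>
        ennreal A * L2sq f = ennreal A * L2sq F \<and>
        ennreal A * L2sq F \<le> stft_energy E (\<lambda>x \<omega>. STFT G F \<omega> x) \<and>
        stft_energy E (\<lambda>x \<omega>. STFT G F \<omega> x) = stft_energy E (\<lambda>x \<omega>. STFT g f x \<omega>)"
  proof (intro exI[of _ A] conjI A(1) ballI allI impI)
    fix f F assume "f \<in> PW \<Lambda> - {\<lambda>_. 0}" and F: "is_fourier_L2 f F"
    then have f: "f \<in> PW \<Lambda>" by simp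
    show "ennreal A * L2sq f = ennreal A * L2sq F" using eqn[OF f F] by simp
    show "ennreal A * L2sq F \<le> stft_energy E (\<lambda>x \<omega>. STFT G F \<omega> x)"
      using F by (intro A(2) supp[OF f F]) (simp add: is_fourier_L2_def)
    show "stft_energy E (\<lambda>x \<omega>. STFT G F \<omega> x) = stft_energy E (\<lambda>x \<omega>. STFT g f x \<omega>)"
      using refl[OF f F] sym by simp
  qed
  define C where "C = (SUP u. \<integral>\<^sup>+ x. ennreal (exp (- (norm (x - u))\<^sup>2)) \<partial>count_space E)"
  define B where "B = ennreal (2 powr (real DIM('a) / 2)) * C * (S0norm g)\<^sup>2"
  have b: "0 < B \<and> B < \<infinity> \<and>
          (\<forall>f \<in> PW \<Lambda> - {\<lambda>_. 0}. \<forall>F. is_fourier_L2 f F \<longrightarrow>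
             stft_energy E (\<lambda>x \<omega>. STFT g f x \<omega>) = stft_energy E (\<lambda>x \<omega>. STFT G F \<omega> (- x)) \<and>
             stft_energy E (\<lambda>x \<omega>. STFT G F \<omega> (- x)) \<le> B * L2sq F \<and>
             B * L2sq F = B * L2sq f)" if gF: "g \<in> Feichtinger"
  proof (intro conjI ballI allI impI)
    \<comment> \<open>An empty E would make C, and with it B, equal to 0.\<close>
    have "E \<noteq> {}" by (rule balayage_nonempty[OF bal strict_multiplicity_nonempty[OF strict]])
    then have "C > 0" unfolding C_def by (rule gaussian_sum_pos)
    moreover have "S0norm g > 0" by (rule Feichtinger_S0norm_pos[OF gF]) (simp add: gnorm)
    ultimately show "0 < B" by (simp add: B_def ennreal_zero_less_mult_iff zero_less_iff_neq_zero)
    have "C < \<infinity>" unfolding C_def by (rule gaussian_sum_finite[OF sepE countE])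
    moreover have "S0norm g < \<infinity>" using gF by (simp add: Feichtinger_def)
    ultimately show "B < \<infinity>" by (simp add: B_def ennreal_mult_less_top power_less_top_ennreal)
    fix f F assume "f \<in> PW \<Lambda> - {\<lambda>_. 0}" and F: "is_fourier_L2 f F"
    then have f: "f \<in> PW \<Lambda>" by simp
    show *: "stft_energy E (\<lambda>x \<omega>. STFT g f x \<omega>) = stft_energy E (\<lambda>x \<omega>. STFT G F \<omega> (- x))"
      by (rule refl[OF f F])
    show "B * L2sq F = B * L2sq f" using eqn[OF f F] by simp
    show "stft_energy E (\<lambda>x \<omega>. STFT G F \<omega> (- x)) \<le> B * L2sq F"
      using stft_upper_bound[OF countE gF L2[OF f]] eqn[OF f F] unfolding * B_def C_def by simp
  qed
  show ?thesis
    using a b unfolding Let_def B_def C_def by blast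
qed

end
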